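(* There is an absolute constant $c>0$ such that the following holds for every positive integer $d$. Let $\mathcal{C}_1,\dots,\mathcal{C}_{3d}$ be finite families of convex bodies in $\mathbb{R}^d$. Assume that for any indices $1\leq i_1<\dots<i_{2d}\leq 3d$ and any selection of sets $C_{i_k}\in\mathcal{C}_{i_k}$ ($1\leq k\leq 2d$), the intersection $\bigcap_{k=1}^{2d} C_{i_k}$ contains an ellipsoid of volume at least $1$. Then there exists $1\leq i\leq 3d$ such that $\bigcap_{C\in\mathcal{C}_i} C$ contains an ellipsoid of volume at least $c^{d^2}d^{-5d^2/2}$.
   Context: A convex body in $\mathbb{R}^d$ is a compact convex set with non-empty interior. An ellipsoid is an image of the closed Euclidean unit ball under a non-singular affine map. Volume is $d$-dimensional Lebesgue measure. An absolute constant does not depend on $d$ or on the families. *)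

theory Defs
  imports "HOL-Analysis.Analysis" "Jordan_Normal_Form.Matrix"
begin

text \<open>
  The constant of the theorem must not depend on the dimension, so the dimension \<open>d\<close> has to be a
  number quantified inside the formula rather than a type. Therefore \<open>\<real>\<^sup>d\<close> is the space of functions
  \<open>nat \<Rightarrow> real\<close> on the index set \<open>{..<d}\<close> that are \<open>undefined\<close> elsewhere. This is at
  once the carrier of the product topology and of the product measure of the library.
\<close>

definition Rd :: "nat \<Rightarrow> (nat \<Rightarrow> real) set" where
  "Rd d = {..<d} \<rightarrow>\<^sub>E UNIV"

definition Rd_topology :: "nat \<Rightarrow> (nat \<Rightarrow> real) topology" where
  "Rd_topology d = product_topology (\<lambda>_. euclideanreal) {..<d}"

definition Rd_lebesgue :: "nat \<Rightarrow> (nat \<Rightarrow> real) measure" where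
  "Rd_lebesgue d = completion (Pi\<^sub>M {..<d} (\<lambda>_. lborel))"

lemma topspace_Rd_topology [simp]: "topspace (Rd_topology d) = Rd d"
  by (simp add: Rd_topology_def Rd_def)

lemma space_Rd_lebesgue [simp]: "space (Rd_lebesgue d) = Rd d"
  by (simp add: Rd_lebesgue_def Rd_def space_PiM)

text \<open>
  The library predicate \<open>convex\<close> needs an instance of \<open>real_vector\<close>, which functions
  \<open>nat \<Rightarrow> real\<close> are not; the following is its definition with coordinatewise operations.
\<close>

definition convex_Rd :: "nat \<Rightarrow> (nat \<Rightarrow> real) set \<Rightarrow> bool" where
  "convex_Rd d K \<longleftrightarrow>
     (\<forall>x\<in>K. \<forall>y\<in>K. \<forall>u\<ge>0. \<forall>v\<ge>0. u + v = 1 \<longrightarrow> (\<lambda>i\<in>{..<d}. u * x i + v * y i) \<in> K)"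

definition convex_body :: "nat \<Rightarrow> (nat \<Rightarrow> real) set \<Rightarrow> bool" where
  "convex_body d K \<longleftrightarrow>
     compactin (Rd_topology d) K \<and> convex_Rd d K \<and> Rd_topology d interior_of K \<noteq> {}"

definition unit_ball_Rd :: "nat \<Rightarrow> (nat \<Rightarrow> real) set" where
  "unit_ball_Rd d = {x \<in> Rd d. L2_set x {..<d} \<le> 1}"

definition affine_map_Rd :: "nat \<Rightarrow> real mat \<Rightarrow> (nat \<Rightarrow> real) \<Rightarrow> (nat \<Rightarrow> real) \<Rightarrow> (nat \<Rightarrow> real)" where
  "affine_map_Rd d A b x = (\<lambda>i\<in>{..<d}. (\<Sum>j<d. A $$ (i, j) * x j) + b i)"

definition ellipsoid :: "nat \<Rightarrow> (nat \<Rightarrow> real) set \<Rightarrow> bool" where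
  "ellipsoid d E \<longleftrightarrow>
     (\<exists>A\<in>carrier_mat d d. \<exists>b\<in>Rd d. invertible_mat A \<and> E = affine_map_Rd d A b ` unit_ball_Rd d)"

definition contains_ellipsoid_of_volume_at_least ::
    "nat \<Rightarrow> real \<Rightarrow> (nat \<Rightarrow> real) set \<Rightarrow> bool" where
  "contains_ellipsoid_of_volume_at_least d v S \<longleftrightarrow>
     (\<exists>E. ellipsoid d E \<and> E \<subseteq> S \<and> measure (Rd_lebesgue d) E \<ge> v)"

end

theory Submission
  imports Defs "Jordan_Normal_Form.Determinant"
begin

text \<open>
  An ellipsoid \<open>A B + b\<close>, with \<open>B\<close> the unit ball, has volume \<open>\<bar>det A\<bar> vol B\<close>, so all volumes are measured
  by determinants. Call an ellipsoid large if its volume is at least \<open>1\<close>.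

  Sweep a half-space \<open>H = {x\<^sub>0 \<le> s}\<close> upwards until, for every choice of \<open>2d - 1\<close> bodies from
  different families, the intersection of these bodies with \<open>H\<close> contains a large ellipsoid. Just
  before that moment some choice \<open>K\<^sub>0\<close> fails. An ellipsoid that is shrunk by one half towards its lowest
  point loses height, so no ellipsoid in \<open>M = \<Inter>K\<^sub>0 \<inter> H\<close> has volume \<open>2\<^sup>d\<close> or more. The families
  that do not occur in \<open>K\<^sub>0\<close> are \<open>d + 1\<close> in number. Choose one body \<open>F\<^sub>i\<close> from each of them. Any \<open>2d\<close> of the
  sets \<open>F\<^sub>i\<close>, the members of \<open>K\<^sub>0\<close>, and \<open>H\<close> share a large ellipsoid, either by the hypothesis or by the
  choice of \<open>H\<close>. By a quantitative Helly theorem (\<open>quantitative_Helly\<close>) all of them share an ellipsoid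
  \<open>E\<close> of volume at least \<open>\<delta> = (54 d\<^sup>5\<^sup>/\<^sup>2)\<^sup>-\<^sup>d\<close>. It lies in \<open>M\<close>, as does a large ellipsoid \<open>T\<close> that depends
  on \<open>K\<^sub>0\<close> only. If \<open>E\<close> were much thinner than \<open>T\<close> in some direction, then its bounded volume would make
  it long in others, and an average of \<open>T\<close> and \<open>E\<close> would be an ellipsoid in \<open>M\<close> of volume at least \<open>2\<^sup>d\<close>. Hence
  \<open>E\<close> contains a translate of \<open>(\<delta> / 8\<^sup>d) T\<close> (\<open>scaled_copy_in_sets\<close>). So every choice of the \<open>F\<^sub>i\<close> contains
  a translate of one fixed ellipsoid. The colourful Helly theorem, applied to the sets of admissible
  centres, yields one family whose whole intersection contains such a translate, and its volume is at least
  \<open>(\<delta> / 8\<^sup>d)\<^sup>d = (1/432)\<^bsup>d\<^sup>2\<^esup> d\<^bsup>-5d\<^sup>2/2\<^esup>\<close>.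

  For the quantitative Helly theorem, normalise an almost largest ellipsoid of the intersection to be
  the unit ball. Stretching the ball slightly in a direction \<open>p\<close>, and possibly shifting it along \<open>p\<close>,
  increases the volume, so the result leaves one of the sets. This provides outer normals that
  are not nearly orthogonal to \<open>p\<close>, or that point towards \<open>p\<close> (\<open>outer_normal\<close>). From these one selects
  \<open>d\<close> normals with a large determinant and at most \<open>d\<close> others that balance them: a positive combination
  of all of them vanishes. For an ellipsoid \<open>A B + b\<close> in the corresponding sets, the same combination of the
  inequalities \<open>\<bar>A\<^sup>T u\<bar> + \<langle>u, b\<rangle> \<le> 3\<close> bounds \<open>\<bar>A\<^sup>T u\<bar>\<close> for the \<open>d\<close> chosen normals, and Hadamard's
  inequality bounds \<open>det A\<close>.
\<close>

section \<open>Vectors, matrices and determinants\<close>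

text \<open>
  The dimension \<open>d\<close> is a variable, so a vector is an arbitrary function on the natural numbers of
  which only the entries below \<open>d\<close> matter, and likewise for matrices. In this way no membership in a
  carrier has to be carried along; equalities are asserted for indices below \<open>d\<close> only.
\<close>

definition dot :: "nat \<Rightarrow> (nat \<Rightarrow> real) \<Rightarrow> (nat \<Rightarrow> real) \<Rightarrow> real" where
  "dot d x y = (\<Sum>i<d. x i * y i)"

abbreviation norm_Rd :: "nat \<Rightarrow> (nat \<Rightarrow> real) \<Rightarrow> real" where
  "norm_Rd d x \<equiv> L2_set x {..<d}"

definition app_mat :: "nat \<Rightarrow> (nat \<Rightarrow> nat \<Rightarrow> real) \<Rightarrow> (nat \<Rightarrow> real) \<Rightarrow> nat \<Rightarrow> real" where
  "app_mat d A x = (\<lambda>i. \<Sum>j<d. A i j * x j)"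

definition mat_prod :: "nat \<Rightarrow> (nat \<Rightarrow> nat \<Rightarrow> real) \<Rightarrow> (nat \<Rightarrow> nat \<Rightarrow> real) \<Rightarrow> nat \<Rightarrow> nat \<Rightarrow> real" where
  "mat_prod d A B = (\<lambda>i j. \<Sum>k<d. A i k * B k j)"

definition transposed :: "(nat \<Rightarrow> nat \<Rightarrow> real) \<Rightarrow> nat \<Rightarrow> nat \<Rightarrow> real" where
  "transposed A = (\<lambda>i j. A j i)"

definition Det :: "nat \<Rightarrow> (nat \<Rightarrow> nat \<Rightarrow> real) \<Rightarrow> real" where
  "Det d A = det (mat d d (\<lambda>(i, j). A i j))"

lemma transposed_transposed [simp]: "transposed (transposed A) = A"
  by (simp add: transposed_def)

lemma dot_commute: "dot d x y = dot d y x"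
  by (simp add: dot_def mult.commute)

lemma dot_cong: "(\<And>i. i < d \<Longrightarrow> x i = x' i) \<Longrightarrow> (\<And>i. i < d \<Longrightarrow> y i = y' i) \<Longrightarrow> dot d x y = dot d x' y'"
  by (simp add: dot_def)

lemma dot_self: "dot d x x = (norm_Rd d x)\<^sup>2"
  by (simp add: dot_def L2_set_def sum_nonneg power2_eq_square)

lemma dot_le: "\<bar>dot d x y\<bar> \<le> norm_Rd d x * norm_Rd d y"
proof -
  have "\<bar>dot d x y\<bar> \<le> (\<Sum>i<d. \<bar>x i\<bar> * \<bar>y i\<bar>)"
    unfolding dot_def by (metis (no_types, lifting) abs_mult sum.cong sum_abs)
  also have "\<dots> \<le> norm_Rd d x * norm_Rd d y" by (rule L2_set_mult_ineq)
  finally show ?thesis .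
qed

lemma dot_lin: "dot d x (\<lambda>i. a * y i + b * z i) = a * dot d x y + b * dot d x z"
  by (simp add: dot_def algebra_simps sum.distrib sum_distrib_left)

lemma dot_add: "dot d x (\<lambda>i. y i + z i) = dot d x y + dot d x z"
  using dot_lin[of d x 1 y 1 z] by simp

lemma dot_diff: "dot d x (\<lambda>i. y i - z i) = dot d x y - dot d x z"
  using dot_lin[of d x 1 y "-1" z] by simp

lemma dot_scale: "dot d x (\<lambda>i. a * y i) = a * dot d x y"
  using dot_lin[of d x a y 0 y] by simp

lemma dot_scale_left: "dot d (\<lambda>i. a * y i) x = a * dot d y x"
  using dot_scale[of d x a y] by (simp add: dot_commute)

lemma dot_sum_left: "dot d (\<lambda>i. \<Sum>j\<in>J. c j * u j i) x = (\<Sum>j\<in>J. c j * dot d (u j) x)"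
proof -
  have "dot d (\<lambda>i. \<Sum>j\<in>J. c j * u j i) x = (\<Sum>i<d. \<Sum>j\<in>J. c j * u j i * x i)"
    by (simp add: dot_def sum_distrib_right)
  also have "\<dots> = (\<Sum>j\<in>J. \<Sum>i<d. c j * u j i * x i)" by (rule sum.swap)
  finally show ?thesis by (simp add: dot_def sum_distrib_left mult.assoc)
qed

lemma norm_Rd_scale: "norm_Rd d (\<lambda>i. a * x i) = \<bar>a\<bar> * norm_Rd d x"
  by (simp add: L2_set_def power_mult_distrib sum_distrib_left[symmetric] real_sqrt_mult)

lemma norm_Rd_sub_sq: "(norm_Rd d (\<lambda>i. x i - y i))\<^sup>2 = (norm_Rd d x)\<^sup>2 - 2 * dot d x y + (norm_Rd d y)\<^sup>2"
  unfolding dot_self[symmetric] dot_def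
  by (simp add: algebra_simps sum.distrib sum_subtractf sum_distrib_left)

lemma abs_le_norm_Rd: "i < d \<Longrightarrow> \<bar>x i\<bar> \<le> norm_Rd d x"
  using member_le_L2_set[of "{..<d}" i "\<lambda>i. \<bar>x i\<bar>"] by (simp add: L2_set_def)

lemma norm_Rd_pos: "i < d \<Longrightarrow> x i \<noteq> 0 \<Longrightarrow> 0 < norm_Rd d x"
  using abs_le_norm_Rd[of i d x] by linarith

lemma norm_Rd_cong: "(\<And>i. i < d \<Longrightarrow> x i = y i) \<Longrightarrow> norm_Rd d x = norm_Rd d y"
  by (simp add: L2_set_def)

lemma app_mat_cong: "(\<And>i. i < d \<Longrightarrow> x i = y i) \<Longrightarrow> app_mat d A x = app_mat d A y"
  by (simp add: app_mat_def)

lemma app_mat_row: "app_mat d A x i = dot d (A i) x"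
  by (simp add: app_mat_def dot_def)

lemma app_mat_lin: "app_mat d A (\<lambda>i. a * x i + b * y i) = (\<lambda>i. a * app_mat d A x i + b * app_mat d A y i)"
  by (rule ext) (simp only: app_mat_row dot_lin)

lemma app_mat_scale: "app_mat d A (\<lambda>i. a * x i) = (\<lambda>i. a * app_mat d A x i)"
  by (rule ext) (simp only: app_mat_row dot_scale)

lemma app_mat_mat_prod: "app_mat d (mat_prod d A B) x = app_mat d A (app_mat d B x)"
proof
  fix i
  have "app_mat d (mat_prod d A B) x i = (\<Sum>j<d. \<Sum>k<d. A i k * B k j * x j)"
    by (simp add: app_mat_def mat_prod_def sum_distrib_right)
  also have "\<dots> = (\<Sum>k<d. \<Sum>j<d. A i k * B k j * x j)" by (rule sum.swap)
  finally show "app_mat d (mat_prod d A B) x i = app_mat d A (app_mat d B x) i"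
    by (simp add: app_mat_def sum_distrib_left mult.assoc)
qed

lemma dot_app_mat: "dot d x (app_mat d A y) = dot d (app_mat d (transposed A) x) y"
proof -
  have "dot d x (app_mat d A y) = (\<Sum>i<d. \<Sum>j<d. x i * (A i j * y j))"
    by (simp add: dot_def app_mat_def sum_distrib_left)
  also have "\<dots> = (\<Sum>j<d. \<Sum>i<d. x i * (A i j * y j))" by (rule sum.swap)
  also have "\<dots> = dot d (app_mat d (transposed A) x) y"
    unfolding dot_def app_mat_def transposed_def sum_distrib_right by (intro sum.cong) simp_all
  finally show ?thesis .
qed

lemma transposed_mat_prod: "transposed (mat_prod d A B) = mat_prod d (transposed B) (transposed A)"
  by (simp add: transposed_def mat_prod_def mult.commute)

lemma Det_cong: "(\<And>i j. i < d \<Longrightarrow> j < d \<Longrightarrow> A i j = B i j) \<Longrightarrow> Det d A = Det d B"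
proof -
  assume "\<And>i j. i < d \<Longrightarrow> j < d \<Longrightarrow> A i j = B i j"
  then have "mat d d (\<lambda>(i, j). A i j) = mat d d (\<lambda>(i, j). B i j)"
    by (intro eq_matI) auto
  then show ?thesis by (simp add: Det_def)
qed

lemma Det_mat_prod: "Det d (mat_prod d A B) = Det d A * Det d B"
proof -
  have "mat d d (\<lambda>(i, j). mat_prod d A B i j) = mat d d (\<lambda>(i, j). A i j) * mat d d (\<lambda>(i, j). B i j)"
    by (intro eq_matI) (auto simp: mat_prod_def scalar_prod_def atLeast0LessThan)
  then show ?thesis
    by (simp add: Det_def det_mult[of _ d])
qed

lemma Det_transposed: "Det d (transposed A) = Det d A"
proof -
  have "mat d d (\<lambda>(i, j). transposed A i j) = transpose_mat (mat d d (\<lambda>(i, j). A i j))"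
    by (intro eq_matI) (auto simp: transposed_def)
  then show ?thesis
    by (simp add: Det_def det_transpose[of _ d])
qed

lemma Det_lower:
  assumes "\<And>i j. i < j \<Longrightarrow> j < d \<Longrightarrow> A i j = 0"
  shows "Det d A = (\<Prod>i<d. A i i)"
proof -
  have "Det d A = prod_list (diag_mat (mat d d (\<lambda>(i, j). A i j)))"
    unfolding Det_def using assms by (intro det_lower_triangular[of d]) auto
  also have "\<dots> = prod_list (map (\<lambda>i. A i i) [0..<d])"
    unfolding diag_mat_def by (intro arg_cong[where f = prod_list] map_cong) auto
  also have "\<dots> = (\<Prod>i<d. A i i)"
    by (simp add: prod.distinct_set_conv_list[symmetric] atLeast0LessThan)
  finally show ?thesis .
qed

lemma Det_scale: "Det d (\<lambda>i j. c * A i j) = c ^ d * Det d A"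
proof -
  have "mat d d (\<lambda>(i, j). c * A i j) = c \<cdot>\<^sub>m mat d d (\<lambda>(i, j). A i j)"
    by (intro eq_matI) auto
  then show ?thesis by (simp add: Det_def)
qed

definition id_mat :: "nat \<Rightarrow> nat \<Rightarrow> real" where
  "id_mat i j = (if i = j then 1 else 0)"

lemma Det_id_mat [simp]: "Det d id_mat = 1"
  by (subst Det_lower) (auto simp: id_mat_def)

lemma app_mat_diag: "i < d \<Longrightarrow> app_mat d (\<lambda>i j. if i = j then c i else 0) x i = c i * x i"
  by (simp add: app_mat_def if_distrib[of "\<lambda>t. t * _"] cong: if_cong)

lemma app_mat_id_mat: "i < d \<Longrightarrow> app_mat d (\<lambda>i j. r * id_mat i j) x i = r * x i"
  by (simp add: app_mat_def id_mat_def if_distrib if_distribR cong: if_cong)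

lemma app_mat_idm': "i < d \<Longrightarrow> app_mat d id_mat x i = x i"
  using app_mat_id_mat[of i d 1] by simp

lemma Det_inverse:
  assumes "Det d A \<noteq> 0"
  obtains B where "\<And>x i. i < d \<Longrightarrow> app_mat d A (app_mat d B x) i = x i" "\<And>x i. i < d \<Longrightarrow> app_mat d B (app_mat d A x) i = x i"
    "Det d B = 1 / Det d A"
proof -
  let ?A = "mat d d (\<lambda>(i, j). A i j)"
  have "?A \<in> Units (ring_mat TYPE(real) d ())"
    using assms by (intro det_non_zero_imp_unit) (auto simp: Det_def)
  then obtain B where B: "B \<in> carrier_mat d d" "B * ?A = 1\<^sub>m d" "?A * B = 1\<^sub>m d"
    by (auto simp: Units_def ring_mat_def)
  let ?B = "\<lambda>i j. B $$ (i, j)"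
  have 1: "mat_prod d A ?B i j = id_mat i j" if "i < d" "j < d" for i j
  proof -
    have "(?A * B) $$ (i, j) = mat_prod d A ?B i j"
      using that B(1) by (simp add: mat_prod_def scalar_prod_def atLeast0LessThan)
    then show ?thesis using that B(3) by (simp add: id_mat_def)
  qed
  have 2: "mat_prod d ?B A i j = id_mat i j" if "i < d" "j < d" for i j
  proof -
    have "(B * ?A) $$ (i, j) = mat_prod d ?B A i j"
      using that B(1) by (simp add: mat_prod_def scalar_prod_def atLeast0LessThan)
    then show ?thesis using that B(2) by (simp add: id_mat_def)
  qed
  have "app_mat d (mat_prod d A ?B) x i = app_mat d id_mat x i" "app_mat d (mat_prod d ?B A) x i = app_mat d id_mat x i" if "i < d" for x i
    using 1 2 that by (simp_all add: app_mat_def)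
  then have "app_mat d A (app_mat d ?B x) i = x i" "app_mat d ?B (app_mat d A x) i = x i" if "i < d" for x i
    using that by (simp_all add: app_mat_mat_prod app_mat_idm')
  moreover have "Det d A * Det d ?B = 1"
    using Det_cong[of d "mat_prod d A ?B" id_mat] 1 by (simp add: Det_mat_prod)
  ultimately show ?thesis
    using assms by (intro that[of ?B]) (auto simp: field_simps)
qed

section \<open>Triangularisation and the inequality of Hadamard\<close>

text \<open>
  Fewer than \<open>d\<close> homogeneous equations in \<open>d\<close> unknowns have a nontrivial solution: zero rows turn
  the system into a square one with determinant zero.
\<close>

lemma orthogonal_direction:
  assumes "m < d"
  obtains q where "norm_Rd d q = 1" "\<And>k. k < m \<Longrightarrow> dot d (a k) q = 0"
proof -
  define A where "A = (\<lambda>i. if i < m then a i else (\<lambda>_. 0))"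
  let ?A = "mat d d (\<lambda>(i, j). A i j)"
  have "Det d A = 0"
  proof -
    have "mat\<^sub>r d d (\<lambda>i. if i = m then 0\<^sub>v d else vec d (A i)) = ?A"
      using assms by (intro eq_matI) (auto simp: A_def)
    then show ?thesis
      using det_row_0[of m d "\<lambda>i. vec d (A i)"] assms by (auto simp: Det_def)
  qed
  then obtain v where v: "v \<in> carrier_vec d" "v \<noteq> 0\<^sub>v d" "?A *\<^sub>v v = 0\<^sub>v d"
    using det_0_iff_vec_prod_zero[of ?A d] by (auto simp: Det_def)
  define w where "w = (\<lambda>i. v $ i)"
  from v(1,2) obtain i where i: "i < d" "w i \<noteq> 0" unfolding w_def
    by (metis carrier_vecD eq_vecI index_zero_vec(1) index_zero_vec(2))
  have w: "dot d (a k) w = 0" if "k < m" for k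
  proof -
    have "(?A *\<^sub>v v) $ k = 0" using that assms v(3) by simp
    then show ?thesis using that assms v(1)
      by (auto simp: scalar_prod_def dot_def w_def A_def atLeast0LessThan)
  qed
  have pos: "0 < norm_Rd d w" using i norm_Rd_pos by blast
  show ?thesis
  proof (rule that[of "\<lambda>i. (1 / norm_Rd d w) * w i"])
    show "norm_Rd d (\<lambda>i. (1 / norm_Rd d w) * w i) = 1" using pos by (simp only: norm_Rd_scale) simp
    show "dot d (a k) (\<lambda>i. (1 / norm_Rd d w) * w i) = 0" if "k < m" for k
      using w[OF that] by (simp only: dot_scale)
  qed
qed

definition orthonormal :: "nat \<Rightarrow> (nat \<Rightarrow> nat \<Rightarrow> real) \<Rightarrow> bool" where
  "orthonormal d Q \<longleftrightarrow> (\<forall>i<d. \<forall>j<d. dot d (Q i) (Q j) = id_mat i j)"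

lemma orthonormal_Det: assumes "orthonormal d Q" shows "\<bar>Det d Q\<bar> = 1"
proof -
  have "Det d Q * Det d (transposed Q) = Det d id_mat"
    using assms by (subst Det_mat_prod[symmetric], intro Det_cong) (auto simp: mat_prod_def transposed_def orthonormal_def dot_def)
  then have "(Det d Q)\<^sup>2 = 1" by (simp add: Det_transposed power2_eq_square)
  then show ?thesis by (auto simp: power2_eq_1_iff)
qed

lemma orthonormal_app_mat_transposed: assumes "orthonormal d Q" "i < d" shows "app_mat d Q (app_mat d (transposed Q) x) i = x i"
proof -
  have "app_mat d (mat_prod d Q (transposed Q)) x i = app_mat d id_mat x i"
    using assms by (auto simp: app_mat_def mat_prod_def transposed_def orthonormal_def dot_def)
  then show ?thesis using assms by (simp add: app_mat_mat_prod app_mat_idm')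
qed

lemma orthonormal_app_mat_tr2: assumes "orthonormal d Q" "i < d" shows "app_mat d (transposed Q) (app_mat d Q x) i = x i"
proof -
  have "Det d Q \<noteq> 0" using orthonormal_Det[OF assms(1)] by auto
  then obtain B where B: "\<And>x i. i < d \<Longrightarrow> app_mat d Q (app_mat d B x) i = x i" "\<And>x i. i < d \<Longrightarrow> app_mat d B (app_mat d Q x) i = x i"
    using Det_inverse by metis
  \<comment> \<open>\<open>B = B Q Q\<^sup>T = Q\<^sup>T\<close>\<close>
  have "app_mat d B y j = app_mat d (transposed Q) y j" if "j < d" for y j
  proof -
    have "app_mat d B y j = app_mat d B (app_mat d Q (app_mat d (transposed Q) y)) j"
      using app_mat_cong[of d y "app_mat d Q (app_mat d (transposed Q) y)" B] orthonormal_app_mat_transposed[OF assms(1)] by metis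
    then show ?thesis using B(2) that by simp
  qed
  then show ?thesis using B(2) assms(2) by metis
qed

lemma orthonormal_norm_Rd: assumes "orthonormal d Q" shows "norm_Rd d (app_mat d Q x) = norm_Rd d x"
proof -
  have "(norm_Rd d (app_mat d Q x))\<^sup>2 = dot d (app_mat d (transposed Q) (app_mat d Q x)) x"
    by (simp add: dot_self[symmetric] dot_app_mat)
  also have "\<dots> = dot d x x"
    using orthonormal_app_mat_tr2[OF assms] by (intro dot_cong) auto
  finally show ?thesis by (simp add: dot_self power2_eq_iff_nonneg)
qed

lemma orthonormal_norm_Rd_transposed: assumes "orthonormal d Q" shows "norm_Rd d (app_mat d (transposed Q) x) = norm_Rd d x"
proof -
  have "(norm_Rd d (app_mat d (transposed Q) x))\<^sup>2 = dot d (app_mat d Q (app_mat d (transposed Q) x)) x"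
    by (simp add: dot_self[symmetric] dot_app_mat)
  also have "\<dots> = dot d x x"
    using orthonormal_app_mat_transposed[OF assms] by (intro dot_cong) auto
  finally show ?thesis by (simp add: dot_self power2_eq_iff_nonneg)
qed

text \<open>
  The rows of \<open>Q\<close> are chosen from the last to the first. Row \<open>k\<close> has to be orthogonal to the \<open>k\<close> rows
  \<open>A j\<close> with \<open>j < k\<close> and to the \<open>d - 1 - k\<close> rows of \<open>Q\<close> chosen before, which are \<open>d - 1\<close> conditions.
  Then \<open>A Q\<^sup>T\<close> is lower triangular.
\<close>

lemma QR:
  obtains Q where "orthonormal d Q" "\<And>j k. j < k \<Longrightarrow> k < d \<Longrightarrow> dot d (A j) (Q k) = 0"
    "\<And>k. k < d \<Longrightarrow> 0 \<le> dot d (A k) (Q k)"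
proof -
  have "\<exists>Q. (\<forall>i<d. \<forall>j<d. d - n \<le> i \<longrightarrow> d - n \<le> j \<longrightarrow> dot d (Q i) (Q j) = id_mat i j) \<and>
     (\<forall>k<d. d - n \<le> k \<longrightarrow> 0 \<le> dot d (A k) (Q k) \<and> (\<forall>j<k. dot d (A j) (Q k) = 0))" if "n \<le> d" for n
    using that
  proof (induction n)
    case 0
    then show ?case by auto
  next
    case (Suc n)
    then obtain Q where Q: "\<And>i j. i<d \<Longrightarrow> j<d \<Longrightarrow> d - n \<le> i \<Longrightarrow> d - n \<le> j \<Longrightarrow> dot d (Q i) (Q j) = id_mat i j"
      "\<And>k. k<d \<Longrightarrow> d - n \<le> k \<Longrightarrow> 0 \<le> dot d (A k) (Q k)"
      "\<And>k j. k<d \<Longrightarrow> d - n \<le> k \<Longrightarrow> j < k \<Longrightarrow> dot d (A j) (Q k) = 0"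
      by (metis Suc_leD)
    define k where "k = d - Suc n"
    have k: "k < d" "d - n = Suc k" using Suc.prems by (auto simp: k_def)
    obtain q where q: "norm_Rd d q = 1" "\<And>m. m < d - 1 \<Longrightarrow> dot d (if m < k then A m else Q (Suc m)) q = 0"
      using orthogonal_direction[of "d - 1" d "\<lambda>m. if m < k then A m else Q (Suc m)"] k by auto
    have qA: "dot d (A m) q = 0" if "m < k" for m using q(2)[of m] that k by auto
    have qQ: "dot d (Q m) q = 0" if "k < m" "m < d" for m using q(2)[of "m - 1"] that k by (cases m) auto
    define s :: real where "s = (if 0 \<le> dot d (A k) q then 1 else -1)"
    define q' where "q' = (\<lambda>i. s * q i)"
    have s: "s * s = 1" "0 \<le> s * dot d (A k) q" by (auto simp: s_def)
    have q': "dot d q' q' = 1" "dot d (A k) q' \<ge> 0" "m < k \<Longrightarrow> dot d (A m) q' = 0"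
        "k < m \<Longrightarrow> m < d \<Longrightarrow> dot d (Q m) q' = 0" "k < m \<Longrightarrow> m < d \<Longrightarrow> dot d q' (Q m) = 0" for m
      using q(1) s qA[of m] qQ[of m]
      by (simp_all add: q'_def dot_scale dot_scale_left dot_self dot_commute[of d q])
    show ?case
    proof (intro exI[of _ "Q(k := q')"] conjI allI impI)
      fix i j assume "i < d" "j < d" "d - Suc n \<le> i" "d - Suc n \<le> j"
      then show "dot d ((Q(k := q')) i) ((Q(k := q')) j) = id_mat i j"
        using Q(1)[of i j] q' k by (cases "i = k"; cases "j = k") (auto simp: id_mat_def k_def)
    next
      fix i assume "i < d" "d - Suc n \<le> i"
      then show "0 \<le> dot d (A i) ((Q(k := q')) i)"
        using Q(2)[of i] q' k by (cases "i = k") (auto simp: k_def)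
    next
      fix i j assume "i < d" "d - Suc n \<le> i" "j < i"
      then show "dot d (A j) ((Q(k := q')) i) = 0"
        using Q(3)[of i j] q' k by (cases "i = k") (auto simp: k_def)
    qed
  qed
  from this[of d] show ?thesis using that unfolding orthonormal_def by auto
qed

text \<open>
  A triangularisation of any matrix with first row \<open>u\<close> makes all later rows of \<open>Q\<close> orthogonal to \<open>u\<close>.
\<close>

lemma orthonormal_first_row:
  assumes "norm_Rd d u = 1"
  obtains R where "orthonormal d R" "R 0 = u"
proof -
  have "d > 0" using assms by (cases d) auto
  obtain Q where Q: "orthonormal d Q" "\<And>j k. j < k \<Longrightarrow> k < d \<Longrightarrow> dot d u (Q k) = 0"
    by (rule QR[where d=d and A="\<lambda>_. u"]) blast
  have "dot d u (Q k) = 0" if "0 < k" "k < d" for k using Q(2)[of 0 k] that by auto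
  then have "orthonormal d (Q(0 := u))" using Q(1) assms
    by (auto simp: orthonormal_def dot_self dot_commute[of d _ u]) (auto simp: id_mat_def)
  then show ?thesis using that by auto
qed

lemma Det_QR:
  assumes "orthonormal d Q" "\<And>j k. j < k \<Longrightarrow> k < d \<Longrightarrow> dot d (A j) (Q k) = 0"
  shows "\<bar>Det d A\<bar> = (\<Prod>k<d. \<bar>dot d (A k) (Q k)\<bar>)"
proof -
  have "\<bar>Det d A\<bar> = \<bar>Det d (mat_prod d A (transposed Q))\<bar>"
    using orthonormal_Det[OF assms(1)] by (simp add: Det_mat_prod Det_transposed abs_mult)
  also have "Det d (mat_prod d A (transposed Q)) = Det d (\<lambda>i j. dot d (A i) (Q j))"
    by (intro Det_cong) (simp add: mat_prod_def transposed_def dot_def)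
  also have "\<dots> = (\<Prod>k<d. dot d (A k) (Q k))"
    using assms(2) by (intro Det_lower)
  finally show ?thesis by (simp add: abs_prod)
qed

lemma Hadamard: "\<bar>Det d A\<bar> \<le> (\<Prod>k<d. norm_Rd d (A k))"
proof -
  obtain Q where Q: "orthonormal d Q" "\<And>j k. j < k \<Longrightarrow> k < d \<Longrightarrow> dot d (A j) (Q k) = 0" using QR[where d=d and A=A] by metis
  have "\<bar>Det d A\<bar> = (\<Prod>k<d. \<bar>dot d (A k) (Q k)\<bar>)" using Det_QR[OF Q] .
  also have "\<dots> \<le> (\<Prod>k<d. norm_Rd d (A k))"
  proof (intro prod_mono conjI)
    fix k assume "k \<in> {..<d}"
    then have "(norm_Rd d (Q k))\<^sup>2 = 1" using Q(1) by (auto simp: orthonormal_def dot_self[symmetric] id_mat_def)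
    then have "norm_Rd d (Q k) = 1" using L2_set_nonneg[of "Q k" "{..<d}"] by (auto simp: power2_eq_1_iff)
    then show "\<bar>dot d (A k) (Q k)\<bar> \<le> norm_Rd d (A k)" using dot_le[of d "A k" "Q k"] by simp
  qed auto
  finally show ?thesis .
qed

section \<open>Closed convex sets and separation\<close>

text \<open>
  A subset of \<open>\<real>\<^sup>d\<close> is represented by the cylinder over it in the space of all functions. Its
  closedness refers to the product topology of that space.
\<close>

definition cylindrical :: "nat \<Rightarrow> (nat \<Rightarrow> real) set \<Rightarrow> bool" where
  "cylindrical d K \<longleftrightarrow> (\<forall>x y. x \<in> K \<longrightarrow> (\<forall>i<d. x i = y i) \<longrightarrow> y \<in> K)"

definition convex_set :: "(nat \<Rightarrow> real) set \<Rightarrow> bool" where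
  "convex_set K \<longleftrightarrow> (\<forall>x\<in>K. \<forall>y\<in>K. \<forall>u\<ge>0. \<forall>v\<ge>0. u + v = 1 \<longrightarrow> (\<lambda>i. u * x i + v * y i) \<in> K)"

definition closed_convex :: "nat \<Rightarrow> (nat \<Rightarrow> real) set \<Rightarrow> bool" where
  "closed_convex d K \<longleftrightarrow> closed K \<and> convex_set K \<and> cylindrical d K"

lemma cylindricalD:
  assumes "cylindrical d K" "x \<in> K" "\<And>i. i < d \<Longrightarrow> x i = y i"
  shows "y \<in> K"
  using assms(1)[unfolded cylindrical_def, rule_format, OF assms(2)] assms(3) by blast

lemma convex_setD:
  assumes "convex_set K" "x \<in> K" "y \<in> K" "0 \<le> u" "0 \<le> v" "u + v = 1"
  shows "(\<lambda>i. u * x i + v * y i) \<in> K"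
  using assms(1)[unfolded convex_set_def, rule_format, OF assms(2-6)] .

lemma convex_set_INT: "(\<And>j. j \<in> J \<Longrightarrow> convex_set (K j)) \<Longrightarrow> convex_set (\<Inter>j\<in>J. K j)"
  unfolding convex_set_def[of "\<Inter>j\<in>J. K j"]
proof (intro ballI allI impI INT_I)
  fix x y j and u v :: real
  assume *: "\<And>j. j \<in> J \<Longrightarrow> convex_set (K j)" "x \<in> (\<Inter>j\<in>J. K j)" "y \<in> (\<Inter>j\<in>J. K j)" "0 \<le> u" "0 \<le> v" "u + v = 1" "j \<in> J"
  show "(\<lambda>i. u * x i + v * y i) \<in> K j"
    by (rule convex_setD[OF *(1)[OF *(7)] INT_D[OF *(2) *(7)] INT_D[OF *(3) *(7)] *(4-6)])
qed

lemma cylindrical_INT: "(\<And>j. j \<in> J \<Longrightarrow> cylindrical d (K j)) \<Longrightarrow> cylindrical d (\<Inter>j\<in>J. K j)"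
  unfolding cylindrical_def[of d "\<Inter>j\<in>J. K j"]
proof (intro allI impI INT_I)
  fix x y j
  assume *: "\<And>j. j \<in> J \<Longrightarrow> cylindrical d (K j)" "x \<in> (\<Inter>j\<in>J. K j)" "\<forall>i<d. x i = y i" "j \<in> J"
  show "y \<in> K j"
    by (rule cylindricalD[OF *(1)[OF *(4)] INT_D[OF *(2) *(4)]]) (simp add: *(3))
qed

lemma closed_convex_INT: "(\<And>j. j \<in> J \<Longrightarrow> closed_convex d (K j)) \<Longrightarrow> closed_convex d (\<Inter>j\<in>J. K j)"
  unfolding closed_convex_def using convex_set_INT[of J K] cylindrical_INT[of J d K] by (simp add: closed_INT)

lemma convex_set_sum:
  assumes K: "convex_set K" and J: "finite J" and "\<And>j. j \<in> J \<Longrightarrow> u j \<in> K" "\<And>j. j \<in> J \<Longrightarrow> 0 \<le> c j"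
    and "(\<Sum>j\<in>J. c j) = 1"
  shows "(\<lambda>i. \<Sum>j\<in>J. c j * u j i) \<in> K"
  using J assms(3-)
proof (induction J arbitrary: c rule: finite_induct)
  case empty
  then show ?case by simp
next
  case (insert a J)
  show ?case
  proof (cases "c a = 1")
    case True
    then have "(\<Sum>j\<in>J. c j) = 0" using insert by simp
    then have "\<forall>j\<in>J. c j = 0" using insert by (subst (asm) sum_nonneg_eq_0_iff) auto
    then have "(\<lambda>i. \<Sum>j\<in>insert a J. c j * u j i) = u a" using True insert by auto
    then show ?thesis using insert by simp
  next
    case False
    have s: "(\<Sum>j\<in>J. c j) = 1 - c a" using insert by simp
    moreover have "(\<Sum>j\<in>J. c j) \<ge> 0" using insert by (intro sum_nonneg) auto
    ultimately have p: "1 - c a > 0" using False by auto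
    have "(\<lambda>i. \<Sum>j\<in>J. (c j / (1 - c a)) * u j i) \<in> K"
      using insert p s by (intro insert.IH) (auto simp: sum_divide_distrib[symmetric])
    then have "(\<lambda>i. c a * u a i + (1 - c a) * (\<Sum>j\<in>J. (c j / (1 - c a)) * u j i)) \<in> K"
      using insert p by (intro convex_setD[OF K]) auto
    also have "(\<lambda>i. c a * u a i + (1 - c a) * (\<Sum>j\<in>J. (c j / (1 - c a)) * u j i))
        = (\<lambda>i. \<Sum>j\<in>insert a J. c j * u j i)"
      using insert p by (simp add: sum_distrib_left)
    finally show ?thesis .
  qed
qed

lemma convex_set_ball: "convex_set {x. norm_Rd d x \<le> r}"
  unfolding convex_set_def
proof (intro ballI allI impI)
  fix x y u v assume *: "x \<in> {x. norm_Rd d x \<le> r}" "y \<in> {x. norm_Rd d x \<le> r}" "0 \<le> (u::real)" "0 \<le> (v::real)" "u + v = 1"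
  have "norm_Rd d (\<lambda>i. u * x i + v * y i) \<le> norm_Rd d (\<lambda>i. u * x i) + norm_Rd d (\<lambda>i. v * y i)"
    by (rule L2_set_triangle_ineq)
  also have "\<dots> = u * norm_Rd d x + v * norm_Rd d y" using * by (simp add: norm_Rd_scale)
  also have "\<dots> \<le> u * r + v * r" using * by (intro add_mono mult_left_mono) auto
  also have "\<dots> = r" using *(5) by (simp add: distrib_right[symmetric])
  finally show "(\<lambda>i. u * x i + v * y i) \<in> {x. norm_Rd d x \<le> r}" by simp
qed

lemma cylindrical_ball: "cylindrical d {x. norm_Rd d x \<le> r}"
  unfolding cylindrical_def
proof (intro allI impI)
  fix x y assume x: "x \<in> {x. norm_Rd d x \<le> r}" "\<forall>i<d. x i = y i"
  have "norm_Rd d y = norm_Rd d x" by (rule norm_Rd_cong) (simp add: x(2))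
  then show "y \<in> {x. norm_Rd d x \<le> r}" using x(1) by simp
qed

lemma continuous_on_coord: "continuous_on S (\<lambda>x::nat \<Rightarrow> real. x i)"
  by (rule continuous_on_subset[OF continuous_on_product_coordinates]) simp

lemma continuous_norm_Rd_diff: "continuous_on S (\<lambda>x. norm_Rd d (\<lambda>i. a i - x i))"
proof -
  have "continuous_on S (\<lambda>x. (a i - x i)\<^sup>2)" for i
    by (rule continuous_on_power[OF continuous_on_diff[OF continuous_on_const continuous_on_coord]])
  then show ?thesis
    unfolding L2_set_def by (rule continuous_on_real_sqrt[OF continuous_on_sum])
qed

lemma compact_coordinatewise:
  fixes S :: "nat \<Rightarrow> real set"
  assumes "\<And>i. compact (S i)"
  shows "compact {x. \<forall>i. x i \<in> S i}"
proof -
  have "compactin (product_topology (\<lambda>i. euclidean) UNIV) (PiE UNIV S)"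
    using assms by (subst compactin_PiE) (auto simp: compactin_euclidean_iff)
  moreover have "PiE UNIV S = {x. \<forall>i. x i \<in> S i}" by auto
  ultimately show ?thesis
    by (simp add: euclidean_product_topology)
qed

text \<open>
  The set may be unbounded and has unbounded fibres. It suffices to minimise over its points that
  are no farther from \<open>a\<close> than a given one and vanish from coordinate \<open>d\<close> on, and these form a compact set.
\<close>

lemma nearest_point:
  assumes K: "closed K" "cylindrical d K" "K \<noteq> {}"
  obtains z where "z \<in> K" "\<And>x. x \<in> K \<Longrightarrow> norm_Rd d (\<lambda>i. a i - z i) \<le> norm_Rd d (\<lambda>i. a i - x i)"
proof -
  from K obtain x0 where x0: "x0 \<in> K" by auto
  define r where "r = norm_Rd d (\<lambda>i. a i - x0 i)"
  define S where "S = (\<lambda>i. if i < d then {a i - r..a i + r} else {0})"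
  define cut where "cut = (\<lambda>x i. if i < d then x i else (0::real))"
  have cut: "cut x \<in> K" if "x \<in> K" for x using cylindricalD[OF K(2) that] by (auto simp: cut_def)
  have cutn: "norm_Rd d (\<lambda>i. a i - cut x i) = norm_Rd d (\<lambda>i. a i - x i)" for x
    by (rule norm_Rd_cong) (auto simp: cut_def)
  have cutS: "cut x \<in> {x. \<forall>i. x i \<in> S i}" if "norm_Rd d (\<lambda>i. a i - x i) \<le> r" for x
  proof -
    have "\<bar>a i - x i\<bar> \<le> r" if "i < d" for i
      using abs_le_norm_Rd[OF that, of "\<lambda>i. a i - x i"] \<open>norm_Rd d _ \<le> r\<close> by simp
    then show ?thesis by (auto simp: S_def cut_def abs_le_iff) (smt (verit))+
  qed
  have "compact ({x. \<forall>i. x i \<in> S i} \<inter> K)"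
    using K(1) by (intro compact_Int_closed compact_coordinatewise) (auto simp: S_def)
  moreover have "cut x0 \<in> {x. \<forall>i. x i \<in> S i} \<inter> K" using cut[OF x0] cutS[of x0] by (simp add: r_def)
  ultimately obtain z where z: "z \<in> {x. \<forall>i. x i \<in> S i} \<inter> K"
     "\<forall>x\<in>{x. \<forall>i. x i \<in> S i} \<inter> K. norm_Rd d (\<lambda>i. a i - z i) \<le> norm_Rd d (\<lambda>i. a i - x i)"
    using continuous_attains_inf[OF _ _ continuous_norm_Rd_diff[where d = d and a = a]] by blast
  show ?thesis
  proof (rule that[of z])
    show "z \<in> K" using z by auto
    fix x assume x: "x \<in> K"
    show "norm_Rd d (\<lambda>i. a i - z i) \<le> norm_Rd d (\<lambda>i. a i - x i)"
    proof (cases "norm_Rd d (\<lambda>i. a i - x i) \<le> r")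
      case True
      then show ?thesis using bspec[OF z(2), of "cut x"] cut[OF x] cutS[OF True] by (simp only: cutn) blast
    next
      case False
      have "norm_Rd d (\<lambda>i. a i - z i) \<le> norm_Rd d (\<lambda>i. a i - cut x0 i)"
        using z(2) \<open>cut x0 \<in> _\<close> by (rule bspec)
      then show ?thesis using False cutn[of x0] by (simp add: r_def)
    qed
  qed
qed

text \<open>
  First-order condition: moving from \<open>z\<close> a small step towards \<open>x\<close> does not decrease the
  distance to \<open>a\<close>.
\<close>

lemma nearest_point_obtuse:
  assumes K: "convex_set K" "z \<in> K" "\<And>x. x \<in> K \<Longrightarrow> norm_Rd d (\<lambda>i. a i - z i) \<le> norm_Rd d (\<lambda>i. a i - x i)" and x: "x \<in> K"
  shows "dot d (\<lambda>i. a i - z i) (\<lambda>i. x i - z i) \<le> 0"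
proof (rule ccontr)
  define w where "w = (\<lambda>i. a i - z i)"
  define v where "v = (\<lambda>i. x i - z i)"
  define b where "b = dot d w v"
  define s where "s = (norm_Rd d v)\<^sup>2"
  assume "\<not> ?thesis"
  then have b: "b > 0" by (simp add: b_def w_def v_def)
  have s: "s \<ge> 0" by (simp add: s_def)
  have *: "2 * t * b \<le> t\<^sup>2 * s" if "0 \<le> t" "t \<le> 1" for t
  proof -
    have "(\<lambda>i. (1 - t) * z i + t * x i) \<in> K" using that K x by (intro convex_setD) auto
    from K(3)[OF this] have "(norm_Rd d w)\<^sup>2 \<le> (norm_Rd d (\<lambda>i. a i - ((1 - t) * z i + t * x i)))\<^sup>2"
      by (auto simp: w_def intro!: power_mono)
    also have "(\<lambda>i. a i - ((1 - t) * z i + t * x i)) = (\<lambda>i. w i - t * v i)"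
      by (auto simp: w_def v_def algebra_simps)
    also have "(norm_Rd d (\<lambda>i. w i - t * v i))\<^sup>2 = (norm_Rd d w)\<^sup>2 - 2 * t * b + t\<^sup>2 * s"
      by (simp add: norm_Rd_sub_sq norm_Rd_scale dot_scale b_def s_def power_mult_distrib)
    finally show ?thesis by simp
  qed
  show False
  proof (cases "s \<le> b")
    case True
    then show ?thesis using *[of 1] b by auto
  next
    case False
    then show ?thesis using *[of "b / s"] b s by (auto simp: power2_eq_square divide_simps split: if_splits)
  qed
qed

lemma separation:
  assumes K: "closed_convex d K" "K \<noteq> {}" and y: "y \<notin> K"
  obtains u h where "norm_Rd d u = 1" "\<And>z. z \<in> K \<Longrightarrow> dot d u z \<le> h" "h < dot d u y"
proof -
  have K': "closed K" "convex_set K" "cylindrical d K" using K by (auto simp: closed_convex_def)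
  obtain z where z: "z \<in> K" "\<And>x. x \<in> K \<Longrightarrow> norm_Rd d (\<lambda>i. y i - z i) \<le> norm_Rd d (\<lambda>i. y i - x i)"
    by (rule nearest_point[OF K'(1,3) K(2), where a = y]) blast
  define w where "w = (\<lambda>i. y i - z i)"
  have "norm_Rd d w \<noteq> 0"
  proof
    assume "norm_Rd d w = 0"
    then have "z i = y i" if "i < d" for i using that by (auto simp: L2_set_eq_0_iff w_def)
    then show False using cylindricalD[OF K'(3) z(1)] y by blast
  qed
  then have w: "norm_Rd d w > 0" using L2_set_nonneg[of w "{..<d}"] by linarith
  define u where "u = (\<lambda>i. (1 / norm_Rd d w) * w i)"
  have "dot d u w = norm_Rd d w"
    unfolding u_def dot_scale_left dot_self using w by (simp add: power2_eq_square)
  show ?thesis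
  proof (rule that[of u "dot d u z"])
    show "norm_Rd d u = 1" unfolding u_def norm_Rd_scale using w by simp
    show "dot d u z < dot d u y" using \<open>dot d u w = norm_Rd d w\<close> w by (simp add: w_def dot_diff)
    fix x assume "x \<in> K"
    then have "dot d w (\<lambda>i. x i - z i) \<le> 0" unfolding w_def using nearest_point_obtuse[OF K'(2) z] by blast
    then have "dot d u (\<lambda>i. x i - z i) \<le> 0" unfolding u_def dot_scale_left using w
      by (simp add: divide_le_0_iff)
    then show "dot d u x \<le> dot d u z" by (simp add: dot_diff)
  qed
qed

section \<open>The theorem of Helly and its colourful version\<close>

text \<open>
  The argument of Radon: \<open>d + 2\<close> points have an affine dependence \<open>q\<close>, and the hulls of the points with
  positive coefficients and of the others meet. A common point lies in every \<open>S j\<close>, because each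
  \<open>x i\<close> belongs to all sets except possibly \<open>S i\<close>.
\<close>

lemma Helly_minimal:
  assumes S: "\<And>j. j < d + 2 \<Longrightarrow> convex_set (S j)" "\<And>j. j < d + 2 \<Longrightarrow> cylindrical d (S j)"
    and x: "\<And>i j. i < d + 2 \<Longrightarrow> j < d + 2 \<Longrightarrow> i \<noteq> j \<Longrightarrow> x i \<in> S j"
  obtains z where "\<And>j. j < d + 2 \<Longrightarrow> z \<in> S j"
proof -
  let ?n = "d + 2"
  obtain q where q: "norm_Rd ?n q = 1" "\<And>k. k < d + 1 \<Longrightarrow> dot ?n (\<lambda>j. if k < d then x j k else 1) q = 0"
    using orthogonal_direction[of "d + 1" ?n "\<lambda>k j. if k < d then x j k else 1"] by auto
  have q0: "(\<Sum>j<?n. q j) = 0" using q(2)[of d] by (simp add: dot_def)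
  have qx: "(\<Sum>j<?n. q j * x j k) = 0" if "k < d" for k
    using q(2)[of k] that by (simp add: dot_def mult.commute)
  define P where "P = {j. j < ?n \<and> q j > 0}"
  define N where "N = {j. j < ?n \<and> \<not> q j > 0}"
  have fin: "finite P" "finite N" "{..<?n} = P \<union> N" "P \<inter> N = {}" by (auto simp: P_def N_def)
  define s where "s = (\<Sum>j\<in>P. q j)"
  have split: "(\<Sum>j<?n. f j) = (\<Sum>j\<in>P. f j) + (\<Sum>j\<in>N. f j)" for f :: "nat \<Rightarrow> real"
    using fin by (simp add: sum.union_disjoint)
  have sN: "(\<Sum>j\<in>N. - q j) = s" using q0 split[of q] by (simp add: s_def sum_negf)
  have "s > 0"
  proof (rule ccontr)
    assume "\<not> s > 0"
    moreover have "s \<ge> 0" unfolding s_def by (intro sum_nonneg) (auto simp: P_def)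
    ultimately have "s = 0" by simp
    then have "\<forall>j\<in>P. q j = 0" "\<forall>j\<in>N. - q j = 0"
      using sN fin sum_nonneg_eq_0_iff[of P q] sum_nonneg_eq_0_iff[of N "\<lambda>j. - q j"]
      by (auto simp: s_def P_def N_def)
    then have "\<forall>j<?n. q j = 0" using fin(3) by (auto simp: P_def N_def)
    then have "norm_Rd ?n q = 0" by (auto simp: L2_set_def)
    then show False using q(1) by simp
  qed
  define z where "z = (\<lambda>k. \<Sum>j\<in>P. (q j / s) * x j k)"
  define z' where "z' = (\<lambda>k. \<Sum>j\<in>N. (- q j / s) * x j k)"
  have zz: "z k = z' k" if "k < d" for k
  proof -
    have "(\<Sum>j\<in>P. q j * x j k) = (\<Sum>j\<in>N. - q j * x j k)"
      using qx[OF that] split[of "\<lambda>j. q j * x j k"] by (simp add: sum_negf)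
    then have "(\<Sum>j\<in>P. q j * x j k) / s = (\<Sum>j\<in>N. - q j * x j k) / s" by simp
    then show ?thesis by (simp add: z_def z'_def sum_divide_distrib)
  qed
  have "z \<in> S j" if j: "j < ?n" for j
  proof (cases "j \<in> P")
    case True
    have "z' \<in> S j" unfolding z'_def
    proof (rule convex_set_sum[OF S(1)[OF j] fin(2)])
      show "(\<Sum>j\<in>N. - q j / s) = 1" using sN \<open>s > 0\<close> by (simp only: sum_divide_distrib[symmetric]) simp
    next
      fix i assume "i \<in> N"
      then show "x i \<in> S j" using x[of i j] True by (auto simp: N_def P_def)
      show "0 \<le> - q i / s" using \<open>i \<in> N\<close> \<open>s > 0\<close> by (auto simp: N_def divide_simps)
    qed
    then show ?thesis using cylindricalD[OF S(2)[OF j], of z' z] zz by auto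
  next
    case False
    show "z \<in> S j" unfolding z_def
    proof (rule convex_set_sum[OF S(1)[OF j] fin(1)])
      show "(\<Sum>j\<in>P. q j / s) = 1" using \<open>s > 0\<close> by (simp add: s_def sum_divide_distrib[symmetric])
    next
      fix i assume "i \<in> P"
      then show "x i \<in> S j" using x[of i j] False j by (auto simp: P_def)
      show "0 \<le> q i / s" using \<open>i \<in> P\<close> \<open>s > 0\<close> by (auto simp: P_def)
    qed
  qed
  then show ?thesis using that by blast
qed

text \<open>
  Among all intersections of \<open>d\<close> sets from different families take one that is farthest from the
  origin, with nearest point \<open>p\<close>. Let \<open>A\<close> belong to the omitted family. Any \<open>d + 1\<close> of these \<open>d\<close>
  sets, \<open>A\<close>, and the ball around the origin through \<open>p\<close> have a common point, hence all \<open>d + 2\<close> do.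
  The point \<open>p\<close> is the only point of the intersection in that ball, so \<open>p\<close> lies in \<open>A\<close>.
\<close>

lemma colourful_Helly:
  assumes F: "\<And>i. i \<le> d \<Longrightarrow> finite (\<F> i)" "\<And>i S. i \<le> d \<Longrightarrow> S \<in> \<F> i \<Longrightarrow> closed_convex d S"
    and sel: "\<And>K. (\<And>i. i \<le> d \<Longrightarrow> K i \<in> \<F> i) \<Longrightarrow> \<exists>x. \<forall>i\<le>d. x \<in> K i"
  obtains i x where "i \<le> d" "\<And>S. S \<in> \<F> i \<Longrightarrow> x \<in> S"
proof (cases "\<exists>i\<le>d. \<F> i = {}")
  case True
  then show ?thesis using that by blast
next
  case False
  define G :: "(nat \<Rightarrow> (nat \<Rightarrow> real) set) \<times> nat \<Rightarrow> _"
    where "G = (\<lambda>(K, i). \<Inter>j\<in>{..d} - {i}. K j)"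
  define X where "X = PiE {..d} \<F> \<times> {..d}"
  have finX: "finite X" using F by (auto simp: X_def intro!: finite_PiE)
  have "PiE {..d} \<F> \<noteq> {}" using False by (auto simp: PiE_eq_empty_iff)
  then have X0: "X \<noteq> {}" by (auto simp: X_def)
  have G: "closed_convex d (G p)" "G p \<noteq> {}" if "p \<in> X" for p
  proof -
    obtain K i where p: "p = (K, i)" by force
    have K: "\<And>j. j \<le> d \<Longrightarrow> K j \<in> \<F> j" using that p by (auto simp: X_def)
    show "closed_convex d (G p)" unfolding G_def p using F(2) K by (auto intro!: closed_convex_INT)
    show "G p \<noteq> {}" using sel[OF K] by (auto simp: G_def p)
  qed
  have "\<exists>z. z \<in> G p \<and> (\<forall>x\<in>G p. norm_Rd d z \<le> norm_Rd d x)" if p: "p \<in> X" for p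
  proof -
    obtain z where "z \<in> G p" "\<And>x. x \<in> G p \<Longrightarrow> norm_Rd d (\<lambda>i. 0 - z i) \<le> norm_Rd d (\<lambda>i. 0 - x i)"
      using nearest_point[of "G p" d "\<lambda>_. 0"] G(1)[OF p] G(2)[OF p] unfolding closed_convex_def by blast
    moreover have "norm_Rd d (\<lambda>i. 0 - x i) = norm_Rd d x" for x using norm_Rd_scale[where d = d and a = "-1" and x = x] by simp
    ultimately show ?thesis by auto
  qed
  then obtain m where m: "\<And>p. p \<in> X \<Longrightarrow> m p \<in> G p" "\<And>p x. p \<in> X \<Longrightarrow> x \<in> G p \<Longrightarrow> norm_Rd d (m p) \<le> norm_Rd d x"
    by metis
  obtain p0 where p0: "p0 \<in> X" "\<And>p. p \<in> X \<Longrightarrow> norm_Rd d (m p) \<le> norm_Rd d (m p0)"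
  proof -
    have "Max ((\<lambda>p. norm_Rd d (m p)) ` X) \<in> (\<lambda>p. norm_Rd d (m p)) ` X" using finX X0 by (intro Max_in) auto
    then obtain p0 where "p0 \<in> X" "norm_Rd d (m p0) = Max ((\<lambda>p. norm_Rd d (m p)) ` X)" by auto
    moreover have "norm_Rd d (m p) \<le> Max ((\<lambda>p. norm_Rd d (m p)) ` X)" if "p \<in> X" for p
      using finX that by (intro Max_ge) auto
    ultimately show ?thesis using that by auto
  qed
  obtain K0 i0 where K0: "p0 = (K0, i0)" by force
  have i0: "i0 \<le> d" "K0 \<in> PiE {..d} \<F>" using p0(1) by (auto simp: X_def K0)
  have "m p0 \<in> A" if A: "A \<in> \<F> i0" for A
  proof -
    define K1 where "K1 = K0(i0 := A)"
    have "K1 j \<in> \<F> j" if "j \<le> d" for j using i0 A that by (auto simp: K1_def)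
    then have K1: "K1 \<in> PiE {..d} \<F>" using i0 by (auto simp: K1_def PiE_def extensional_def)
    then have XK1: "(K1, i) \<in> X" if "i \<le> d" for i using that by (auto simp: X_def)
    have K1F: "closed_convex d (K1 j)" if "j \<le> d" for j using F(2)[OF that] K1 that by auto
    obtain y where y: "\<And>j. j \<le> d \<Longrightarrow> y \<in> K1 j" using sel[of K1] K1 by (auto simp: PiE_def Pi_def)
    define S where "S = (\<lambda>j. if j \<le> d then K1 j else {x. norm_Rd d x \<le> norm_Rd d (m p0)})"
    define x where "x = (\<lambda>i. if i \<le> d then m (K1, i) else y)"
    have "convex_set (S j)" "cylindrical d (S j)" for j
      using K1F[of j] convex_set_ball cylindrical_ball by (auto simp: S_def closed_convex_def)
    moreover have "x i \<in> S j" if "i < d + 2" "j < d + 2" "i \<noteq> j" for i j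
    proof (cases "i \<le> d")
      case True
      then show ?thesis using m(1)[OF XK1[OF True]] p0(2)[OF XK1[OF True]] that
        by (auto simp: x_def S_def G_def)
    next
      case False
      then show ?thesis using that y by (auto simp: x_def S_def)
    qed
    ultimately obtain z where z: "\<And>j. j < d + 2 \<Longrightarrow> z \<in> S j"
      using Helly_minimal[of d S x] by metis
    \<comment> \<open>\<open>z\<close> is a point of the extremal intersection that is at least as close to the origin as \<open>m p0\<close>\<close>
    have zK: "z \<in> K1 j" if "j \<le> d" for j using z[of j] that by (simp add: S_def)
    have zn: "norm_Rd d z \<le> norm_Rd d (m p0)" using z[of "d + 1"] by (simp add: S_def)
    have "z \<in> K0 j" if "j \<le> d" "j \<noteq> i0" for j using zK[OF that(1)] that(2) by (simp add: K1_def)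
    then have zG: "z \<in> G p0" by (auto simp: G_def K0)
    let ?p = "m p0"
    have neg: "norm_Rd d (\<lambda>i. 0 - x i) = norm_Rd d x" for x using norm_Rd_scale[where d = d and a = "-1" and x = x] by simp
    have "dot d (\<lambda>i. 0 - ?p i) (\<lambda>i. z i - ?p i) \<le> 0"
      using nearest_point_obtuse[of "G p0" ?p "\<lambda>_. 0" d z] m[OF p0(1)] G(1)[OF p0(1)] zG
      by (simp only: neg) (auto simp: closed_convex_def)
    then have "(norm_Rd d ?p)\<^sup>2 \<le> dot d ?p z"
      using dot_scale_left[of d "-1" ?p "\<lambda>i. z i - ?p i"] by (simp add: dot_diff dot_self)
    moreover have "(norm_Rd d z)\<^sup>2 \<le> (norm_Rd d ?p)\<^sup>2" using zn by (intro power_mono) auto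
    ultimately have "(norm_Rd d (\<lambda>i. z i - ?p i))\<^sup>2 \<le> 0"
      unfolding norm_Rd_sub_sq dot_commute[of d z] by linarith
    then have "norm_Rd d (\<lambda>i. z i - ?p i) = 0" by simp
    then have "z i = ?p i" if "i < d" for i using that by (auto simp: L2_set_eq_0_iff)
    then show ?thesis using cylindricalD[of d A z ?p] zK[OF i0(1)] F(2)[OF i0(1) A] by (auto simp: K1_def closed_convex_def)
  qed
  then show ?thesis using that i0 by blast
qed

section \<open>The volume of ellipsoids\<close>

abbreviation lborel_Rd :: "nat \<Rightarrow> (nat \<Rightarrow> real) measure" where
  "lborel_Rd d \<equiv> Pi\<^sub>M {..<d} (\<lambda>_. lborel)"

lemma space_lborel_Rd: "space (lborel_Rd d) = Rd d"
  by (simp add: space_PiM Rd_def)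

lemma measurable_coord: "i < d \<Longrightarrow> (\<lambda>x. x i) \<in> borel_measurable (lborel_Rd d)"
  using measurable_component_singleton[of i "{..<d}" "\<lambda>_. lborel"] by simp

text \<open>
  Integrate over the last coordinate first: for fixed earlier coordinates the triangular map is
  an affine map of the line with slope \<open>L d d\<close>.
\<close>

lemma triangular_nn_integral:
  assumes "f \<in> borel_measurable (lborel_Rd d)" "\<And>i. i < d \<Longrightarrow> L i i \<noteq> 0"
  shows "(\<integral>\<^sup>+x. f x \<partial>lborel_Rd d) =
    ennreal (\<Prod>i<d. \<bar>L i i\<bar>) * (\<integral>\<^sup>+x. f (\<lambda>i\<in>{..<d}. (\<Sum>j<Suc i. L i j * x j) + b i) \<partial>lborel_Rd d)"
  using assms
proof (induction d arbitrary: f)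
  case 0
  then show ?case by (simp add: PiM_empty nn_integral_count_space_finite restrict_def)
next
  case (Suc d)
  interpret product_sigma_finite "\<lambda>_::nat. lborel :: real measure" by unfold_locales
  have ins: "{..<Suc d} = insert d {..<d}" by auto
  let ?T = "\<lambda>d x. \<lambda>i\<in>{..<d}. (\<Sum>j<Suc i. L i j * x j) + b i"
  have f: "f \<in> borel_measurable (Pi\<^sub>M (insert d {..<d}) (\<lambda>_. lborel))"
    using Suc.prems(1) by (simp add: ins)
  have upd: "(\<lambda>(x, y). x(d := y)) \<in> measurable (lborel_Rd d \<Otimes>\<^sub>M lborel) (Pi\<^sub>M (insert d {..<d}) (\<lambda>_. lborel))"
    using measurable_add_dim[of d "{..<d}" "\<lambda>_. lborel"] by simp
  have f2: "(\<lambda>(x, y). f (x(d := y))) \<in> borel_measurable (lborel_Rd d \<Otimes>\<^sub>M lborel)"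
    using measurable_compose[OF upd f] by (simp add: case_prod_unfold)
  define g where "g = (\<lambda>x. \<integral>\<^sup>+y. f (x(d := y)) \<partial>lborel)"
  have g: "g \<in> borel_measurable (lborel_Rd d)"
    unfolding g_def using f2 by (rule lborel.borel_measurable_nn_integral)
  have fy: "(\<lambda>y. f (x(d := y))) \<in> borel_measurable borel" if "x \<in> space (lborel_Rd d)" for x
    using measurable_compose[OF measurable_Pair1'[OF that, of lborel] f2] by (simp add: measurable_lborel1)
  have Tsp: "?T d x \<in> space (lborel_Rd d)" for x by (auto simp: space_PiM)
  have TPd: "?T n \<in> measurable (lborel_Rd n) (lborel_Rd n)" for n
  proof (rule measurable_restrict)
    fix i assume "i \<in> {..<n}"
    then show "(\<lambda>x. (\<Sum>j<Suc i. L i j * x j) + b i) \<in> measurable (lborel_Rd n) lborel"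
      by (simp only: measurable_lborel1)
        (intro borel_measurable_add borel_measurable_sum borel_measurable_times measurable_coord, auto)
  qed
  have key: "g (?T d x) = ennreal \<bar>L d d\<bar> * (\<integral>\<^sup>+y. f (?T (Suc d) (x(d := y))) \<partial>lborel)"
    if "x \<in> space (lborel_Rd d)" for x
  proof -
    let ?c = "(\<Sum>j<d. L d j * x j) + b d"
    have "g (?T d x) = ennreal \<bar>L d d\<bar> * (\<integral>\<^sup>+y. f ((?T d x)(d := ?c + L d d * y)) \<partial>lborel)"
      unfolding g_def using nn_integral_real_affine[OF fy[OF Tsp[of x]], where c = "L d d" and t = ?c] Suc.prems(2)[of d] by simp
    moreover have "(?T d x)(d := ?c + L d d * y) = ?T (Suc d) (x(d := y))" for y
      by (rule ext) (auto simp: restrict_def less_Suc_eq)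
    ultimately show ?thesis by (simp only:)
  qed
  have fT: "(\<lambda>x. f (?T (Suc d) x)) \<in> borel_measurable (Pi\<^sub>M (insert d {..<d}) (\<lambda>_. lborel))"
    using measurable_compose[OF TPd Suc.prems(1)] by (simp only: ins)
  have "(\<lambda>(x, y). f (?T (Suc d) (x(d := y)))) \<in> borel_measurable (lborel_Rd d \<Otimes>\<^sub>M lborel)"
    using measurable_compose[OF upd fT] by (simp add: case_prod_unfold)
  then have meas: "(\<lambda>x. \<integral>\<^sup>+y. f (?T (Suc d) (x(d := y))) \<partial>lborel) \<in> borel_measurable (lborel_Rd d)"
    by (rule lborel.borel_measurable_nn_integral)
  have "(\<integral>\<^sup>+x. f x \<partial>lborel_Rd (Suc d)) = (\<integral>\<^sup>+x. g x \<partial>lborel_Rd d)"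
    unfolding ins g_def using f by (subst product_nn_integral_insert) auto
  also have "\<dots> = ennreal (\<Prod>i<d. \<bar>L i i\<bar>) * (\<integral>\<^sup>+x. g (?T d x) \<partial>lborel_Rd d)"
    using Suc.prems(2) by (intro Suc.IH[OF g]) auto
  also have "(\<integral>\<^sup>+x. g (?T d x) \<partial>lborel_Rd d) =
      (\<integral>\<^sup>+x. ennreal \<bar>L d d\<bar> * (\<integral>\<^sup>+y. f (?T (Suc d) (x(d := y))) \<partial>lborel) \<partial>lborel_Rd d)"
    using key by (intro nn_integral_cong) auto
  also have "\<dots> = ennreal \<bar>L d d\<bar> * (\<integral>\<^sup>+x. (\<integral>\<^sup>+y. f (?T (Suc d) (x(d := y))) \<partial>lborel) \<partial>lborel_Rd d)"
    using meas by (rule nn_integral_cmult)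
  also have "(\<integral>\<^sup>+x. (\<integral>\<^sup>+y. f (?T (Suc d) (x(d := y))) \<partial>lborel) \<partial>lborel_Rd d) = (\<integral>\<^sup>+x. f (?T (Suc d) x) \<partial>lborel_Rd (Suc d))"
    unfolding ins using fT by (subst product_nn_integral_insert) (auto simp: ins)
  finally show ?case
    by (simp only: prod.lessThan_Suc ennreal_mult prod_nonneg abs_ge_zero mult.assoc)
qed

definition ball_volume :: "nat \<Rightarrow> real" where
  "ball_volume d = measure (Rd_lebesgue d) (unit_ball_Rd d)"

lemma ellipsoid_eq:
  assumes C: "\<And>x i. i < d \<Longrightarrow> app_mat d A (app_mat d C x) i = x i" "\<And>x i. i < d \<Longrightarrow> app_mat d C (app_mat d A x) i = x i"
  shows "(\<lambda>x. \<lambda>i\<in>{..<d}. app_mat d A x i + b i) ` unit_ball_Rd d = {y \<in> Rd d. norm_Rd d (app_mat d C (\<lambda>i. y i - b i)) \<le> 1}"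
proof (rule subset_antisym; rule subsetI)
  fix y assume "y \<in> (\<lambda>x. \<lambda>i\<in>{..<d}. app_mat d A x i + b i) ` unit_ball_Rd d"
  then obtain x where x: "norm_Rd d x \<le> 1" "y = (\<lambda>i\<in>{..<d}. app_mat d A x i + b i)" by (auto simp: unit_ball_Rd_def)
  have "app_mat d C (\<lambda>i. y i - b i) = app_mat d C (app_mat d A x)" by (rule app_mat_cong) (simp add: x)
  then have "norm_Rd d (app_mat d C (\<lambda>i. y i - b i)) = norm_Rd d x" by (simp only:) (rule norm_Rd_cong, rule C(2))
  then show "y \<in> {y \<in> Rd d. norm_Rd d (app_mat d C (\<lambda>i. y i - b i)) \<le> 1}" using x by (simp add: Rd_def)
next
  fix y assume y: "y \<in> {y \<in> Rd d. norm_Rd d (app_mat d C (\<lambda>i. y i - b i)) \<le> 1}"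
  define x where "x = (\<lambda>i\<in>{..<d}. app_mat d C (\<lambda>i. y i - b i) i)"
  have "norm_Rd d x = norm_Rd d (app_mat d C (\<lambda>i. y i - b i))" by (rule norm_Rd_cong) (simp add: x_def)
  then have "x \<in> unit_ball_Rd d" using y by (auto simp: unit_ball_Rd_def Rd_def x_def)
  moreover have "y = (\<lambda>i\<in>{..<d}. app_mat d A x i + b i)"
  proof
    fix i
    have "app_mat d A x = app_mat d A (app_mat d C (\<lambda>i. y i - b i))" by (rule app_mat_cong) (simp add: x_def)
    then show "y i = (\<lambda>i\<in>{..<d}. app_mat d A x i + b i) i"
      using C(1)[of i "\<lambda>i. y i - b i"] y by (auto simp: Rd_def PiE_def extensional_def)
  qed
  ultimately show "y \<in> (\<lambda>x. \<lambda>i\<in>{..<d}. app_mat d A x i + b i) ` unit_ball_Rd d" by blast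
qed

lemma measurable_app_mat:
  assumes "\<And>j. j < d \<Longrightarrow> (\<lambda>x. f x j) \<in> borel_measurable M"
  shows "(\<lambda>x. app_mat d A (f x) i) \<in> borel_measurable M"
  unfolding app_mat_def using assms by (intro borel_measurable_sum borel_measurable_times) auto

lemma measurable_norm_Rd:
  assumes "\<And>j. j < d \<Longrightarrow> (\<lambda>x. f x j) \<in> borel_measurable M"
  shows "(\<lambda>x. norm_Rd d (f x)) \<in> borel_measurable M"
  unfolding L2_set_def using assms
  by (intro measurable_compose[OF _ borel_measurable_sqrt] borel_measurable_sum borel_measurable_power) auto

text \<open>
  Since the ball is invariant under orthogonal maps, \<open>A\<close> may be replaced by the triangular
  matrix \<open>A Q\<^sup>T\<close>, whose diagonal product is \<open>\<bar>det A\<bar>\<close>.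
\<close>

lemma emeasure_ellipsoid:
  fixes b :: "nat \<Rightarrow> real"
  assumes "Det d A \<noteq> 0"
  defines "E \<equiv> (\<lambda>x. \<lambda>i\<in>{..<d}. app_mat d A x i + b i) ` unit_ball_Rd d"
  shows "E \<in> sets (lborel_Rd d)" "emeasure (lborel_Rd d) E = ennreal \<bar>Det d A\<bar> * emeasure (lborel_Rd d) (unit_ball_Rd d)"
proof -
  obtain C where C: "\<And>x i. i < d \<Longrightarrow> app_mat d A (app_mat d C x) i = x i" "\<And>x i. i < d \<Longrightarrow> app_mat d C (app_mat d A x) i = x i"
    using Det_inverse[OF assms(1)] by metis
  have E: "E = {y \<in> Rd d. norm_Rd d (app_mat d C (\<lambda>i. y i - b i)) \<le> 1}"
    unfolding E_def by (rule ellipsoid_eq[OF C])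
  have "(\<lambda>y. norm_Rd d (app_mat d C (\<lambda>i. y i - b i))) \<in> borel_measurable (lborel_Rd d)"
    by (rule measurable_norm_Rd, rule measurable_app_mat, rule borel_measurable_diff[OF measurable_coord]) simp_all
  then have "{y \<in> space (lborel_Rd d). norm_Rd d (app_mat d C (\<lambda>i. y i - b i)) \<le> 1} \<in> sets (lborel_Rd d)" by measurable
  then show Es: "E \<in> sets (lborel_Rd d)" by (simp add: E space_lborel_Rd)
  have "(\<lambda>y. norm_Rd d y) \<in> borel_measurable (lborel_Rd d)"
    by (rule measurable_norm_Rd, rule measurable_coord)
  then have "{y \<in> space (lborel_Rd d). norm_Rd d y \<le> 1} \<in> sets (lborel_Rd d)" by measurable
  then have Bs: "unit_ball_Rd d \<in> sets (lborel_Rd d)" by (simp add: unit_ball_Rd_def space_lborel_Rd)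
  obtain Q where Q: "orthonormal d Q" "\<And>j k. j < k \<Longrightarrow> k < d \<Longrightarrow> dot d (A j) (Q k) = 0" using QR[where d=d and A=A] by metis
  define L where "L = mat_prod d A (transposed Q)"
  have Ldot: "L i j = dot d (A i) (Q j)" for i j by (simp add: L_def mat_prod_def transposed_def dot_def)
  have DetL: "\<bar>Det d A\<bar> = (\<Prod>i<d. \<bar>L i i\<bar>)" using Det_QR[OF Q] by (simp add: Ldot)
  have L0: "L i i \<noteq> 0" if "i < d" for i
  proof
    assume "L i i = 0"
    then have "(\<Prod>i<d. \<bar>L i i\<bar>) = 0" using that by (intro prod_zero) auto
    then show False using DetL assms(1) by linarith
  qed
  let ?T = "\<lambda>x. \<lambda>i\<in>{..<d}. (\<Sum>j<Suc i. L i j * x j) + b i"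
  have T: "?T x = (\<lambda>i\<in>{..<d}. app_mat d A (app_mat d (transposed Q) x) i + b i)" for x
  proof (rule restrict_ext)
    fix i assume i: "i \<in> {..<d}"
    have "(\<Sum>j<Suc i. L i j * x j) = (\<Sum>j<d. L i j * x j)"
      using i Q(2) by (intro sum.mono_neutral_left) (auto simp: Ldot)
    also have "\<dots> = app_mat d A (app_mat d (transposed Q) x) i" by (simp only: app_mat_mat_prod[symmetric] L_def) (simp only: app_mat_def)
    finally show "(\<Sum>j<Suc i. L i j * x j) + b i = app_mat d A (app_mat d (transposed Q) x) i + b i" by simp
  qed
  have ET: "?T x \<in> E \<longleftrightarrow> x \<in> unit_ball_Rd d" if "x \<in> space (lborel_Rd d)" for x
  proof -
    have "app_mat d C (\<lambda>i. ?T x i - b i) = app_mat d C (app_mat d A (app_mat d (transposed Q) x))"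
      unfolding T by (rule app_mat_cong) simp
    then have "norm_Rd d (app_mat d C (\<lambda>i. ?T x i - b i)) = norm_Rd d (app_mat d (transposed Q) x)"
      by (simp only:) (rule norm_Rd_cong, rule C(2))
    moreover have "?T x \<in> Rd d" by (auto simp: Rd_def)
    ultimately show ?thesis using that unfolding E
      by (auto simp: unit_ball_Rd_def space_lborel_Rd orthonormal_norm_Rd_transposed[OF Q(1)])
  qed
  have "emeasure (lborel_Rd d) E = (\<integral>\<^sup>+x. indicator E x \<partial>lborel_Rd d)" using Es by simp
  also have "\<dots> = ennreal \<bar>Det d A\<bar> * (\<integral>\<^sup>+x. indicator E (?T x) \<partial>lborel_Rd d)"
    unfolding DetL using Es L0 by (intro triangular_nn_integral) auto
  also have "(\<integral>\<^sup>+x. indicator E (?T x) \<partial>lborel_Rd d) = (\<integral>\<^sup>+x. indicator (unit_ball_Rd d) x \<partial>lborel_Rd d)"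
    using ET by (intro nn_integral_cong) (simp add: indicator_def)
  finally show "emeasure (lborel_Rd d) E = ennreal \<bar>Det d A\<bar> * emeasure (lborel_Rd d) (unit_ball_Rd d)"
    using Bs by simp
qed

lemma emeasure_ball:
  shows "unit_ball_Rd d \<in> sets (lborel_Rd d)" "0 < emeasure (lborel_Rd d) (unit_ball_Rd d)" "emeasure (lborel_Rd d) (unit_ball_Rd d) < \<infinity>"
proof -
  interpret product_sigma_finite "\<lambda>_::nat. lborel :: real measure" by unfold_locales
  have "(\<lambda>y. norm_Rd d y) \<in> borel_measurable (lborel_Rd d)"
    by (rule measurable_norm_Rd, rule measurable_coord)
  then have "{y \<in> space (lborel_Rd d). norm_Rd d y \<le> 1} \<in> sets (lborel_Rd d)" by measurable
  then show Bs: "unit_ball_Rd d \<in> sets (lborel_Rd d)" by (simp add: unit_ball_Rd_def space_lborel_Rd)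
  have cube: "emeasure (lborel_Rd d) (PiE {..<d} (\<lambda>_. {-r..r})) = ennreal (2 * r) ^ d" if "r \<ge> 0" for r :: real
    using that by (subst emeasure_PiM) auto
  have "unit_ball_Rd d \<subseteq> PiE {..<d} (\<lambda>_. {-1..1})"
  proof
    fix x assume x: "x \<in> unit_ball_Rd d"
    then have "\<bar>x i\<bar> \<le> 1" if "i < d" for i using abs_le_norm_Rd[OF that, of x] by (auto simp: unit_ball_Rd_def)
    then have "-1 \<le> x i \<and> x i \<le> 1" if "i < d" for i using that by (simp add: abs_le_iff minus_le_iff)
    then show "x \<in> PiE {..<d} (\<lambda>_. {-1..1})" using x by (auto simp: unit_ball_Rd_def Rd_def)
  qed
  then have "emeasure (lborel_Rd d) (unit_ball_Rd d) \<le> ennreal (2 * 1) ^ d"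
    using cube[of 1] by (metis emeasure_mono sets_PiM_I_finite finite_lessThan atLeastAtMost_borel sets_lborel zero_le_one)
  also have "\<dots> < \<infinity>" by (simp add: power_less_top_ennreal)
  finally show "emeasure (lborel_Rd d) (unit_ball_Rd d) < \<infinity>" .
  define r :: real where "r = 1 / (real d + 1)"
  have r: "r > 0" by (simp add: r_def)
  have "PiE {..<d} (\<lambda>_. {-r..r}) \<subseteq> unit_ball_Rd d"
  proof
    fix x assume x: "x \<in> PiE {..<d} (\<lambda>_. {-r..r})"
    have "norm_Rd d x \<le> (\<Sum>i<d. \<bar>x i\<bar>)" by (rule L2_set_le_sum_abs)
    also have "\<dots> \<le> (\<Sum>i<d. r)" using x by (intro sum_mono) (auto simp: PiE_def Pi_def abs_le_iff minus_le_iff)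
    also have "\<dots> \<le> 1" by (simp add: r_def)
    finally show "x \<in> unit_ball_Rd d" using x by (auto simp: unit_ball_Rd_def Rd_def)
  qed
  then have "ennreal (2 * r) ^ d \<le> emeasure (lborel_Rd d) (unit_ball_Rd d)"
    using cube[of r] r emeasure_mono[OF _ Bs] by (metis less_imp_le)
  moreover have "0 < ennreal (2 * r) ^ d" using r by (simp add: ennreal_power)
  ultimately show "0 < emeasure (lborel_Rd d) (unit_ball_Rd d)" by (rule less_le_trans[rotated])
qed

lemma ball_volume_pos: "ball_volume d > 0"
  using emeasure_ball[of d] by (simp add: ball_volume_def Rd_lebesgue_def measure_def enn2real_positive_iff)

lemma measure_ellipsoid:
  assumes "Det d A \<noteq> 0"
  shows "measure (Rd_lebesgue d) ((\<lambda>x. \<lambda>i\<in>{..<d}. app_mat d A x i + b i) ` unit_ball_Rd d) = \<bar>Det d A\<bar> * ball_volume d"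
  using emeasure_ellipsoid[OF assms, of b] emeasure_ball(1)[of d]
  by (simp add: ball_volume_def Rd_lebesgue_def measure_def enn2real_mult)

section \<open>Ellipsoids in convex sets\<close>

text \<open>
  The image of the unit ball under \<open>x \<mapsto> A x + b\<close> lies in \<open>K\<close>. The matrix may be singular.
\<close>

definition ellipsoid_in :: "nat \<Rightarrow> (nat \<Rightarrow> nat \<Rightarrow> real) \<Rightarrow> (nat \<Rightarrow> real) \<Rightarrow> (nat \<Rightarrow> real) set \<Rightarrow> bool" where
  "ellipsoid_in d A b K \<longleftrightarrow> (\<forall>x. norm_Rd d x \<le> 1 \<longrightarrow> (\<lambda>i. app_mat d A x i + b i) \<in> K)"

lemma ellipsoid_inD: "ellipsoid_in d A b K \<Longrightarrow> norm_Rd d x \<le> 1 \<Longrightarrow> (\<lambda>i. app_mat d A x i + b i) \<in> K"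
  by (simp add: ellipsoid_in_def)

lemma norm_Rd_zero [simp]: "norm_Rd d (\<lambda>i. 0) = 0"
  by (simp add: L2_set_def)

text \<open>
  The support function of the ellipsoid in direction \<open>u\<close> is \<open>\<bar>A\<^sup>T u\<bar> + \<langle>u, b\<rangle>\<close>.
\<close>

lemma ellipsoid_in_support:
  assumes "ellipsoid_in d A b K" "\<And>z. z \<in> K \<Longrightarrow> dot d u z \<le> h"
  shows "norm_Rd d (app_mat d (transposed A) u) + dot d u b \<le> h"
proof -
  define w where "w = app_mat d (transposed A) u"
  define x where "x = (\<lambda>i. (if norm_Rd d w = 0 then 0 else 1 / norm_Rd d w) * w i)"
  have "norm_Rd d x \<le> 1" by (simp add: x_def norm_Rd_scale)
  then have "dot d u (\<lambda>i. app_mat d A x i + b i) \<le> h" using assms(2)[OF ellipsoid_inD[OF assms(1)]] by blast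
  moreover have "dot d u (app_mat d A x) = norm_Rd d w"
    unfolding dot_app_mat w_def[symmetric] by (simp add: x_def dot_scale dot_self power2_eq_square)
  ultimately show ?thesis by (simp add: dot_add w_def)
qed

lemma closed_convex_preimage:
  assumes "closed_convex d K"
  shows "closed_convex d {x. (\<lambda>i. app_mat d T x i + t i) \<in> K}" (is "closed_convex d ?P")
proof -
  have K: "closed K" "convex_set K" "cylindrical d K" using assms by (auto simp: closed_convex_def)
  have "continuous_on UNIV (\<lambda>x. app_mat d T x i + t i)" for i
    unfolding app_mat_def
    by (rule continuous_on_add[OF continuous_on_sum[OF continuous_on_mult[OF continuous_on_const continuous_on_coord]] continuous_on_const])
  then have "continuous_on UNIV (\<lambda>x i. app_mat d T x i + t i)"
    by (rule continuous_on_coordinatewise_then_product)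
  then have "closed ((\<lambda>x i. app_mat d T x i + t i) -` K)"
    using K(1) continuous_closed_vimage continuous_on_eq_continuous_at open_UNIV by blast
  moreover have "(\<lambda>x i. app_mat d T x i + t i) -` K = ?P" by auto
  ultimately have 1: "closed ?P" by simp
  have 2: "convex_set ?P" unfolding convex_set_def[of ?P]
  proof (intro ballI allI impI)
    fix x y and u v :: real
    assume *: "x \<in> ?P" "y \<in> ?P" "0 \<le> u" "0 \<le> v" "u + v = 1"
    have "(\<lambda>i. u * (app_mat d T x i + t i) + v * (app_mat d T y i + t i)) \<in> K"
      using convex_setD[OF K(2) _ _ *(3-5)] *(1,2) by simp
    also have "(\<lambda>i. u * (app_mat d T x i + t i) + v * (app_mat d T y i + t i))
        = (\<lambda>i. app_mat d T (\<lambda>i. u * x i + v * y i) i + t i)"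
    proof
      fix i
      have "u * t i + v * t i = t i" using *(5) by (simp add: distrib_right[symmetric])
      then show "u * (app_mat d T x i + t i) + v * (app_mat d T y i + t i) = app_mat d T (\<lambda>i. u * x i + v * y i) i + t i"
        by (simp add: app_mat_lin algebra_simps)
    qed
    finally show "(\<lambda>i. u * x i + v * y i) \<in> ?P" by simp
  qed
  have 3: "cylindrical d ?P" unfolding cylindrical_def[of d ?P]
  proof (intro allI impI)
    fix x y assume *: "x \<in> ?P" "\<forall>i<d. x i = y i"
    have "app_mat d T x = app_mat d T y" using *(2) by (intro app_mat_cong) simp
    then show "y \<in> ?P" using *(1) by simp
  qed
  show ?thesis using 1 2 3 by (simp add: closed_convex_def)
qed

text \<open>
  The admissible centres of translates of a fixed ellipsoid inside \<open>K\<close>: an intersection of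
  translates of \<open>K\<close>.
\<close>

lemma closed_convex_erosion:
  assumes "closed_convex d K"
  shows "closed_convex d {y. ellipsoid_in d A y K}"
proof -
  have K: "cylindrical d K" using assms by (simp add: closed_convex_def)
  have "{y. ellipsoid_in d A y K} = (\<Inter>x\<in>{x. norm_Rd d x \<le> 1}. {y. (\<lambda>i. app_mat d id_mat y i + app_mat d A x i) \<in> K})"
  proof -
    have "(\<lambda>i. app_mat d A x i + y i) \<in> K \<longleftrightarrow> (\<lambda>i. app_mat d id_mat y i + app_mat d A x i) \<in> K" for x y
      using cylindricalD[OF K, of "\<lambda>i. app_mat d A x i + y i" "\<lambda>i. app_mat d id_mat y i + app_mat d A x i"]
        cylindricalD[OF K, of "\<lambda>i. app_mat d id_mat y i + app_mat d A x i" "\<lambda>i. app_mat d A x i + y i"] by (auto simp: app_mat_idm')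
    then show ?thesis by (auto simp: ellipsoid_in_def)
  qed
  also have "closed_convex d \<dots>" using closed_convex_preimage[OF assms] by (intro closed_convex_INT)
  finally show ?thesis .
qed

lemma ellipsoid_in_preimage:
  "ellipsoid_in d A b {x. (\<lambda>i. app_mat d T x i + t i) \<in> K} \<longleftrightarrow> ellipsoid_in d (mat_prod d T A) (\<lambda>i. app_mat d T b i + t i) K"
proof -
  have "app_mat d T (\<lambda>i. app_mat d A x i + b i) = (\<lambda>i. app_mat d T (app_mat d A x) i + app_mat d T b i)" for x
    using app_mat_lin[of d T 1 "app_mat d A x" 1 b] by simp
  then show ?thesis by (simp add: ellipsoid_in_def app_mat_mat_prod add.assoc)
qed

lemma ellipsoid_in_pullback:
  assumes T: "\<And>x i. i < d \<Longrightarrow> app_mat d T (app_mat d C x) i = x i" and "ellipsoid_in d A b K" "cylindrical d K"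
  shows "ellipsoid_in d (mat_prod d C A) (app_mat d C (\<lambda>i. b i - t i)) {x. (\<lambda>i. app_mat d T x i + t i) \<in> K}"
  unfolding ellipsoid_in_def
proof (intro allI impI)
  fix x assume x: "norm_Rd d x \<le> 1"
  let ?z = "\<lambda>i. app_mat d (mat_prod d C A) x i + app_mat d C (\<lambda>i. b i - t i) i"
  have z: "?z = app_mat d C (\<lambda>i. app_mat d A x i + (b i - t i))"
    using app_mat_lin[of d C 1 "app_mat d A x" 1 "\<lambda>i. b i - t i"] by (simp add: app_mat_mat_prod)
  have "(\<lambda>i. app_mat d T ?z i + t i) \<in> K"
    by (rule cylindricalD[OF assms(3) ellipsoid_inD[OF assms(2) x]]) (simp add: z T)
  then show "?z \<in> {x. (\<lambda>i. app_mat d T x i + t i) \<in> K}" by simp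
qed

section \<open>Outer normals of sets with an almost largest ball\<close>

text \<open>
  The size \<open>e\<close> of the perturbation is so small that the terms of order \<open>e\<^sup>2\<close>, which carry factors up to
  \<open>d\<^sup>2\<close>, are dominated by the terms of order \<open>e\<close>. No limit \<open>e \<rightarrow> 0\<close> is taken.
\<close>

lemma stretch_parameter:
  assumes "d \<ge> 1" "e = 1 / (2 * (real d)\<^sup>2)"
  shows "1 \<le> (real d)\<^sup>2" "0 < e" "e * (real d)\<^sup>2 = 1 / 2" "e * real d \<le> 1 / 2" "e \<le> 1 / 2"
proof -
  have d: "real d \<ge> 1" using assms by simp
  then show d2: "1 \<le> (real d)\<^sup>2" by (rule one_le_power)
  then show e: "0 < e" "e * (real d)\<^sup>2 = 1 / 2" using d by (simp_all add: assms(2))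
  have "real d \<le> (real d)\<^sup>2" using mult_left_mono[OF d, of "real d"] by (simp add: power2_eq_square)
  then have "e * real d \<le> e * (real d)\<^sup>2" using e(1) by (intro mult_left_mono) auto
  then show "e * real d \<le> 1 / 2" using e(2) by linarith
  have "e * 1 \<le> e * (real d)\<^sup>2" using e(1) d2 by (intro mult_left_mono) auto
  then show "e \<le> 1 / 2" using e(2) by linarith
qed

text \<open>
  The factor by which the volume grows when one axis is stretched by \<open>1 + d e\<close> and the others are
  shrunk by \<open>1 - e\<close>.
\<close>

lemma stretch_Det:
  assumes "d \<ge> 1" "e = 1 / (2 * (real d)\<^sup>2)"
  shows "(1 + real d * e) * (1 - e) ^ (d - 1) \<ge> 1 + 1 / (4 * (real d)\<^sup>2)"
proof -
  have d: "real d \<ge> 1" using assms by simp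
  have e: "0 < e" "e \<le> 1" "e * (real d)\<^sup>2 = 1 / 2" using stretch_parameter[OF assms] by auto
  have "1 + real (d - 1) * (- e) \<le> (1 + (- e)) ^ (d - 1)"
    using e by (intro Bernoulli_inequality) auto
  then have B: "1 - (real d - 1) * e \<le> (1 - e) ^ (d - 1)" using assms(1) by (simp add: of_nat_diff)
  have "1 + 1 / (4 * (real d)\<^sup>2) = 1 + e / 2" by (simp add: assms(2))
  also have "\<dots> \<le> (1 + real d * e) * (1 - (real d - 1) * e)"
  proof -
    have "(1 + real d * e) * (1 - (real d - 1) * e) = 1 + e - e * (e * (real d)\<^sup>2) + real d * e * e"
      by (simp add: algebra_simps power2_eq_square)
    also have "\<dots> \<ge> 1 + e - e * (1 / 2)" unfolding e(3) using e(1) d by simp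
    finally show ?thesis by simp
  qed
  also have "\<dots> \<le> (1 + real d * e) * (1 - e) ^ (d - 1)"
    using B e d by (intro mult_left_mono) auto
  finally show ?thesis .
qed

text \<open>
  Here \<open>a + s e q\<close> is the support function of the stretched and shifted ball in a direction that has
  inner product \<open>q\<close> with the axis \<open>p\<close>. It exceeds \<open>1\<close> only if \<open>(d + 1) q\<^sup>2 + s q > 3/4\<close>.
\<close>

lemma stretch_estimate:
  fixes a s q :: real
  assumes "d \<ge> 1" "e = 1 / (2 * (real d)\<^sup>2)" "a\<^sup>2 = (1 + real d * e)\<^sup>2 * q\<^sup>2 + (1 - e)\<^sup>2 * (1 - q\<^sup>2)"
    and "\<bar>q\<bar> \<le> 1" "0 \<le> s" "s \<le> real d + 1"
  shows "a + s * e * q \<le> 1 + e * ((real d + 1) * q\<^sup>2 + s * q - 3 / 4)" "a + s * e * q \<le> 3"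
proof -
  have d: "real d \<ge> 1" using assms by simp
  note d2 = stretch_parameter(1)[OF assms(1,2)] and e = stretch_parameter(2-)[OF assms(1,2)]
  have q2: "0 \<le> q\<^sup>2" "q\<^sup>2 \<le> 1" using assms(4) by (auto simp: abs_square_le_1)
  have "2 * a \<le> a\<^sup>2 + 1" using zero_le_power2[of "a - 1"] by (simp add: power2_eq_square algebra_simps)
  also have "a\<^sup>2 + 1 = 2 + 2 * e * ((real d + 1) * q\<^sup>2 - 1) + e * (e * ((real d)\<^sup>2 * q\<^sup>2 + (1 - q\<^sup>2)))"
    unfolding assms(3) by (simp add: power2_eq_square algebra_simps)
  also have "(real d)\<^sup>2 * q\<^sup>2 + (1 - q\<^sup>2) \<le> (real d)\<^sup>2 * q\<^sup>2 + (real d)\<^sup>2 * (1 - q\<^sup>2)"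
    using mult_right_mono[OF d2(1), of "1 - q\<^sup>2"] q2 by simp
  also have "\<dots> = (real d)\<^sup>2" by (simp add: algebra_simps)
  finally have "2 * a \<le> 2 + 2 * e * ((real d + 1) * q\<^sup>2 - 1) + e * (e * (real d)\<^sup>2)"
    using e(1) by (simp add: mult_left_mono)
  then have "2 * a \<le> 2 + 2 * e * ((real d + 1) * q\<^sup>2 - 1) + e * (1 / 2)" unfolding e(2) .
  then show 1: "a + s * e * q \<le> 1 + e * ((real d + 1) * q\<^sup>2 + s * q - 3 / 4)"
    by (simp add: algebra_simps)
  have "(real d + 1) * q\<^sup>2 \<le> real d + 1" using q2 d mult_left_mono[of "q\<^sup>2" 1 "real d + 1"] by simp
  moreover have "s * q \<le> real d + 1"
  proof -
    have "s * q \<le> s * 1" using assms by (intro mult_left_mono) auto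
    then show ?thesis using assms(6) by simp
  qed
  ultimately have "(real d + 1) * q\<^sup>2 + s * q - 3 / 4 \<le> 2 * real d + 2" by linarith
  then have "e * ((real d + 1) * q\<^sup>2 + s * q - 3 / 4) \<le> e * (2 * real d + 2)"
    using e(1) by (intro mult_left_mono) auto
  also have "\<dots> \<le> 2" using e by (simp add: algebra_simps)
  finally show "a + s * e * q \<le> 3" using 1 by simp
qed

text \<open>
  The ball stretched along \<open>p\<close> and shifted by \<open>s e p\<close> has too large a determinant to lie in all \<open>G i\<close>. A
  hyperplane that separates one of its points from some \<open>G i\<close> has a normal \<open>u\<close> whose offset is
  at least \<open>1\<close>, because \<open>G i\<close> contains the ball, and smaller than the support function of the
  stretched ball.
\<close>

lemma outer_normal:
  assumes d: "d \<ge> 1" and G: "\<And>i. i \<in> I \<Longrightarrow> closed_convex d (G i)" "\<And>i. i \<in> I \<Longrightarrow> ellipsoid_in d id_mat (\<lambda>_. 0) (G i)"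
    and max: "\<forall>A b. (\<forall>i\<in>I. ellipsoid_in d A b (G i)) \<longrightarrow> \<bar>Det d A\<bar> < 1 + 1 / (4 * (real d)\<^sup>2)"
    and p: "norm_Rd d p = 1" and s: "0 \<le> s" "s \<le> real d + 1"
  obtains u i where "i \<in> I" "norm_Rd d u = 1" "\<And>z. z \<in> G i \<Longrightarrow> dot d u z \<le> 3"
    "(real d + 1) * (dot d p u)\<^sup>2 + s * dot d p u > 3 / 4"
proof -
  obtain R where R: "orthonormal d R" "R 0 = p" using orthonormal_first_row[OF p] .
  define e where "e = 1 / (2 * (real d)\<^sup>2)"
  have "0 < e" using stretch_parameter(2)[OF d e_def] .
  define c where "c = (\<lambda>k::nat. if k = 0 then 1 + real d * e else 1 - e)"
  define D where "D = (\<lambda>i j. if i = j then c i else 0)"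
  define A where "A = mat_prod d (transposed R) (mat_prod d D R)"
  define b where "b = (\<lambda>i. (s * e) * p i)"
  have "Det d D = (\<Prod>i<d. c i)" by (subst Det_lower) (auto simp: D_def)
  also have "\<dots> = (1 + real d * e) * (\<Prod>i\<in>{1..<d}. c i)"
    using d by (subst lessThan_atLeast0, subst prod.atLeast_Suc_lessThan) (auto simp: c_def)
  also have "(\<Prod>i\<in>{1..<d}. c i) = (1 - e) ^ (d - 1)"
    by (simp add: c_def)
  finally have DD: "Det d D = (1 + real d * e) * (1 - e) ^ (d - 1)" .
  have "\<bar>Det d A\<bar> = \<bar>Det d D\<bar>" using orthonormal_Det[OF R(1)] by (simp add: A_def Det_mat_prod Det_transposed abs_mult)
  then have "\<bar>Det d A\<bar> \<ge> 1 + 1 / (4 * (real d)\<^sup>2)"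
    using stretch_Det[OF d e_def] DD by linarith
  then have "\<not> (\<forall>i\<in>I. ellipsoid_in d A b (G i))" using max by (meson not_le)
  then obtain i x where i: "i \<in> I" and x: "norm_Rd d x \<le> 1" "(\<lambda>k. app_mat d A x k + b k) \<notin> G i"
    by (auto simp: ellipsoid_in_def)
  let ?y = "\<lambda>k. app_mat d A x k + b k"
  have Gi: "closed_convex d (G i)" "G i \<noteq> {}" using G(1)[OF i] ellipsoid_inD[OF G(2)[OF i], of "\<lambda>_. 0"] by auto
  obtain u h where u: "norm_Rd d u = 1" "\<And>z. z \<in> G i \<Longrightarrow> dot d u z \<le> h" "h < dot d u ?y"
    using separation[OF Gi x(2)] by metis
  have "u \<in> G i"
  proof (rule cylindricalD[of d])
    show "cylindrical d (G i)" using Gi by (simp add: closed_convex_def)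
    show "(\<lambda>k. app_mat d id_mat u k + 0) \<in> G i" using ellipsoid_inD[OF G(2)[OF i], of u] u(1) by simp
  qed (simp add: app_mat_idm')
  \<comment> \<open>the point \<open>u\<close> of the unit ball lies in \<open>G i\<close>\<close>
  then have h1: "1 \<le> h" using u(2)[of u] u(1) by (simp add: dot_self)
  define q where "q = dot d p u"
  have q1: "\<bar>q\<bar> \<le> 1" using dot_le[of d p u] p u(1) by (simp add: q_def)
  define a where "a = norm_Rd d (app_mat d (transposed A) u)"
  define w where "w = app_mat d R u"
  have w0: "w 0 = q" by (simp add: w_def app_mat_row R(2) q_def)
  have wn: "(\<Sum>k<d. (w k)\<^sup>2) = 1"
    using orthonormal_norm_Rd[OF R(1), of u] u(1) dot_self[of d w] by (simp add: w_def[symmetric] dot_def power2_eq_square)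
  have "a\<^sup>2 = (1 + real d * e)\<^sup>2 * q\<^sup>2 + (1 - e)\<^sup>2 * (1 - q\<^sup>2)"
  proof -
    have "transposed D = D" by (intro ext) (auto simp: transposed_def D_def)
    then have "app_mat d (transposed A) u = app_mat d (transposed R) (app_mat d D w)"
      by (simp add: A_def transposed_mat_prod app_mat_mat_prod w_def)
    then have "a\<^sup>2 = (norm_Rd d (app_mat d D w))\<^sup>2" by (simp add: a_def orthonormal_norm_Rd_transposed[OF R(1)])
    also have "\<dots> = (\<Sum>k<d. (c k)\<^sup>2 * (w k)\<^sup>2)"
      unfolding dot_self[symmetric] dot_def D_def
      by (intro sum.cong) (simp_all add: app_mat_diag power2_eq_square)
    also have "\<dots> = (\<Sum>k<d. (1 - e)\<^sup>2 * (w k)\<^sup>2 + (if k = 0 then ((1 + real d * e)\<^sup>2 - (1 - e)\<^sup>2) * (w k)\<^sup>2 else 0))"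
      by (intro sum.cong) (auto simp: c_def algebra_simps)
    also have "\<dots> = (1 - e)\<^sup>2 * (\<Sum>k<d. (w k)\<^sup>2) + ((1 + real d * e)\<^sup>2 - (1 - e)\<^sup>2) * (w 0)\<^sup>2"
      using d by (simp add: sum.distrib sum_distrib_left)
    finally show ?thesis by (simp add: wn w0 algebra_simps)
  qed
  note est = stretch_estimate[OF d e_def this q1 s]
  have "dot d u ?y = dot d (app_mat d (transposed A) u) x + s * e * q"
    by (simp add: dot_add dot_app_mat b_def dot_scale q_def dot_commute[of d u p])
  also have "dot d (app_mat d (transposed A) u) x \<le> a * norm_Rd d x" using dot_le[of d "app_mat d (transposed A) u" x] by (simp add: a_def)
  also have "a * norm_Rd d x \<le> a * 1" using x(1) by (intro mult_left_mono) (auto simp: a_def)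
  finally have y: "dot d u ?y \<le> a + s * e * q" by simp
  show ?thesis
  proof (rule that[OF i u(1)])
    show "dot d u z \<le> 3" if "z \<in> G i" for z using u(2)[OF that] u(3) y est(2) by linarith
    have "0 < e * ((real d + 1) * q\<^sup>2 + s * q - 3 / 4)" using h1 u(3) y est(1) by linarith
    then show "(real d + 1) * (dot d p u)\<^sup>2 + s * dot d p u > 3 / 4"
      using \<open>0 < e\<close> by (simp add: zero_less_mult_iff q_def[symmetric])
  qed
qed

section \<open>Frames and balanced combinations of normals\<close>

text \<open>
  Choose \<open>u k\<close> so that it is far from orthogonal to a unit vector \<open>Q k\<close> that is orthogonal to all
  earlier choices. Then \<open>u Q\<^sup>T\<close> is triangular with large diagonal, and \<open>\<bar>det Q\<bar> \<le> 1\<close>.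
\<close>

lemma greedy_frame:
  assumes U: "\<And>p. norm_Rd d p = 1 \<Longrightarrow> \<exists>u\<in>U. r \<le> \<bar>dot d p u\<bar>" and r: "0 \<le> r"
  obtains u where "\<And>k. k < d \<Longrightarrow> u k \<in> U" "r ^ d \<le> \<bar>Det d u\<bar>"
proof -
  have "\<exists>u Q. \<forall>k<n. u k \<in> U \<and> norm_Rd d (Q k) = 1 \<and> r \<le> \<bar>dot d (Q k) (u k)\<bar> \<and> (\<forall>j<k. dot d (u j) (Q k) = 0)"
    if "n \<le> d" for n
    using that
  proof (induction n)
    case 0
    then show ?case by simp
  next
    case (Suc n)
    then obtain u Q where uQ: "\<And>k. k < n \<Longrightarrow> u k \<in> U \<and> norm_Rd d (Q k) = 1 \<and> r \<le> \<bar>dot d (Q k) (u k)\<bar>"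
       "\<And>k j. k < n \<Longrightarrow> j < k \<Longrightarrow> dot d (u j) (Q k) = 0" by (metis Suc_leD)
    obtain q where q: "norm_Rd d q = 1" "\<And>k. k < n \<Longrightarrow> dot d (u k) q = 0"
      using orthogonal_direction[of n d u] Suc.prems by auto
    obtain w where w: "w \<in> U" "r \<le> \<bar>dot d q w\<bar>" using U[OF q(1)] by blast
    show ?case
    proof (rule exI[of _ "u(n := w)"], rule exI[of _ "Q(n := q)"], intro allI impI)
      fix k assume "k < Suc n"
      then show "(u(n := w)) k \<in> U \<and> norm_Rd d ((Q(n := q)) k) = 1 \<and> r \<le> \<bar>dot d ((Q(n := q)) k) ((u(n := w)) k)\<bar> \<and>
         (\<forall>j<k. dot d ((u(n := w)) j) ((Q(n := q)) k) = 0)"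
        using uQ[of k] q w by (cases "k = n") auto
    qed
  qed
  from this[of d] obtain u Q where uQ: "\<And>k. k < d \<Longrightarrow> u k \<in> U \<and> norm_Rd d (Q k) = 1 \<and> r \<le> \<bar>dot d (Q k) (u k)\<bar>"
       "\<And>k j. k < d \<Longrightarrow> j < k \<Longrightarrow> dot d (u j) (Q k) = 0" by auto
  have "r ^ d = (\<Prod>k<d. r)" by simp
  also have "\<dots> \<le> (\<Prod>k<d. \<bar>dot d (u k) (Q k)\<bar>)"
    using uQ(1) r by (intro prod_mono) (auto simp: dot_commute[of d "u _"])
  also have "\<dots> = \<bar>\<Prod>k<d. dot d (u k) (Q k)\<bar>" by (simp add: abs_prod)
  also have "(\<Prod>k<d. dot d (u k) (Q k)) = Det d (\<lambda>i j. dot d (u i) (Q j))"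
    using uQ(2) by (subst Det_lower) auto
  also have "\<dots> = Det d (mat_prod d u (transposed Q))" by (simp add: mat_prod_def transposed_def dot_def)
  also have "\<bar>\<dots>\<bar> = \<bar>Det d u\<bar> * \<bar>Det d Q\<bar>" by (simp add: Det_mat_prod Det_transposed abs_mult)
  also have "\<dots> \<le> \<bar>Det d u\<bar> * 1"
  proof (rule mult_left_mono)
    have "\<bar>Det d Q\<bar> \<le> (\<Prod>k<d. norm_Rd d (Q k))" by (rule Hadamard)
    also have "\<dots> = 1" using uQ(1) by simp
    finally show "\<bar>Det d Q\<bar> \<le> 1" .
  qed simp
  finally show ?thesis using that[of u] uQ(1) by simp
qed

lemma continuous_dot: "continuous_on S (dot d p)"
  unfolding dot_def
  by (rule continuous_on_sum[OF continuous_on_mult[OF continuous_on_const continuous_on_coord]])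

text \<open>
  Compactness of the sphere: finitely many elements of \<open>U\<close> already serve all directions.
\<close>

lemma finite_directions:
  assumes U: "\<And>p. norm_Rd d p = 1 \<Longrightarrow> \<exists>u\<in>U. r < dot d p u"
  obtains W where "finite W" "W \<subseteq> U" "\<And>p. norm_Rd d p = 1 \<Longrightarrow> \<exists>u\<in>W. r < dot d p u"
proof -
  define S where "S = {x. \<forall>i. x i \<in> (if i < d then {-1..1::real} else {0})} \<inter> {x. norm_Rd d x = 1}"
  have "closed {x. norm_Rd d (\<lambda>i. 0 - x i) = 1}"
    by (rule closed_Collect_eq[OF continuous_norm_Rd_diff continuous_on_const])
  moreover have "norm_Rd d (\<lambda>i. 0 - x i) = norm_Rd d x" for x
    using norm_Rd_scale[where d = d and a = "-1" and x = x] by simp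
  ultimately have "closed {x. norm_Rd d x = 1}" by simp
  then have "compact S" unfolding S_def
    by (intro compact_Int_closed compact_coordinatewise) auto
  moreover have "open {p. r < dot d u p}" if "u \<in> U" for u
    by (rule open_Collect_less[OF continuous_on_const continuous_dot])
  moreover have "S \<subseteq> (\<Union>u\<in>U. {p. r < dot d u p})"
    using U by (force simp: S_def dot_commute[of d _ _])
  ultimately obtain W where W: "W \<subseteq> U" "finite W" "S \<subseteq> (\<Union>u\<in>W. {p. r < dot d u p})"
    by (rule compactE_image)
  show ?thesis
  proof (rule that[OF W(2,1)])
    fix p assume p: "norm_Rd d p = 1"
    define p' where "p' = (\<lambda>i. if i < d then p i else 0)"
    have "norm_Rd d p' = norm_Rd d p" by (rule norm_Rd_cong) (simp add: p'_def)
    then have n: "norm_Rd d p' = 1" using p by simp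
    have "- 1 \<le> p i \<and> p i \<le> 1" if "i < d" for i using abs_le_norm_Rd[OF that, of p] p by (simp add: abs_le_iff minus_le_iff)
    then have "p' \<in> S" using n by (auto simp: S_def p'_def)
    then obtain u where u: "u \<in> W" "r < dot d u p'" using W(3) by blast
    have "dot d u p' = dot d p u"
      by (subst dot_commute) (rule dot_cong, simp_all add: p'_def)
    then show "\<exists>u\<in>W. r < dot d p u" using u by auto
  qed
qed

text \<open>
  If \<open>y\<close> were outside the hull of the finitely many points of \<open>finite_directions\<close>, then the direction
  from the nearest point of the hull to \<open>y\<close> would have inner product at most \<open>r\<close> with all of them.
\<close>

lemma ball_in_hull:
  assumes U: "\<And>p. norm_Rd d p = 1 \<Longrightarrow> \<exists>u\<in>U. r < dot d p u" and y: "norm_Rd d y \<le> r" and d: "d \<ge> 1"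
  obtains W \<mu> where "finite W" "W \<subseteq> U" "\<And>w. w \<in> W \<Longrightarrow> 0 \<le> \<mu> w" "(\<Sum>w\<in>W. \<mu> w) = 1"
    "\<And>i. i < d \<Longrightarrow> y i = (\<Sum>w\<in>W. \<mu> w * w i)"
proof -
  obtain W where W: "finite W" "W \<subseteq> U" "\<And>p. norm_Rd d p = 1 \<Longrightarrow> \<exists>u\<in>W. r < dot d p u"
    using finite_directions[OF U] by metis
  obtain f and n :: nat where f: "W = f ` {..<n}" "inj_on f {..<n}"
    using finite_imp_nat_seg_image_inj_on[OF W(1)] by (metis lessThan_def)
  define M where "M = {\<mu>. \<forall>i. \<mu> i \<in> (if i < n then {0..1::real} else {0})} \<inter> {\<mu>. (\<Sum>i<n. \<mu> i) = 1}"
  define z where "z = (\<lambda>\<mu> i. \<Sum>j<n. \<mu> j * f j i)"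
  have "closed {\<mu>. (\<Sum>i<n. \<mu> i) = (1::real)}"
    by (rule closed_Collect_eq[OF continuous_on_sum[OF continuous_on_coord] continuous_on_const])
  then have "compact M" unfolding M_def
    by (intro compact_Int_closed compact_coordinatewise) auto
  have Mb: "0 \<le> \<nu> i" "\<nu> i \<le> 1" "i < n \<or> \<nu> i = 0" if "\<nu> \<in> M" for \<nu> i
  proof -
    have "\<nu> i \<in> (if i < n then {0..1} else {0})" using that unfolding M_def by blast
    then show "0 \<le> \<nu> i" "\<nu> i \<le> 1" "i < n \<or> \<nu> i = 0" by (auto split: if_splits)
  qed
  have unit: "(\<lambda>i. if i = j then 1 else 0) \<in> M" if "j < n" for j
    using that by (auto simp: M_def)
  have zunit: "z (\<lambda>i. if i = j then 1 else 0) = f j" if "j < n" for j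
    using that by (simp add: z_def if_distrib[of "\<lambda>t. t * _"] cong: if_cong)
  have "n \<noteq> 0"
  proof
    assume "n = 0"
    then have "W = {}" using f by simp
    moreover obtain p where "norm_Rd d p = 1" using orthogonal_direction[of 0 d] d by auto
    ultimately show False using W(3) by blast
  qed
  then have "M \<noteq> {}" using unit[of 0] by auto
  have cont: "continuous_on M (\<lambda>\<mu>. norm_Rd d (\<lambda>i. y i - z \<mu> i))"
  proof -
    have "continuous_on M (\<lambda>\<mu>. (y i - z \<mu> i)\<^sup>2)" for i
      unfolding z_def
      by (rule continuous_on_power[OF continuous_on_diff[OF continuous_on_const
            continuous_on_sum[OF continuous_on_mult[OF continuous_on_coord continuous_on_const]]]])
    then show ?thesis
      unfolding L2_set_def by (rule continuous_on_real_sqrt[OF continuous_on_sum])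
  qed
  obtain \<mu> where \<mu>: "\<mu> \<in> M" "\<And>\<nu>. \<nu> \<in> M \<Longrightarrow> norm_Rd d (\<lambda>i. y i - z \<mu> i) \<le> norm_Rd d (\<lambda>i. y i - z \<nu> i)"
    using continuous_attains_inf[OF \<open>compact M\<close> \<open>M \<noteq> {}\<close> cont] by blast
  have "convex_set (z ` M)" unfolding convex_set_def
  proof (intro ballI allI impI)
    fix x x' and a b :: real
    assume *: "x \<in> z ` M" "x' \<in> z ` M" "0 \<le> a" "0 \<le> b" "a + b = 1"
    then obtain \<nu> \<nu>' where \<nu>: "\<nu> \<in> M" "\<nu>' \<in> M" "x = z \<nu>" "x' = z \<nu>'" by blast
    have "a * \<nu> i + b * \<nu>' i \<le> 1" "0 \<le> a * \<nu> i + b * \<nu>' i" if "i < n" for i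
    proof -
      have b: "0 \<le> \<nu> i" "\<nu> i \<le> 1" "0 \<le> \<nu>' i" "\<nu>' i \<le> 1" using Mb \<nu>(1,2) by auto
      have "a * \<nu> i + b * \<nu>' i \<le> a * 1 + b * 1" using b * by (intro add_mono mult_left_mono) auto
      then show "a * \<nu> i + b * \<nu>' i \<le> 1" "0 \<le> a * \<nu> i + b * \<nu>' i" using b * by auto
    qed
    moreover have "(\<Sum>i<n. a * \<nu> i + b * \<nu>' i) = 1"
      using \<nu>(1,2) *(5) by (simp add: M_def sum.distrib sum_distrib_left[symmetric])
    ultimately have "(\<lambda>i. a * \<nu> i + b * \<nu>' i) \<in> M" using Mb(3)[OF \<nu>(1)] Mb(3)[OF \<nu>(2)]
      by (fastforce simp: M_def)
    moreover have "(\<lambda>i. a * x i + b * x' i) = z (\<lambda>i. a * \<nu> i + b * \<nu>' i)"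
      by (rule ext) (simp add: \<nu>(3,4) z_def sum_distrib_left sum.distrib distrib_right mult.assoc)
    ultimately show "(\<lambda>i. a * x i + b * x' i) \<in> z ` M" by blast
  qed
  have obt: "dot d (\<lambda>i. y i - z \<mu> i) (\<lambda>i. x i - z \<mu> i) \<le> 0" if "x \<in> z ` M" for x
    by (rule nearest_point_obtuse[OF \<open>convex_set (z ` M)\<close> _ _ that]) (use \<mu> in auto)
  define w where "w = (\<lambda>i. y i - z \<mu> i)"
  have "norm_Rd d w = 0"
  proof (rule ccontr)
    assume "norm_Rd d w \<noteq> 0"
    then have w: "norm_Rd d w > 0" using L2_set_nonneg[of w "{..<d}"] by linarith
    define p where "p = (\<lambda>i. (1 / norm_Rd d w) * w i)"
    have p: "norm_Rd d p = 1" unfolding p_def norm_Rd_scale using w by simp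
    obtain u where u: "u \<in> W" "r < dot d p u" using W(3)[OF p] by blast
    then have "u \<in> z ` M" using unit zunit f(1) by (metis (no_types, lifting) imageE imageI lessThan_iff)
    then have "dot d w u \<le> dot d w (z \<mu>)" using obt by (simp add: w_def[symmetric] dot_diff)
    then have "dot d p u \<le> dot d p (z \<mu>)" using w unfolding p_def dot_scale_left by (intro mult_left_mono) auto
    also have "dot d p (z \<mu>) = dot d p y - dot d p w" by (simp add: w_def dot_diff)
    also have "dot d p w = norm_Rd d w" unfolding p_def dot_scale_left dot_self using w by (simp add: power2_eq_square)
    also have "dot d p y - norm_Rd d w \<le> dot d p y" using w by simp
    also have "dot d p y \<le> r" using dot_le[of d p y] p y by simp
    finally show False using u(2) by simp
  qed
  then have yz: "y i = z \<mu> i" if "i < d" for i using that by (auto simp: w_def L2_set_eq_0_iff)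
  show ?thesis
  proof (rule that[OF W(1,2), of "\<lambda>w. \<mu> (the_inv_into {..<n} f w)"])
    show "0 \<le> \<mu> (the_inv_into {..<n} f w)" if "w \<in> W" for w
      using Mb(1)[OF \<mu>(1)] .
    show "(\<Sum>w\<in>W. \<mu> (the_inv_into {..<n} f w)) = 1"
      unfolding f(1) using \<mu>(1) f(2) by (simp add: sum.reindex the_inv_into_f_f M_def)
    show "y i = (\<Sum>w\<in>W. \<mu> (the_inv_into {..<n} f w) * w i)" if "i < d" for i
      unfolding f(1) yz[OF that] using f(2) by (simp add: sum.reindex the_inv_into_f_f z_def)
  qed
qed

text \<open>
  More than \<open>d\<close> vectors are linearly dependent. Subtracting a multiple of the dependence removes one
  of them; with the right sign of the dependence the total weight does not increase. Control of the
  total weight is why the conic form with \<open>d\<close> vectors is used.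
\<close>

lemma conic_Caratheodory:
  fixes \<mu> :: "(nat \<Rightarrow> real) \<Rightarrow> real"
  assumes "finite W" "\<And>w. w \<in> W \<Longrightarrow> 0 \<le> \<mu> w"
  obtains W' \<mu>' where "W' \<subseteq> W" "card W' \<le> d" "\<And>w. w \<in> W' \<Longrightarrow> 0 \<le> \<mu>' w" "(\<Sum>w\<in>W'. \<mu>' w) \<le> (\<Sum>w\<in>W. \<mu> w)"
    "\<And>i. i < d \<Longrightarrow> (\<Sum>w\<in>W'. \<mu>' w * w i) = (\<Sum>w\<in>W. \<mu> w * w i)"
proof -
  have "\<exists>W' \<mu>'. W' \<subseteq> W \<and> card W' \<le> d \<and> (\<forall>w\<in>W'. 0 \<le> \<mu>' w) \<and> (\<Sum>w\<in>W'. \<mu>' w) \<le> (\<Sum>w\<in>W. \<mu> w) \<and>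
    (\<forall>i<d. (\<Sum>w\<in>W'. \<mu>' w * w i) = (\<Sum>w\<in>W. \<mu> w * w i))"
    using assms
  proof (induction "card W" arbitrary: W \<mu>)
    case 0
    then show ?case by (intro exI[of _ W] exI[of _ \<mu>]) auto
  next
    case (Suc m)
    show ?case
    proof (cases "card W \<le> d")
      case True
      then show ?thesis using Suc.prems by (intro exI[of _ W] exI[of _ \<mu>]) auto
    next
      case False
      obtain f and n :: nat where f: "W = f ` {..<n}" "inj_on f {..<n}"
        using finite_imp_nat_seg_image_inj_on[OF Suc.prems(1)] by (metis lessThan_def)
      have "d < n" using False f by (simp add: card_image)
      then obtain q where q: "norm_Rd n q = 1" "\<And>k. k < d \<Longrightarrow> dot n (\<lambda>j. f j k) q = 0"
        using orthogonal_direction[of d n "\<lambda>k j. f j k"] by auto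
      \<comment> \<open>the sign for which the subtraction below does not increase the total weight\<close>
      define s :: real where "s = (if (\<Sum>j<n. q j) \<ge> 0 then 1 else -1)"
      define \<beta> where "\<beta> = (\<lambda>w. s * q (the_inv_into {..<n} f w))"
      have \<beta>f: "\<beta> (f j) = s * q j" if "j < n" for j using f(2) that by (simp add: \<beta>_def the_inv_into_f_f)
      have \<beta>s: "(\<Sum>w\<in>W. \<beta> w) \<ge> 0"
        unfolding f(1) using f(2) by (simp add: sum.reindex \<beta>f sum_distrib_left[symmetric]) (simp add: s_def)
      have \<beta>0: "(\<Sum>w\<in>W. \<beta> w * w i) = 0" if "i < d" for i
      proof -
        have "(\<Sum>w\<in>W. \<beta> w * w i) = s * (\<Sum>j<n. f j i * q j)"
          unfolding f(1) using f(2) by (simp add: sum.reindex \<beta>f sum_distrib_left mult_ac)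
        then show ?thesis using q(2)[OF that] by (simp add: dot_def)
      qed
      have "\<exists>w\<in>W. \<beta> w > 0"
      proof (rule ccontr)
        assume *: "\<not> ?thesis"
        then have "(\<Sum>w\<in>W. - \<beta> w) = 0" using \<beta>s sum_nonneg[of W "\<lambda>w. - \<beta> w"] by (simp add: sum_negf not_less)
        then have "\<forall>w\<in>W. - \<beta> w = 0" using * Suc.prems(1) by (subst (asm) sum_nonneg_eq_0_iff) (auto simp: not_less)
        then have "\<forall>j<n. s * q j = 0" using \<beta>f f(1) by auto
        then have "\<forall>j<n. q j = 0" by (auto simp: s_def split: if_splits)
        then have "norm_Rd n q = 0" by (auto simp: L2_set_def)
        then show False using q(1) by simp
      qed
      define P where "P = {w \<in> W. \<beta> w > 0}"
      have P: "finite P" "P \<noteq> {}" using \<open>\<exists>w\<in>W. \<beta> w > 0\<close> Suc.prems(1) by (auto simp: P_def)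
      define \<tau> where "\<tau> = Min ((\<lambda>w. \<mu> w / \<beta> w) ` P)"
      have "\<tau> \<in> (\<lambda>w. \<mu> w / \<beta> w) ` P" unfolding \<tau>_def using P by (intro Min_in) auto
      then obtain w0 where w0: "w0 \<in> W" "\<beta> w0 > 0" "\<tau> = \<mu> w0 / \<beta> w0" by (auto simp: P_def)
      have \<tau>0: "\<tau> \<ge> 0" using w0 Suc.prems(2)[of w0] by simp
      define \<nu> where "\<nu> = (\<lambda>w. \<mu> w - \<tau> * \<beta> w)"
      have \<nu>0: "\<nu> w \<ge> 0" if "w \<in> W" for w
      proof (cases "\<beta> w > 0")
        case True
        then have "\<tau> \<le> \<mu> w / \<beta> w" unfolding \<tau>_def using P that by (intro Min_le) (auto simp: P_def)
        then show ?thesis using True by (simp add: \<nu>_def field_simps)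
      next
        case False
        then have "\<tau> * \<beta> w \<le> 0" using \<tau>0 by (simp add: mult_nonneg_nonpos)
        then show ?thesis using Suc.prems(2)[OF that] by (simp add: \<nu>_def)
      qed
      have \<nu>w0: "\<nu> w0 = 0" using w0 by (simp add: \<nu>_def)
      have drop: "(\<Sum>w\<in>W - {w0}. \<nu> w * g w) = (\<Sum>w\<in>W. \<nu> w * g w)" for g
        using Suc.prems(1) w0(1) \<nu>w0 by (simp add: sum_diff1)
      have "m = card (W - {w0})" using Suc.hyps(2) w0(1) Suc.prems(1) by simp
      from Suc.hyps(1)[OF this, of \<nu>] obtain W' \<mu>' where W': "W' \<subseteq> W - {w0}" "card W' \<le> d" "\<forall>w\<in>W'. 0 \<le> \<mu>' w"
        "(\<Sum>w\<in>W'. \<mu>' w) \<le> (\<Sum>w\<in>W - {w0}. \<nu> w)" "\<forall>i<d. (\<Sum>w\<in>W'. \<mu>' w * w i) = (\<Sum>w\<in>W - {w0}. \<nu> w * w i)"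
        using Suc.prems(1) \<nu>0 by auto
      have "(\<Sum>w\<in>W - {w0}. \<nu> w) = (\<Sum>w\<in>W. \<mu> w) - \<tau> * (\<Sum>w\<in>W. \<beta> w)"
        using drop[of "\<lambda>_. 1"] by (simp add: \<nu>_def sum_subtractf sum_distrib_left)
      also have "\<dots> \<le> (\<Sum>w\<in>W. \<mu> w)" using \<tau>0 \<beta>s by simp
      finally have 1: "(\<Sum>w\<in>W'. \<mu>' w) \<le> (\<Sum>w\<in>W. \<mu> w)" using W'(4) by simp
      have 2: "(\<Sum>w\<in>W'. \<mu>' w * w i) = (\<Sum>w\<in>W. \<mu> w * w i)" if "i < d" for i
      proof -
        have "(\<Sum>w\<in>W. \<nu> w * w i) = (\<Sum>w\<in>W. \<mu> w * w i) - \<tau> * (\<Sum>w\<in>W. \<beta> w * w i)"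
          by (simp add: \<nu>_def left_diff_distrib sum_subtractf sum_distrib_left mult.assoc)
        then show ?thesis using W'(5) that drop[of "\<lambda>w. w i"] \<beta>0 by simp
      qed
      show ?thesis using W'(1-3) 1 2 by (intro exI[of _ W'] exI[of _ \<mu>']) auto
    qed
  qed
  then show ?thesis using that by blast
qed

section \<open>The quantitative Helly theorem\<close>

text \<open>
  The two estimates come from \<open>outer_normal\<close> without shift and with the shift \<open>s = d + 1\<close>. The shift
  excludes normals that point away from \<open>p\<close>.
\<close>

lemma normals_in_all_directions:
  assumes d: "d \<ge> 1" and G: "\<And>i. i \<in> I \<Longrightarrow> closed_convex d (G i)" "\<And>i. i \<in> I \<Longrightarrow> ellipsoid_in d id_mat (\<lambda>_. 0) (G i)"
    and max: "\<forall>A b. (\<forall>i\<in>I. ellipsoid_in d A b (G i)) \<longrightarrow> \<bar>Det d A\<bar> < 1 + 1 / (4 * (real d)\<^sup>2)"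
    and p: "norm_Rd d p = 1"
  defines "U \<equiv> {u. norm_Rd d u = 1 \<and> (\<exists>i\<in>I. \<forall>z\<in>G i. dot d u z \<le> 3)}"
  shows "\<exists>u\<in>U. 1 / (2 * sqrt (real d)) \<le> \<bar>dot d p u\<bar>" "\<exists>u\<in>U. 1 / (8 * real d) < dot d p u"
proof -
  have d1: "real d \<ge> 1" using d by simp
  show "\<exists>u\<in>U. 1 / (2 * sqrt (real d)) \<le> \<bar>dot d p u\<bar>"
  proof -
    obtain u i where u: "i \<in> I" "norm_Rd d u = 1" "\<And>z. z \<in> G i \<Longrightarrow> dot d u z \<le> 3"
      "(real d + 1) * (dot d p u)\<^sup>2 + 0 * dot d p u > 3 / 4"
      by (rule outer_normal[where d = d and I = I and G = G and p = p and s = 0, OF d G max p]) auto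
    define q where "q = dot d p u"
    have "3 / 4 < (real d + 1) * q\<^sup>2" using u(4) by (simp add: q_def)
    also have "\<dots> \<le> (2 * real d) * q\<^sup>2" using d1 by (intro mult_right_mono) auto
    finally have "1 / (4 * real d) \<le> q\<^sup>2" using d1 by (simp add: field_simps)
    then have "sqrt (1 / (4 * real d)) \<le> \<bar>q\<bar>" using real_sqrt_le_mono by fastforce
    moreover have "sqrt (1 / (4 * real d)) = 1 / (2 * sqrt (real d))" by (simp add: real_sqrt_divide real_sqrt_mult)
    ultimately show ?thesis using u by (auto simp: U_def q_def)
  qed
  show "\<exists>u\<in>U. 1 / (8 * real d) < dot d p u"
  proof -
    obtain u i where u: "i \<in> I" "norm_Rd d u = 1" "\<And>z. z \<in> G i \<Longrightarrow> dot d u z \<le> 3"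
      "(real d + 1) * (dot d p u)\<^sup>2 + (real d + 1) * dot d p u > 3 / 4"
      by (rule outer_normal[where d = d and I = I and G = G and p = p and s = "real d + 1", OF d G max p]) auto
    define q where "q = dot d p u"
    have q: "\<bar>q\<bar> \<le> 1" using dot_le[of d p u] p u(2) by (simp add: q_def)
    have *: "3 / 4 < (real d + 1) * (q * (q + 1))"
      using u(4) by (simp add: q_def power2_eq_square algebra_simps)
    have "q > 0"
    proof (rule ccontr)
      assume "\<not> q > 0"
      then have "q * (q + 1) \<le> 0" using q by (intro mult_nonpos_nonneg) auto
      then have "(real d + 1) * (q * (q + 1)) \<le> 0" by (rule mult_nonneg_nonpos[rotated]) simp
      then show False using * by simp
    qed
    note *
    also have "(real d + 1) * (q * (q + 1)) \<le> (2 * real d) * (q * 2)"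
      using d1 q \<open>q > 0\<close> by (intro mult_mono[of "real d + 1" "2 * real d"] mult_left_mono) auto
    finally have "1 / (8 * real d) < q" using d1 by (simp add: field_simps)
    then show ?thesis using u by (auto simp: U_def q_def)
  qed
qed

text \<open>
  Let \<open>u 0, \<dots>, u (d - 1)\<close> be a frame of normals. The vector \<open>y = - (\<kappa> / d) \<Sum> u k\<close> has length at most
  \<open>\<kappa> = 1 / (8 d)\<close>, so it is a convex combination of normals, and by \<open>conic_Caratheodory\<close> a combination
  of at most \<open>d\<close> of them with total weight at most \<open>1\<close>. Adding the inequalities
  \<open>\<bar>A\<^sup>T u\<bar> + \<langle>u, b\<rangle> \<le> 3\<close> with these weights makes \<open>b\<close> disappear.
\<close>

lemma Det_bound_from_2d_normals:
  assumes d: "d \<ge> 1" and G: "\<And>i. i \<in> I \<Longrightarrow> closed_convex d (G i)" "\<And>i. i \<in> I \<Longrightarrow> ellipsoid_in d id_mat (\<lambda>_. 0) (G i)"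
    and max: "\<forall>A b. (\<forall>i\<in>I. ellipsoid_in d A b (G i)) \<longrightarrow> \<bar>Det d A\<bar> < 1 + 1 / (4 * (real d)\<^sup>2)"
    and sub: "\<And>J. J \<subseteq> I \<Longrightarrow> card J \<le> 2 * d \<Longrightarrow> finite J \<Longrightarrow> \<exists>A b. v \<le> \<bar>Det d A\<bar> \<and> (\<forall>j\<in>J. ellipsoid_in d A b (G j))"
  shows "v \<le> (54 * (real d)\<^sup>2 * sqrt (real d)) ^ d"
proof -
  define U where "U = {u. norm_Rd d u = 1 \<and> (\<exists>i\<in>I. \<forall>z\<in>G i. dot d u z \<le> 3)}"
  have dirs: "\<exists>u\<in>U. 1 / (2 * sqrt (real d)) \<le> \<bar>dot d p u\<bar>" "\<exists>u\<in>U. 1 / (8 * real d) < dot d p u"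
    if "norm_Rd d p = 1" for p
    unfolding U_def
    by (rule normals_in_all_directions[where d = d and I = I and G = G and p = p, OF d G max that], assumption+)+
  have d1: "real d \<ge> 1" using d by simp
  define r where "r = 1 / (2 * sqrt (real d))"
  define \<kappa> where "\<kappa> = 1 / (8 * real d)"
  have pos: "r > 0" "\<kappa> > 0" using d1 by (auto simp: r_def \<kappa>_def)
  have "\<forall>u\<in>U. \<exists>i. i \<in> I \<and> (\<forall>z\<in>G i. dot d u z \<le> 3)" by (simp add: U_def Bex_def)
  from bchoice[OF this] obtain \<iota> where \<iota>: "\<And>u. u \<in> U \<Longrightarrow> \<iota> u \<in> I"
    "\<And>u z. u \<in> U \<Longrightarrow> z \<in> G (\<iota> u) \<Longrightarrow> dot d u z \<le> 3" by blast
  obtain u where u: "\<And>k. k < d \<Longrightarrow> u k \<in> U" "r ^ d \<le> \<bar>Det d u\<bar>"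
  proof (rule greedy_frame[where d = d and U = U and r = r])
    show "\<exists>u\<in>U. r \<le> \<bar>dot d p u\<bar>" if "norm_Rd d p = 1" for p using dirs(1)[OF that] by (simp add: r_def)
  qed (use pos in auto)
  define y where "y = (\<lambda>i. \<Sum>k<d. (- (\<kappa> / d)) * u k i)"
  have "norm_Rd d y \<le> \<kappa>"
  proof -
    have "(norm_Rd d y)\<^sup>2 = dot d y y" by (simp add: dot_self)
    also have "\<dots> = (\<Sum>k<d. (- (\<kappa> / d)) * dot d (u k) y)" by (subst (1) y_def) (rule dot_sum_left)
    also have "\<dots> \<le> (\<Sum>k<d. (\<kappa> / d) * norm_Rd d y)"
    proof (rule sum_mono)
      fix k assume "k \<in> {..<d}"
      then have "\<bar>dot d (u k) y\<bar> \<le> norm_Rd d y" using dot_le[of d "u k" y] u(1)[of k] by (simp add: U_def)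
      then have "(\<kappa> / d) * (- dot d (u k) y) \<le> (\<kappa> / d) * norm_Rd d y" using pos by (intro mult_left_mono) auto
      then show "(- (\<kappa> / d)) * dot d (u k) y \<le> (\<kappa> / d) * norm_Rd d y" by simp
    qed
    also have "\<dots> = \<kappa> * norm_Rd d y" using d1 by simp
    finally have "norm_Rd d y * norm_Rd d y \<le> \<kappa> * norm_Rd d y" by (simp add: power2_eq_square)
    then show ?thesis using pos(2) L2_set_nonneg[of y "{..<d}"]
      by (cases "norm_Rd d y = 0") (auto simp: mult_le_cancel_right)
  qed
  obtain W0 \<mu>0 where W0: "finite W0" "W0 \<subseteq> U" "\<And>w. w \<in> W0 \<Longrightarrow> 0 \<le> \<mu>0 w" "(\<Sum>w\<in>W0. \<mu>0 w) = 1"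
    "\<And>i. i < d \<Longrightarrow> y i = (\<Sum>w\<in>W0. \<mu>0 w * w i)"
  proof (rule ball_in_hull[of d U \<kappa> y])
    show "\<exists>u\<in>U. \<kappa> < dot d p u" if "norm_Rd d p = 1" for p using dirs(2)[OF that] by (simp add: \<kappa>_def)
  qed (use \<open>norm_Rd d y \<le> \<kappa>\<close> d in auto)
  obtain W \<mu> where W: "W \<subseteq> W0" "card W \<le> d" "\<And>w. w \<in> W \<Longrightarrow> 0 \<le> \<mu> w" "(\<Sum>w\<in>W. \<mu> w) \<le> (\<Sum>w\<in>W0. \<mu>0 w)"
    "\<And>i. i < d \<Longrightarrow> (\<Sum>w\<in>W. \<mu> w * w i) = (\<Sum>w\<in>W0. \<mu>0 w * w i)"
    by (rule conic_Caratheodory[where W = W0 and \<mu> = \<mu>0 and d = d, OF W0(1,3)]) blast+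
  have finW: "finite W" "W \<subseteq> U" using W W0 finite_subset by auto
  define J where "J = \<iota> ` (u ` {..<d} \<union> W)"
  have "card J \<le> card (u ` {..<d} \<union> W)" unfolding J_def using finW by (intro card_image_le) auto
  also have "\<dots> \<le> card (u ` {..<d}) + card W" by (rule card_Un_le)
  also have "\<dots> \<le> 2 * d" using card_image_le[of "{..<d}" u] W(2) by simp
  finally have "card J \<le> 2 * d" .
  moreover have "J \<subseteq> I" "finite J" using u(1) finW \<iota>(1) by (auto simp: J_def)
  ultimately obtain A b where A: "v \<le> \<bar>Det d A\<bar>" "\<And>j. j \<in> J \<Longrightarrow> ellipsoid_in d A b (G j)" using sub by metis
  have S: "norm_Rd d (app_mat d (transposed A) w) + dot d w b \<le> 3" if "w \<in> u ` {..<d} \<union> W" for w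
  proof (rule ellipsoid_in_support)
    show "ellipsoid_in d A b (G (\<iota> w))" using that A(2) by (auto simp: J_def)
    have "w \<in> U" using that u(1) finW by auto
    then show "dot d w z \<le> 3" if "z \<in> G (\<iota> w)" for z by (rule \<iota>(2)[OF _ that])
  qed
  have zero: "(\<Sum>k<d. (\<kappa> / d) * dot d (u k) b) + (\<Sum>w\<in>W. \<mu> w * dot d w b) = 0"
  proof -
    have "dot d y b = (\<Sum>k<d. (- (\<kappa> / d)) * dot d (u k) b)" unfolding y_def by (rule dot_sum_left)
    also have "\<dots> = - (\<Sum>k<d. (\<kappa> / d) * dot d (u k) b)" by (simp add: sum_negf)
    finally have 1: "dot d y b = - (\<Sum>k<d. (\<kappa> / d) * dot d (u k) b)" .
    have "dot d y b = dot d (\<lambda>i. \<Sum>w\<in>W. \<mu> w * w i) b" by (rule dot_cong) (simp_all add: W(5) W0(5))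
    also have "\<dots> = (\<Sum>w\<in>W. \<mu> w * dot d w b)" by (rule dot_sum_left)
    finally show ?thesis using 1 by simp
  qed
  have len: "norm_Rd d (app_mat d (transposed A) (u k)) \<le> 27 * (real d)\<^sup>2" if k: "k < d" for k
  proof -
    have "(\<kappa> / d) * norm_Rd d (app_mat d (transposed A) (u k)) \<le> (\<Sum>k<d. (\<kappa> / d) * norm_Rd d (app_mat d (transposed A) (u k)))"
      using k pos by (intro member_le_sum) auto
    also have "\<dots> \<le> (\<Sum>k<d. (\<kappa> / d) * (3 - dot d (u k) b))"
    proof (rule sum_mono, rule mult_left_mono)
      fix k assume "k \<in> {..<d}"
      then show "norm_Rd d (app_mat d (transposed A) (u k)) \<le> 3 - dot d (u k) b" using S[of "u k"] by simp
    qed (use pos in auto)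
    also have "\<dots> = 3 * \<kappa> - (\<Sum>k<d. (\<kappa> / d) * dot d (u k) b)"
      using d1 by (simp add: right_diff_distrib sum_subtractf)
    finally have 1: "(\<kappa> / d) * norm_Rd d (app_mat d (transposed A) (u k)) \<le> 3 * \<kappa> - (\<Sum>k<d. (\<kappa> / d) * dot d (u k) b)" .
    have "0 \<le> (\<Sum>w\<in>W. \<mu> w * (3 - dot d w b))"
    proof (rule sum_nonneg, rule mult_nonneg_nonneg)
      fix w assume w: "w \<in> W"
      show "0 \<le> \<mu> w" using W(3)[OF w] .
      show "0 \<le> 3 - dot d w b" using S[OF UnI2[OF w]] L2_set_nonneg[of "app_mat d (transposed A) w" "{..<d}"] by linarith
    qed
    also have "\<dots> = 3 * (\<Sum>w\<in>W. \<mu> w) - (\<Sum>w\<in>W. \<mu> w * dot d w b)"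
      by (simp add: right_diff_distrib sum_subtractf sum_distrib_right[symmetric])
    also have "\<dots> \<le> 3 - (\<Sum>w\<in>W. \<mu> w * dot d w b)" using W(4) W0(4) by simp
    finally have "(\<kappa> / d) * norm_Rd d (app_mat d (transposed A) (u k)) \<le> 3 * \<kappa> + 3" using 1 zero by linarith
    moreover have "\<kappa> / d = 1 / (8 * (real d)\<^sup>2)" by (simp add: \<kappa>_def power2_eq_square)
    ultimately have "norm_Rd d (app_mat d (transposed A) (u k)) \<le> (3 * \<kappa> + 3) * (8 * (real d)\<^sup>2)"
      using d1 by (simp add: field_simps)
    also have "\<dots> \<le> (3 * (1 / 8) + 3) * (8 * (real d)\<^sup>2)"
      using d1 by (intro mult_right_mono) (auto simp: \<kappa>_def field_simps)
    finally show ?thesis by simp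
  qed
  have "v * r ^ d \<le> \<bar>Det d A\<bar> * \<bar>Det d u\<bar>"
    using A(1) u(2) pos by (intro mult_mono) auto
  also have "\<dots> = \<bar>Det d (mat_prod d u A)\<bar>" by (simp add: Det_mat_prod abs_mult)
  also have "\<dots> \<le> (\<Prod>k<d. norm_Rd d (mat_prod d u A k))" by (rule Hadamard)
  also have "\<dots> = (\<Prod>k<d. norm_Rd d (app_mat d (transposed A) (u k)))" by (simp add: mat_prod_def app_mat_def transposed_def mult.commute)
  also have "\<dots> \<le> (\<Prod>k<d. 27 * (real d)\<^sup>2)" using len by (intro prod_mono) auto
  finally have "v * r ^ d \<le> (27 * (real d)\<^sup>2) ^ d" by simp
  then have "v \<le> (27 * (real d)\<^sup>2) ^ d / r ^ d" using pos by (simp add: field_simps)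
  also have "\<dots> = (54 * (real d)\<^sup>2 * sqrt (real d)) ^ d"
    unfolding power_divide[symmetric] using d1 by (intro arg_cong[where f = "\<lambda>t. t ^ d"]) (simp add: r_def)
  finally show ?thesis .
qed

lemma ball_in_ellipsoid:
  assumes "Det d A \<noteq> 0"
  obtains r where "r > 0" "\<And>x. norm_Rd d x \<le> r \<Longrightarrow> \<exists>y. norm_Rd d y \<le> 1 \<and> (\<forall>i<d. app_mat d A y i = x i)"
proof -
  obtain C where C: "\<And>x i. i < d \<Longrightarrow> app_mat d A (app_mat d C x) i = x i"
    using Det_inverse[OF assms] by metis
  define c where "c = (\<Sum>i<d. norm_Rd d (C i))"
  have c: "c \<ge> 0" by (auto simp: c_def intro!: sum_nonneg)
  have Cn: "norm_Rd d (app_mat d C x) \<le> c * norm_Rd d x" for x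
  proof -
    have "norm_Rd d (app_mat d C x) \<le> (\<Sum>i<d. \<bar>app_mat d C x i\<bar>)" by (rule L2_set_le_sum_abs)
    also have "\<dots> \<le> (\<Sum>i<d. norm_Rd d (C i) * norm_Rd d x)" by (intro sum_mono) (simp add: app_mat_row dot_le)
    finally show ?thesis by (simp add: c_def sum_distrib_right)
  qed
  show ?thesis
  proof (rule that[of "1 / (c + 1)"])
    show "1 / (c + 1) > 0" using c by simp
    fix x assume x: "norm_Rd d x \<le> 1 / (c + 1)"
    have "norm_Rd d (app_mat d C x) \<le> c * (1 / (c + 1))"
      using Cn[of x] mult_left_mono[OF x c] by linarith
    also have "\<dots> \<le> 1" using c by simp
    finally show "\<exists>y. norm_Rd d y \<le> 1 \<and> (\<forall>i<d. app_mat d A y i = x i)" using C by blast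
  qed
qed

lemma ellipsoid_in_ball:
  assumes "Det d A \<noteq> 0"
  obtains r where "r > 0" "\<And>s b K. 0 \<le> s \<Longrightarrow> s \<le> r \<Longrightarrow> cylindrical d K \<Longrightarrow> ellipsoid_in d A b K \<Longrightarrow> ellipsoid_in d (\<lambda>i j. s * id_mat i j) b K"
proof -
  obtain r where r: "r > 0" "\<And>x. norm_Rd d x \<le> r \<Longrightarrow> \<exists>y. norm_Rd d y \<le> 1 \<and> (\<forall>i<d. app_mat d A y i = x i)"
    by (rule ball_in_ellipsoid[OF assms]) blast
  show ?thesis
  proof (rule that[OF r(1)])
    fix s b K assume s: "0 \<le> s" "s \<le> r" and K: "cylindrical d K" "ellipsoid_in d A b K"
    show "ellipsoid_in d (\<lambda>i j. s * id_mat i j) b K" unfolding ellipsoid_in_def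
    proof (intro allI impI)
      fix x assume x: "norm_Rd d x \<le> 1"
      have "norm_Rd d (\<lambda>i. s * x i) = s * norm_Rd d x" using s by (simp add: norm_Rd_scale)
      also have "\<dots> \<le> r * 1" using s x by (intro mult_mono) auto
      finally obtain y where y: "norm_Rd d y \<le> 1" "\<forall>i<d. app_mat d A y i = s * x i" using r(2)[of "\<lambda>i. s * x i"] by auto
      show "(\<lambda>i. app_mat d (\<lambda>i j. s * id_mat i j) x i + b i) \<in> K"
        by (rule cylindricalD[OF K(1) ellipsoid_inD[OF K(2) y(1)]]) (simp add: y(2) app_mat_id_mat)
    qed
  qed
qed

text \<open>
  Nondegenerate ellipsoids contain balls, and only finitely many subsets \<open>J\<close> are involved, so one
  radius serves all of them. The theorem of Helly for the sets of admissible centres of balls with this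
  radius is the case of equal families in the colourful theorem. The purpose is to know that the
  intersection of all sets contains some nondegenerate ellipsoid.
\<close>

lemma common_ball:
  assumes d: "d \<ge> 1" and I: "finite I" and G: "\<And>i. i \<in> I \<Longrightarrow> closed_convex d (G i)"
    and sub: "\<And>J. J \<subseteq> I \<Longrightarrow> card J \<le> d + 1 \<Longrightarrow> \<exists>A b. Det d A \<noteq> 0 \<and> (\<forall>j\<in>J. ellipsoid_in d A b (G j))"
  shows "\<exists>r b. r > 0 \<and> (\<forall>i\<in>I. ellipsoid_in d (\<lambda>i j. r * id_mat i j) b (G i))"
proof -
  define \<J> where "\<J> = {J. J \<subseteq> I \<and> card J \<le> d + 1}"
  have fin: "finite \<J>" "\<J> \<noteq> {}" using I by (auto simp: \<J>_def intro: exI[of _ "{}"])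
  have "\<exists>r>0. \<exists>b. \<forall>s. 0 \<le> s \<longrightarrow> s \<le> r \<longrightarrow> (\<forall>j\<in>J. ellipsoid_in d (\<lambda>i j. s * id_mat i j) b (G j))" if J: "J \<in> \<J>" for J
  proof -
    obtain A b where A: "Det d A \<noteq> 0" "\<forall>j\<in>J. ellipsoid_in d A b (G j)" using sub J unfolding \<J>_def by blast
    obtain r where r: "r > 0" "\<And>s b K. 0 \<le> s \<Longrightarrow> s \<le> r \<Longrightarrow> cylindrical d K \<Longrightarrow> ellipsoid_in d A b K \<Longrightarrow> ellipsoid_in d (\<lambda>i j. s * id_mat i j) b K"
      using ellipsoid_in_ball[OF A(1)] by metis
    have "\<forall>j\<in>J. cylindrical d (G j)" using G J by (auto simp: \<J>_def closed_convex_def)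
    then show ?thesis using r A(2) by blast
  qed
  then obtain r where r: "\<And>J. J \<in> \<J> \<Longrightarrow> r J > 0"
      "\<And>J s. J \<in> \<J> \<Longrightarrow> 0 \<le> s \<Longrightarrow> s \<le> r J \<Longrightarrow> \<exists>b. \<forall>j\<in>J. ellipsoid_in d (\<lambda>i j. s * id_mat i j) b (G j)"
    by metis
  define s where "s = Min (r ` \<J>)"
  have s: "s > 0" unfolding s_def using fin r(1) by (subst Min_gr_iff) auto
  have sJ: "\<exists>b. \<forall>j\<in>J. ellipsoid_in d (\<lambda>i j. s * id_mat i j) b (G j)" if "J \<in> \<J>" for J
  proof -
    have "s \<le> r J" unfolding s_def using fin that by (intro Min_le) auto
    then show ?thesis using r(2)[OF that, of s] s by simp
  qed
  define \<F> where "\<F> = (\<lambda>_::nat. (\<lambda>j. {b. ellipsoid_in d (\<lambda>i j. s * id_mat i j) b (G j)}) ` I)"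
  obtain i b where b: "i \<le> d" "\<And>S. S \<in> \<F> i \<Longrightarrow> b \<in> S"
  proof (rule colourful_Helly[of d \<F>])
    show "finite (\<F> i)" for i using I by (simp add: \<F>_def)
    show "closed_convex d S" if "S \<in> \<F> i" for i S using that closed_convex_erosion G by (auto simp: \<F>_def)
    fix K assume K: "\<And>i. i \<le> d \<Longrightarrow> K i \<in> \<F> i"
    then have "\<forall>i. \<exists>j. i \<le> d \<longrightarrow> j \<in> I \<and> K i = {b. ellipsoid_in d (\<lambda>i j. s * id_mat i j) b (G j)}"
      by (auto simp: \<F>_def)
    then obtain f where f: "\<And>i. i \<le> d \<Longrightarrow> f i \<in> I \<and> K i = {b. ellipsoid_in d (\<lambda>i j. s * id_mat i j) b (G (f i))}" by metis
    have "card (f ` {..d}) \<le> d + 1" using card_image_le[of "{..d}" f] by simp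
    then have "f ` {..d} \<in> \<J>" using f by (auto simp: \<J>_def)
    from sJ[OF this] show "\<exists>x. \<forall>i\<le>d. x \<in> K i" using f by auto
  qed blast
  have "ellipsoid_in d (\<lambda>i j. s * id_mat i j) b (G i)" if "i \<in> I" for i using b(2) that by (auto simp: \<F>_def)
  then show ?thesis using s by blast
qed

lemma dot_unit_vector: "i < d \<Longrightarrow> dot d (\<lambda>j. c * id_mat i j) z = c * z i"
  by (simp add: dot_def id_mat_def if_distrib if_distribR cong: if_cong)

lemma app_mat_transposed_unit_vector: "i < d \<Longrightarrow> app_mat d (transposed A) (\<lambda>j. c * id_mat i j) = (\<lambda>j. c * A i j)"
  by (rule ext) (simp add: app_mat_def transposed_def id_mat_def if_distrib if_distribR cong: if_cong)

text \<open>
  The ellipsoid has half-width \<open>\<bar>A i\<bar>\<close> in coordinate direction \<open>i\<close>.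
\<close>

lemma row_le_box:
  assumes "ellipsoid_in d A b K" "\<And>z i. z \<in> K \<Longrightarrow> i < d \<Longrightarrow> \<bar>z i\<bar> \<le> R" "i < d"
  shows "norm_Rd d (A i) \<le> R"
proof -
  have "norm_Rd d (app_mat d (transposed A) (\<lambda>j. c * id_mat i j)) + dot d (\<lambda>j. c * id_mat i j) b \<le> R" if "\<bar>c\<bar> = 1" for c
  proof (rule ellipsoid_in_support[OF assms(1)])
    fix z assume "z \<in> K"
    then have "\<bar>z i\<bar> \<le> R" using assms(2,3) by blast
    moreover have "c * z i \<le> \<bar>c\<bar> * \<bar>z i\<bar>" by (metis abs_ge_self abs_mult)
    ultimately show "dot d (\<lambda>j. c * id_mat i j) z \<le> R" using that assms(3)
      by (simp only: dot_unit_vector)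
  qed
  from this[of 1] this[of "-1"] show ?thesis
    using assms(3) norm_Rd_scale[where d = d and a = "-1" and x = "A i"]
    by (simp only: app_mat_transposed_unit_vector dot_unit_vector) simp
qed

lemma Det_le_box:
  assumes "ellipsoid_in d A b K" "\<And>z i. z \<in> K \<Longrightarrow> i < d \<Longrightarrow> \<bar>z i\<bar> \<le> R"
  shows "\<bar>Det d A\<bar> \<le> R ^ d"
proof -
  have "\<bar>Det d A\<bar> \<le> (\<Prod>k<d. norm_Rd d (A k))" by (rule Hadamard)
  also have "\<dots> \<le> (\<Prod>k<d. R)"
  proof (rule prod_mono, rule conjI)
    fix k assume "k \<in> {..<d}"
    then have "k < d" by simp
    show "norm_Rd d (A k) \<le> R" by (rule row_le_box[OF assms(1) _ \<open>k < d\<close>]) (rule assms(2))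
  qed simp
  finally show ?thesis by simp
qed

text \<open>
  Let \<open>T B + b\<^sub>1\<close> be an ellipsoid in the intersection whose determinant is almost the supremum. In the
  coordinates in which it is the unit ball, \<open>Det_bound_from_2d_normals\<close> shows that the ellipsoids in
  \<open>2d\<close> of the sets cannot be much larger.
\<close>

lemma quantitative_Helly:
  assumes d: "d \<ge> 1" and I: "finite I" and G: "\<And>i. i \<in> I \<Longrightarrow> closed_convex d (G i)"
    and box: "\<And>z i. z \<in> (\<Inter>j\<in>I. G j) \<Longrightarrow> i < d \<Longrightarrow> \<bar>z i\<bar> \<le> R"
    and v: "v > 0" and sub: "\<And>J. J \<subseteq> I \<Longrightarrow> card J \<le> 2 * d \<Longrightarrow> \<exists>A b. v \<le> \<bar>Det d A\<bar> \<and> (\<forall>j\<in>J. ellipsoid_in d A b (G j))"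
  obtains A b where "v / (54 * (real d)\<^sup>2 * sqrt (real d)) ^ d \<le> \<bar>Det d A\<bar>" "\<And>j. j \<in> I \<Longrightarrow> ellipsoid_in d A b (G j)"
proof -
  let ?M = "(54 * (real d)\<^sup>2 * sqrt (real d)) ^ d"
  have M: "?M > 0" using d by simp
  have ellI: "ellipsoid_in d A b (\<Inter>j\<in>I. G j) \<longleftrightarrow> (\<forall>j\<in>I. ellipsoid_in d A b (G j))" for A b
    by (auto simp: ellipsoid_in_def)
  have "\<exists>r b. r > 0 \<and> (\<forall>i\<in>I. ellipsoid_in d (\<lambda>i j. r * id_mat i j) b (G i))"
  proof (rule common_ball[OF d I G])
    fix J assume J: "J \<subseteq> I" "card J \<le> d + 1"
    then have "card J \<le> 2 * d" using d by simp
    from sub[OF J(1) this] show "\<exists>A b. Det d A \<noteq> 0 \<and> (\<forall>j\<in>J. ellipsoid_in d A b (G j))" using v by force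
  qed
  then obtain r b0 where r: "r > 0" "\<And>i. i \<in> I \<Longrightarrow> ellipsoid_in d (\<lambda>i j. r * id_mat i j) b0 (G i)" by blast
  define V where "V = {\<bar>Det d A\<bar> | A b. \<forall>j\<in>I. ellipsoid_in d A b (G j)}"
  have bdd: "bdd_above V"
  proof (rule bdd_aboveI[of _ "R ^ d"])
    fix t assume "t \<in> V"
    then obtain A b where "t = \<bar>Det d A\<bar>" "ellipsoid_in d A b (\<Inter>j\<in>I. G j)" unfolding V_def using ellI by blast
    have "\<bar>Det d A\<bar> \<le> R ^ d" by (rule Det_le_box[OF \<open>ellipsoid_in d A b _\<close>]) (rule box)
    then show "t \<le> R ^ d" using \<open>t = _\<close> by simp
  qed
  define S where "S = Sup V"
  have "\<bar>Det d (\<lambda>i j. r * id_mat i j)\<bar> \<in> V" unfolding V_def using r(2) by blast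
  moreover have "\<bar>Det d (\<lambda>i j. r * id_mat i j)\<bar> = r ^ d" using r(1) by (simp add: Det_scale)
  ultimately have "r ^ d \<in> V" by simp
  then have "r ^ d \<le> S" unfolding S_def using bdd by (rule cSup_upper)
  then have S: "S > 0" using r(1) by (meson less_le_trans zero_less_power)
  define \<theta> where "\<theta> = 1 / (4 * (real d)\<^sup>2)"
  have \<theta>: "\<theta> > 0" using d by (simp add: \<theta>_def)
  have "S / (1 + \<theta>) < S" using S \<theta> by (simp add: field_simps)
  then obtain t where t: "t \<in> V" "S / (1 + \<theta>) < t"
    using less_cSupE[of "S / (1 + \<theta>)" V] \<open>r ^ d \<in> V\<close> unfolding S_def by blast
  then obtain T b1 where T: "t = \<bar>Det d T\<bar>" "\<And>j. j \<in> I \<Longrightarrow> ellipsoid_in d T b1 (G j)" by (auto simp: V_def)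
  have "0 < S / (1 + \<theta>)" using S \<theta> by simp
  then have "t > 0" using t(2) by linarith
  then have T0: "Det d T \<noteq> 0" using T(1) by auto
  obtain C where C: "\<And>x i. i < d \<Longrightarrow> app_mat d T (app_mat d C x) i = x i" "Det d C = 1 / Det d T"
    using Det_inverse[OF T0] by metis
  define G' where "G' = (\<lambda>j. {x. (\<lambda>i. app_mat d T x i + b1 i) \<in> G j})"
  have "v / \<bar>Det d T\<bar> \<le> ?M"
  proof (rule Det_bound_from_2d_normals[OF d, of I G'])
    show "closed_convex d (G' i)" if "i \<in> I" for i unfolding G'_def using closed_convex_preimage[OF G[OF that]] .
    show "ellipsoid_in d id_mat (\<lambda>_. 0) (G' i)" if "i \<in> I" for i unfolding ellipsoid_in_def
    proof (intro allI impI)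
      fix x assume x: "norm_Rd d x \<le> 1"
      have "app_mat d T (\<lambda>i. app_mat d id_mat x i + 0) = app_mat d T x" by (rule app_mat_cong) (simp add: app_mat_idm')
      then show "(\<lambda>i. app_mat d id_mat x i + 0) \<in> G' i" using ellipsoid_inD[OF T(2)[OF that] x] by (simp add: G'_def)
    qed
    show "\<forall>A b. (\<forall>i\<in>I. ellipsoid_in d A b (G' i)) \<longrightarrow> \<bar>Det d A\<bar> < 1 + 1 / (4 * (real d)\<^sup>2)"
    proof (intro allI impI, rule ccontr)
      fix A b assume *: "\<forall>i\<in>I. ellipsoid_in d A b (G' i)" and "\<not> \<bar>Det d A\<bar> < 1 + 1 / (4 * (real d)\<^sup>2)"
      then have "(1 + \<theta>) * t \<le> \<bar>Det d A\<bar> * t" using \<open>t > 0\<close> by (intro mult_right_mono) (auto simp: \<theta>_def)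
      also have "\<dots> = \<bar>Det d (mat_prod d T A)\<bar>" by (simp add: Det_mat_prod abs_mult T(1))
      also have "\<dots> \<le> S" unfolding S_def
      proof (rule cSup_upper[OF _ bdd])
        have "\<forall>j\<in>I. ellipsoid_in d (mat_prod d T A) (\<lambda>i. app_mat d T b i + b1 i) (G j)"
          using * by (simp add: G'_def ellipsoid_in_preimage)
        then show "\<bar>Det d (mat_prod d T A)\<bar> \<in> V" unfolding V_def by blast
      qed
      finally show False using t(2) \<theta> by (simp add: field_simps)
    qed
    fix J assume J: "J \<subseteq> I" "card J \<le> 2 * d"
    obtain A b where A: "v \<le> \<bar>Det d A\<bar>" "\<forall>j\<in>J. ellipsoid_in d A b (G j)" using sub[OF J] by blast
    have "ellipsoid_in d (mat_prod d C A) (app_mat d C (\<lambda>i. b i - b1 i)) (G' j)" if "j \<in> J" for j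
      unfolding G'_def using A(2) that G J by (intro ellipsoid_in_pullback[OF C(1)]) (auto simp: closed_convex_def)
    moreover have "v / \<bar>Det d T\<bar> \<le> \<bar>Det d (mat_prod d C A)\<bar>"
      using A(1) by (simp add: Det_mat_prod C(2) abs_mult divide_right_mono)
    ultimately show "\<exists>A b. v / \<bar>Det d T\<bar> \<le> \<bar>Det d A\<bar> \<and> (\<forall>j\<in>J. ellipsoid_in d A b (G' j))" by blast
  qed
  then have "v / ?M \<le> \<bar>Det d T\<bar>" using M T0 by (simp add: field_simps)
  then show ?thesis using that T(2) by blast
qed

section \<open>Balls inside ellipsoids of large volume\<close>

text \<open>
  Choose orthonormal bases, the first one starting with \<open>u\<close>, in which \<open>A\<close> becomes lower triangular
  with diagonal \<open>L\<^sub>k \<ge> 0\<close>. The average of the ball and of the ellipsoid is an ellipsoid in \<open>M\<close>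
  with determinant \<open>\<Prod> (1 + L\<^sub>k) / 2\<close>, so \<open>\<Prod> (1 + L\<^sub>k) < 4\<^sup>d\<close>. Since \<open>\<bar>det A\<bar>\<close> is the product of
  the \<open>L\<^sub>k\<close>, the first factor, which is at most \<open>\<bar>A\<^sup>T u\<bar>\<close>, cannot be smaller than \<open>\<bar>det A\<bar> / 4\<^sup>d\<close>.
\<close>

lemma width_of_inner_ellipsoid:
  assumes M: "convex_set M" "cylindrical d M" "ellipsoid_in d id_mat (\<lambda>_. 0) M" "ellipsoid_in d A b M"
    and max: "\<forall>A b. ellipsoid_in d A b M \<longrightarrow> \<bar>Det d A\<bar> < 2 ^ d" and u: "norm_Rd d u = 1" and d: "d \<ge> 1"
  shows "\<bar>Det d A\<bar> / 4 ^ d \<le> norm_Rd d (app_mat d (transposed A) u)"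
proof -
  obtain R where R: "orthonormal d R" "R 0 = u" using orthonormal_first_row[OF u] by blast
  define N where "N = mat_prod d R A"
  obtain Q where Q: "orthonormal d Q" "\<And>j k. j < k \<Longrightarrow> k < d \<Longrightarrow> dot d (N j) (Q k) = 0"
    "\<And>k. k < d \<Longrightarrow> 0 \<le> dot d (N k) (Q k)" using QR[where d = d and A = N] by blast
  define L where "L = mat_prod d N (transposed Q)"
  have L: "L i j = dot d (N i) (Q j)" for i j by (simp add: L_def mat_prod_def transposed_def dot_def)
  \<comment> \<open>\<open>B = (1 + A Q\<^sup>T R) / 2\<close>, written in the basis \<open>R\<close>, where it is triangular\<close>
  define E where "E = (\<lambda>i j. (1 / 2) * (id_mat i j + L i j))"
  define B where "B = mat_prod d (transposed R) (mat_prod d E R)"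
  have B: "app_mat d B x i = (1 / 2) * x i + (1 / 2) * app_mat d A (app_mat d (transposed Q) (app_mat d R x)) i" if i: "i < d" for x i
  proof -
    define w where "w = app_mat d R x"
    define z where "z = app_mat d A (app_mat d (transposed Q) w)"
    have "app_mat d E w k = (1 / 2) * app_mat d id_mat w k + (1 / 2) * app_mat d L w k" for k
      by (simp add: app_mat_def E_def distrib_left distrib_right sum.distrib sum_distrib_left mult.assoc add_divide_distrib sum_divide_distrib)
    moreover have "app_mat d L w = app_mat d R z" by (simp only: L_def N_def app_mat_mat_prod z_def)
    ultimately have "app_mat d E w = (\<lambda>k. (1 / 2) * app_mat d id_mat w k + (1 / 2) * app_mat d R z k)" by (intro ext) simp
    then have "app_mat d B x = (\<lambda>k. (1 / 2) * app_mat d (transposed R) (app_mat d id_mat w) k + (1 / 2) * app_mat d (transposed R) (app_mat d R z) k)"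
      by (simp only: B_def app_mat_mat_prod w_def[symmetric] app_mat_lin)
    moreover have "app_mat d (transposed R) (app_mat d id_mat w) i = x i"
    proof -
      have "app_mat d (transposed R) (app_mat d id_mat w) = app_mat d (transposed R) w" by (rule app_mat_cong) (simp add: app_mat_idm')
      then show ?thesis using orthonormal_app_mat_tr2[OF R(1) i, of x] by (simp add: w_def)
    qed
    ultimately show ?thesis using orthonormal_app_mat_tr2[OF R(1) i, of z] by (simp add: z_def w_def)
  qed
  have "ellipsoid_in d B (\<lambda>i. (1 / 2) * b i) M" unfolding ellipsoid_in_def
  proof (intro allI impI)
    fix x assume x: "norm_Rd d x \<le> 1"
    have n: "norm_Rd d (app_mat d (transposed Q) (app_mat d R x)) \<le> 1" using x by (simp add: orthonormal_norm_Rd[OF R(1)] orthonormal_norm_Rd_transposed[OF Q(1)])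
    have "(\<lambda>i. (1 / 2) * (app_mat d id_mat x i + 0) + (1 / 2) * (app_mat d A (app_mat d (transposed Q) (app_mat d R x)) i + b i)) \<in> M"
      by (rule convex_setD[OF M(1) ellipsoid_inD[OF M(3) x] ellipsoid_inD[OF M(4) n]]) auto
    then show "(\<lambda>i. app_mat d B x i + (1 / 2) * b i) \<in> M"
      by (rule cylindricalD[OF M(2)]) (simp add: B app_mat_idm' distrib_left)
  qed
  then have "\<bar>Det d B\<bar> < 2 ^ d" using max by blast
  moreover have "\<bar>Det d B\<bar> = \<bar>Det d E\<bar>" using orthonormal_Det[OF R(1)] by (simp add: B_def Det_mat_prod Det_transposed abs_mult)
  moreover have "Det d E = (\<Prod>k<d. (1 / 2) * (1 + L k k))"
    by (subst Det_lower) (auto simp: E_def L Q(2) id_mat_def)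
  moreover have "(\<Prod>k<d. (1 / 2) * (1 + L k k)) = (1 / 2) ^ d * (\<Prod>k<d. 1 + L k k)"
    by (simp only: prod.distrib) simp
  moreover have Lpos: "0 \<le> L k k" if "k < d" for k using Q(3)[OF that] by (simp add: L)
  then have "0 \<le> (\<Prod>k<d. 1 + L k k)" by (intro prod_nonneg) (simp add: add_nonneg_nonneg)
  ultimately have "(1 / 2) ^ d * (\<Prod>k<d. 1 + L k k) < 2 ^ d" by (simp add: abs_mult)
  then have four: "(\<Prod>k<d. 1 + L k k) < 4 ^ d"
    by (simp add: power_divide divide_simps power_mult_distrib[symmetric])
  have split: "(\<Prod>k<d. f k) = f 0 * (\<Prod>k\<in>{1..<d}. f k)" for f :: "nat \<Rightarrow> real"
    using d by (subst lessThan_atLeast0, subst prod.atLeast_Suc_lessThan) auto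
  have "\<bar>Det d A\<bar> = \<bar>Det d N\<bar>" using orthonormal_Det[OF R(1)] by (simp add: N_def Det_mat_prod abs_mult)
  also have "\<dots> = (\<Prod>k<d. L k k)" using Det_QR[OF Q(1,2)] Lpos by (simp add: L)
  also have "\<dots> = L 0 0 * (\<Prod>k\<in>{1..<d}. L k k)"
    by (rule split)
  also have "\<dots> \<le> L 0 0 * (\<Prod>k<d. 1 + L k k)"
  proof (rule mult_left_mono)
    have "(\<Prod>k\<in>{1..<d}. L k k) \<le> (\<Prod>k\<in>{1..<d}. 1 + L k k)" using Lpos by (intro prod_mono) auto
    also have "\<dots> = 1 * (\<Prod>k\<in>{1..<d}. 1 + L k k)" by simp
    also have "\<dots> \<le> (1 + L 0 0) * (\<Prod>k\<in>{1..<d}. 1 + L k k)"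
      using Lpos d by (intro mult_right_mono prod_nonneg) (auto intro!: add_nonneg_nonneg)
    also have "\<dots> = (\<Prod>k<d. 1 + L k k)"
      by (rule split[symmetric])
    finally show "(\<Prod>k\<in>{1..<d}. L k k) \<le> (\<Prod>k<d. 1 + L k k)" .
    show "0 \<le> L 0 0" using Lpos d by auto
  qed
  also have "\<dots> \<le> L 0 0 * 4 ^ d" using four Lpos d by (intro mult_left_mono) auto
  finally have "\<bar>Det d A\<bar> / 4 ^ d \<le> L 0 0" by (simp add: divide_simps)
  also have "L 0 0 \<le> norm_Rd d (N 0) * norm_Rd d (Q 0)" unfolding L using dot_le[of d "N 0" "Q 0"] by linarith
  also have "norm_Rd d (Q 0) = 1"
  proof -
    have "(norm_Rd d (Q 0))\<^sup>2 = 1" using Q(1) d by (auto simp: orthonormal_def dot_self[symmetric] id_mat_def)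
    then show ?thesis using L2_set_nonneg[of "Q 0" "{..<d}"] by (auto simp: power2_eq_1_iff)
  qed
  also have "N 0 = app_mat d (transposed A) u" by (simp add: N_def mat_prod_def app_mat_def transposed_def R(2) mult.commute)
  finally show ?thesis by simp
qed

lemma le_of_mult_self: "a * a \<le> b * a \<Longrightarrow> 0 \<le> a \<Longrightarrow> 0 \<le> b \<Longrightarrow> a \<le> (b::real)"
  by (metis mult_right_le_imp_le order_le_less)

text \<open>
  The hypothesis bounds the norm of the inverse transpose of \<open>A\<close> by \<open>1 / r\<close>, and the inverse of \<open>A\<close>
  has the same norm.
\<close>

lemma ball_from_width:
  assumes "Det d A \<noteq> 0" and width: "\<And>u. norm_Rd d u = 1 \<Longrightarrow> r \<le> norm_Rd d (app_mat d (transposed A) u)" and x: "norm_Rd d x \<le> r"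
  obtains y where "norm_Rd d y \<le> 1" "\<And>i. i < d \<Longrightarrow> app_mat d A y i = x i"
proof -
  obtain C where C: "\<And>x i. i < d \<Longrightarrow> app_mat d A (app_mat d C x) i = x i" "\<And>x i. i < d \<Longrightarrow> app_mat d C (app_mat d A x) i = x i"
    using Det_inverse[OF assms(1)] by metis
  define y where "y = app_mat d C x"
  define w where "w = app_mat d (transposed C) y"
  define t where "t = app_mat d (transposed A) w"
  have "r * norm_Rd d w \<le> norm_Rd d t"
  proof (cases "norm_Rd d w = 0")
    case False
    then have pos: "norm_Rd d w > 0" using L2_set_nonneg[of w "{..<d}"] by linarith
    then have "norm_Rd d (\<lambda>i. (1 / norm_Rd d w) * w i) = 1" by (simp only: norm_Rd_scale) simp
    then have "r \<le> norm_Rd d (app_mat d (transposed A) (\<lambda>i. (1 / norm_Rd d w) * w i))" by (rule width)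
    then have "r \<le> (1 / norm_Rd d w) * norm_Rd d t" using pos by (simp only: app_mat_scale norm_Rd_scale t_def) simp
    then show ?thesis using pos by (simp add: field_simps)
  qed simp
  have "(norm_Rd d t)\<^sup>2 = dot d (app_mat d (transposed A) w) t" by (simp add: dot_self t_def)
  also have "\<dots> = dot d y (app_mat d C (app_mat d A t))" by (simp only: dot_app_mat[symmetric] w_def)
  also have "\<dots> = dot d y t" by (rule dot_cong) (simp_all add: C)
  also have "\<dots> \<le> norm_Rd d y * norm_Rd d t" using dot_le[of d y t] by linarith
  finally have "norm_Rd d t * norm_Rd d t \<le> norm_Rd d y * norm_Rd d t" by (simp add: power2_eq_square)
  then have ty: "norm_Rd d t \<le> norm_Rd d y" by (rule le_of_mult_self) simp_all
  have "(norm_Rd d y)\<^sup>2 = dot d w x" unfolding w_def dot_app_mat[symmetric] y_def dot_self[symmetric] ..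
  also have "\<dots> \<le> norm_Rd d w * norm_Rd d x" using dot_le[of d w x] by linarith
  also have "\<dots> \<le> norm_Rd d w * r" using x by (intro mult_left_mono) auto
  also have "\<dots> \<le> norm_Rd d y" using \<open>r * norm_Rd d w \<le> norm_Rd d t\<close> ty by (simp add: mult.commute)
  finally have "norm_Rd d y * norm_Rd d y \<le> 1 * norm_Rd d y" by (simp add: power2_eq_square)
  then have "norm_Rd d y \<le> 1" by (rule le_of_mult_self) simp_all
  then show ?thesis using that[of y] C(1) by (simp add: y_def)
qed

text \<open>
  In the coordinates in which \<open>T B + t\<close> is the unit ball, the ellipsoid \<open>A B + a\<close> has determinant at least
  \<open>\<delta> / 2\<^sup>d\<close> and no ellipsoid in \<open>M\<close> has determinant \<open>2\<^sup>d\<close>, so \<open>width_of_inner_ellipsoid\<close> applies.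
\<close>

lemma scaled_copy_in_sets:
  assumes d: "d \<ge> 1" and M: "closed_convex d M" "ellipsoid_in d T t M" "ellipsoid_in d A a M"
    and max: "\<forall>A b. ellipsoid_in d A b M \<longrightarrow> \<bar>Det d A\<bar> < 2 ^ d * v"
    and T: "v \<le> \<bar>Det d T\<bar>" "v > 0" and A: "\<delta> * v \<le> \<bar>Det d A\<bar>" "\<delta> > 0"
  obtains y where "\<And>F. cylindrical d F \<Longrightarrow> ellipsoid_in d A a F \<Longrightarrow> ellipsoid_in d (\<lambda>i j. (\<delta> / 8 ^ d) * T i j) y F"
proof -
  have T0: "Det d T \<noteq> 0" using T by auto
  obtain C where C: "\<And>x i. i < d \<Longrightarrow> app_mat d T (app_mat d C x) i = x i" "Det d C = 1 / Det d T"
    using Det_inverse[OF T0] by metis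
  define M' where "M' = {x. (\<lambda>i. app_mat d T x i + t i) \<in> M}"
  define A' where "A' = mat_prod d C A"
  define a' where "a' = app_mat d C (\<lambda>i. a i - t i)"
  have cM': "closed_convex d M'" unfolding M'_def by (rule closed_convex_preimage[OF M(1)])
  have cylM: "cylindrical d M" using M(1) by (simp add: closed_convex_def)
  have id: "ellipsoid_in d id_mat (\<lambda>_. 0) M'" unfolding ellipsoid_in_def
  proof (intro allI impI)
    fix x assume x: "norm_Rd d x \<le> 1"
    have "app_mat d T (\<lambda>i. app_mat d id_mat x i + 0) = app_mat d T x" by (rule app_mat_cong) (simp add: app_mat_idm')
    then show "(\<lambda>i. app_mat d id_mat x i + 0) \<in> M'" using ellipsoid_inD[OF M(2) x] by (simp add: M'_def)
  qed
  have el: "ellipsoid_in d A' a' M'" unfolding A'_def a'_def M'_def by (rule ellipsoid_in_pullback[OF C(1) M(3) cylM])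
  have max': "\<forall>A b. ellipsoid_in d A b M' \<longrightarrow> \<bar>Det d A\<bar> < 2 ^ d"
  proof (intro allI impI)
    fix B b assume "ellipsoid_in d B b M'"
    then have "ellipsoid_in d (mat_prod d T B) (\<lambda>i. app_mat d T b i + t i) M" by (simp add: M'_def ellipsoid_in_preimage)
    then have "\<bar>Det d T\<bar> * \<bar>Det d B\<bar> < 2 ^ d * v" using max by (metis Det_mat_prod abs_mult)
    also have "\<dots> \<le> 2 ^ d * \<bar>Det d T\<bar>" using T by simp
    finally have "\<bar>Det d T\<bar> * \<bar>Det d B\<bar> < \<bar>Det d T\<bar> * 2 ^ d" by (simp add: mult.commute)
    then show "\<bar>Det d B\<bar> < 2 ^ d" by (rule mult_left_less_imp_less) simp
  qed
  have DA: "\<bar>Det d A'\<bar> = \<bar>Det d A\<bar> / \<bar>Det d T\<bar>" by (simp add: A'_def Det_mat_prod C(2) abs_mult)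
  have "\<bar>Det d T\<bar> < 2 ^ d * v" using max M(2) by blast
  then have "\<delta> * \<bar>Det d T\<bar> \<le> \<delta> * (2 ^ d * v)" using A(2) by (intro mult_left_mono) auto
  also have "\<dots> \<le> 2 ^ d * \<bar>Det d A\<bar>" using A(1) by (simp add: mult.left_commute)
  finally have "\<delta> / 2 ^ d \<le> \<bar>Det d A'\<bar>" unfolding DA using T0 by (simp add: field_simps)
  then have "\<delta> / 2 ^ d / 4 ^ d \<le> \<bar>Det d A'\<bar> / 4 ^ d" by (rule divide_right_mono) simp
  moreover have "(8::real) ^ d = 2 ^ d * 4 ^ d" by (simp add: power_mult_distrib[symmetric])
  ultimately have r: "\<delta> / 8 ^ d \<le> \<bar>Det d A'\<bar> / 4 ^ d" by (simp add: field_simps)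
  have "Det d A' \<noteq> 0" using \<open>\<delta> / 2 ^ d \<le> \<bar>Det d A'\<bar>\<close> A(2) by (smt (verit) divide_pos_pos zero_less_power)
  define y where "y = (\<lambda>i. app_mat d T a' i + t i)"
  show ?thesis
  proof (rule that[of y])
    fix F assume F: "cylindrical d F" "ellipsoid_in d A a F"
    show "ellipsoid_in d (\<lambda>i j. (\<delta> / 8 ^ d) * T i j) y F" unfolding ellipsoid_in_def
    proof (intro allI impI)
      fix x assume x: "norm_Rd d x \<le> 1"
      have "norm_Rd d (\<lambda>i. (\<delta> / 8 ^ d) * x i) \<le> \<delta> / 8 ^ d"
        unfolding norm_Rd_scale using mult_left_mono[OF x, of "\<delta> / 8 ^ d"] A(2) by simp
      also note r
      finally obtain z where z: "norm_Rd d z \<le> 1" "\<And>i. i < d \<Longrightarrow> app_mat d A' z i = (\<delta> / 8 ^ d) * x i"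
      proof (rule ball_from_width[OF \<open>Det d A' \<noteq> 0\<close>, rotated])
        show "\<bar>Det d A'\<bar> / 4 ^ d \<le> norm_Rd d (app_mat d (transposed A') u)" if "norm_Rd d u = 1" for u
          using cM' by (intro width_of_inner_ellipsoid[OF _ _ id el max' that d]) (auto simp: closed_convex_def)
      qed blast
      have F': "(\<lambda>i. app_mat d A' z i + a' i) \<in> {x. (\<lambda>i. app_mat d T x i + t i) \<in> F}"
        unfolding A'_def a'_def by (rule ellipsoid_inD[OF ellipsoid_in_pullback[OF C(1) F(2,1)] z(1)])
      have "app_mat d T (\<lambda>i. app_mat d A' z i + a' i) = app_mat d T (\<lambda>i. (\<delta> / 8 ^ d) * x i + 1 * a' i)"
        by (rule app_mat_cong) (simp add: z(2))
      also have "\<dots> = (\<lambda>i. (\<delta> / 8 ^ d) * app_mat d T x i + 1 * app_mat d T a' i)" by (rule app_mat_lin)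
      finally have "(\<lambda>i. ((\<delta> / 8 ^ d) * app_mat d T x i + 1 * app_mat d T a' i) + t i) \<in> F" using F' by simp
      then show "(\<lambda>i. app_mat d (\<lambda>i j. (\<delta> / 8 ^ d) * T i j) x i + y i) \<in> F"
        by (rule cylindricalD[OF F(1)]) (simp add: y_def app_mat_def sum_distrib_left sum_distrib_right sum_divide_distrib mult.assoc)
    qed
  qed
qed

lemma closed_convex_halfspace: assumes "d \<ge> 1" shows "closed_convex d {z. z 0 \<le> s}"
  unfolding closed_convex_def
proof (intro conjI)
  show "closed {z::nat \<Rightarrow> real. z 0 \<le> s}" by (rule closed_Collect_le[OF continuous_on_coord continuous_on_const])
  show "convex_set {z. z 0 \<le> s}" unfolding convex_set_def
  proof (intro ballI allI impI)
    fix x y :: "nat \<Rightarrow> real" and u v :: real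
    assume *: "x \<in> {z. z 0 \<le> s}" "y \<in> {z. z 0 \<le> s}" "0 \<le> u" "0 \<le> v" "u + v = 1"
    have "u * x 0 + v * y 0 \<le> u * s + v * s" using * by (intro add_mono mult_left_mono) auto
    also have "\<dots> = s" using *(5) by (simp add: distrib_right[symmetric])
    finally show "(\<lambda>i. u * x i + v * y i) \<in> {z. z 0 \<le> s}" by simp
  qed
  show "cylindrical d {z. z 0 \<le> s}" unfolding cylindrical_def using assms by auto
qed

text \<open>
  The homothety with ratio \<open>1/2\<close> about the lowest point of the ellipsoid lowers its highest point by
  \<open>\<bar>A 0\<bar>\<close>, half of the height of the ellipsoid.
\<close>

lemma halved_ellipsoid:
  assumes d: "d \<ge> 1" and H: "ellipsoid_in d A b {z. z 0 \<le> s}"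
  obtains b' where "\<And>K. ellipsoid_in d A b K \<Longrightarrow> ellipsoid_in d (\<lambda>i j. (1 / 2) * A i j) b' K"
    "ellipsoid_in d (\<lambda>i j. (1 / 2) * A i j) b' {z. z 0 \<le> s - norm_Rd d (A 0)}"
proof -
  define n where "n = norm_Rd d (A 0)"
  have "n \<ge> 0" by (simp add: n_def)
  define e where "e = (\<lambda>i. (if n = 0 then 0 else 1 / n) * A 0 i)"
  have e1: "norm_Rd d e \<le> 1" by (simp add: e_def norm_Rd_scale n_def)
  have Ae: "app_mat d A e 0 = n" unfolding app_mat_row e_def dot_scale dot_self n_def[symmetric] by (simp add: power2_eq_square)
  define b' where "b' = (\<lambda>i. b i - (1 / 2) * app_mat d A e i)"
  have half: "app_mat d (\<lambda>i j. (1 / 2) * A i j) x i = (1 / 2) * app_mat d A x i" for x i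
    by (simp add: app_mat_def sum_divide_distrib)
  show ?thesis
  proof (rule that[of b'])
    fix K assume K: "ellipsoid_in d A b K"
    show "ellipsoid_in d (\<lambda>i j. (1 / 2) * A i j) b' K" unfolding ellipsoid_in_def
    proof (intro allI impI)
      fix x assume x: "norm_Rd d x \<le> 1"
      define w where "w = (\<lambda>i. (1 / 2) * x i + (- (1 / 2)) * e i)"
      have "norm_Rd d w \<le> norm_Rd d (\<lambda>i. (1 / 2) * x i) + norm_Rd d (\<lambda>i. (- (1 / 2)) * e i)"
        unfolding w_def by (rule L2_set_triangle_ineq)
      also have "\<dots> \<le> 1" using x e1 by (simp only: norm_Rd_scale)
      finally have "(\<lambda>i. app_mat d A w i + b i) \<in> K" by (rule ellipsoid_inD[OF K])
      moreover have "app_mat d A w = (\<lambda>i. (1 / 2) * app_mat d A x i + (- (1 / 2)) * app_mat d A e i)" unfolding w_def by (rule app_mat_lin)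
      ultimately have "(\<lambda>i. (1 / 2) * app_mat d A x i + (- (1 / 2)) * app_mat d A e i + b i) \<in> K" by simp
      moreover have "(\<lambda>i. (1 / 2) * app_mat d A x i + (- (1 / 2)) * app_mat d A e i + b i)
          = (\<lambda>i. app_mat d (\<lambda>i j. (1 / 2) * A i j) x i + b' i)"
        unfolding half b'_def by (rule ext) simp
      ultimately show "(\<lambda>i. app_mat d (\<lambda>i j. (1 / 2) * A i j) x i + b' i) \<in> K" by simp
    qed
  next
    have bs: "n + b 0 \<le> s" using ellipsoid_inD[OF H e1] Ae by simp
    show "ellipsoid_in d (\<lambda>i j. (1 / 2) * A i j) b' {z. z 0 \<le> s - norm_Rd d (A 0)}" unfolding ellipsoid_in_def
    proof (intro allI impI)
      fix x assume x: "norm_Rd d x \<le> 1"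
      have "app_mat d A x 0 \<le> n * norm_Rd d x" using dot_le[of d "A 0" x] by (simp add: app_mat_row n_def)
      also have "\<dots> \<le> n" using x \<open>n \<ge> 0\<close> by (simp add: mult_left_le)
      finally have "(1 / 2) * app_mat d A x 0 + b' 0 \<le> s - n" using bs by (simp add: b'_def Ae)
      then show "(\<lambda>i. app_mat d (\<lambda>i j. (1 / 2) * A i j) x i + b' i) \<in> {z. z 0 \<le> s - norm_Rd d (A 0)}"
        by (simp only: half n_def mem_Collect_eq)
    qed
  qed
qed

section \<open>The colourful theorem for determinants\<close>

text \<open>
  The combinatorial heart: the sweep by half-spaces, the quantitative Helly theorem for \<open>3d + 1\<close> sets
  and the colourful Helly theorem for the \<open>d + 1\<close> remaining families. Heights of the half-space are
  restricted to steps of length \<open>\<eta>\<close>, a lower bound for the half-width of large ellipsoids, so a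
  least admissible height exists and halving an ellipsoid lowers it past the previous height.
\<close>

lemma colourful_core:
  assumes d: "d \<ge> 1" and v: "v > 0" and R: "R \<ge> 1"
    and fin: "\<And>i. i \<in> {1..3*d} \<Longrightarrow> finite (\<C> i)" and ne: "\<And>i. i \<in> {1..3*d} \<Longrightarrow> \<C> i \<noteq> {}"
    and closed_convex: "\<And>i C. i \<in> {1..3*d} \<Longrightarrow> C \<in> \<C> i \<Longrightarrow> closed_convex d C"
    and box: "\<And>i C z k. i \<in> {1..3*d} \<Longrightarrow> C \<in> \<C> i \<Longrightarrow> z \<in> C \<Longrightarrow> k < d \<Longrightarrow> \<bar>z k\<bar> \<le> R"
    and sel: "\<forall>J K. J \<subseteq> {1..3*d} \<longrightarrow> card J = 2*d \<longrightarrow> (\<forall>j\<in>J. K j \<in> \<C> j) \<longrightarrow>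
      (\<exists>A b. v \<le> \<bar>Det d A\<bar> \<and> (\<forall>j\<in>J. ellipsoid_in d A b (K j)))"
  defines "\<delta> \<equiv> 1 / (54 * (real d)\<^sup>2 * sqrt (real d)) ^ d"
  shows "\<exists>i\<in>{1..3*d}. \<exists>A b. (\<delta> / 8 ^ d) ^ d * v \<le> \<bar>Det d A\<bar> \<and> (\<forall>C\<in>\<C> i. ellipsoid_in d A b C)"
proof -
  let ?S = "{1..3*d}"
  have \<delta>: "\<delta> > 0" using d by (simp add: \<delta>_def)
  define F0 where "F0 = (\<lambda>i. SOME C. C \<in> \<C> i)"
  have F0: "F0 i \<in> \<C> i" if "i \<in> ?S" for i
    unfolding F0_def by (rule someI_ex) (simp only: ex_in_conv ne[OF that] not_False_eq_True)
  have extend: "\<exists>J'. J \<subseteq> J' \<and> J' \<subseteq> ?S \<and> card J' = n" if "J \<subseteq> ?S" "card J \<le> n" "n \<le> 3 * d" for J n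
    using exists_subset_between[of J n ?S] that by auto
  have sel': "\<exists>A b. v \<le> \<bar>Det d A\<bar> \<and> (\<forall>j\<in>J. ellipsoid_in d A b (K j))"
    if J: "J \<subseteq> ?S" "card J \<le> 2 * d" and K: "\<forall>j\<in>J. K j \<in> \<C> j" for J K
  proof -
    obtain J' where J': "J \<subseteq> J'" "J' \<subseteq> ?S" "card J' = 2 * d" using extend[of J "2 * d"] J by auto
    have "\<forall>j\<in>J'. (if j \<in> J then K j else F0 j) \<in> \<C> j" using K F0 J' by auto
    from sel[rule_format, OF J'(2,3), of "\<lambda>j. if j \<in> J then K j else F0 j"] this
    obtain A b where A: "v \<le> \<bar>Det d A\<bar>" "\<forall>j\<in>J'. ellipsoid_in d A b (if j \<in> J then K j else F0 j)" by blast
    have "ellipsoid_in d A b (K j)" if "j \<in> J" for j using bspec[OF A(2), of j] that J'(1) by auto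
    then show ?thesis using A(1) by blast
  qed
  have le3: "2 * d - 1 \<le> 3 * d" by arith
  define H where "H = (\<lambda>s. {z::nat \<Rightarrow> real. z 0 \<le> s})"
  have ellH: "ellipsoid_in d A b (H s')" if "ellipsoid_in d A b (H s)" "s \<le> s'" for A b s s'
    using that by (force simp: ellipsoid_in_def H_def)
  define P where "P = (\<lambda>s. \<forall>J K. J \<subseteq> ?S \<longrightarrow> card J = 2 * d - 1 \<longrightarrow> (\<forall>j\<in>J. K j \<in> \<C> j) \<longrightarrow>
      (\<exists>A b. v \<le> \<bar>Det d A\<bar> \<and> (\<forall>j\<in>J. ellipsoid_in d A b (K j)) \<and> ellipsoid_in d A b (H s)))"
  have PD: "\<exists>A b. v \<le> \<bar>Det d A\<bar> \<and> (\<forall>j\<in>J. ellipsoid_in d A b (K j)) \<and> ellipsoid_in d A b (H s)"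
    if "P s" "J \<subseteq> ?S" "card J = 2 * d - 1" "\<forall>j\<in>J. K j \<in> \<C> j" for s J K
    by (rule mp[OF mp[OF mp[OF spec[OF spec[OF that(1)[unfolded P_def]]] that(2)] that(3)] that(4)])
  \<comment> \<open>\<open>\<eta>\<close> bounds the half-width in coordinate direction \<open>0\<close> from below\<close>
  define \<eta> where "\<eta> = v / R ^ (d - 1)"
  have \<eta>: "\<eta> > 0" using v R by (simp add: \<eta>_def)
  have wide: "\<eta> \<le> norm_Rd d (A 0)" if A: "v \<le> \<bar>Det d A\<bar>" "ellipsoid_in d A b C" "C \<in> \<C> i" "i \<in> ?S" for A b C i
  proof -
    have row: "norm_Rd d (A k) \<le> R" if "k < d" for k
      by (rule row_le_box[OF A(2) _ that]) (rule box[OF A(4,3)])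
    have "v \<le> (\<Prod>k<d. norm_Rd d (A k))" using A(1) Hadamard[of d A] by linarith
    also have "\<dots> = norm_Rd d (A 0) * (\<Prod>k\<in>{1..<d}. norm_Rd d (A k))"
      using d by (subst lessThan_atLeast0, subst prod.atLeast_Suc_lessThan) auto
    also have "(\<Prod>k\<in>{1..<d}. norm_Rd d (A k)) \<le> (\<Prod>k\<in>{1..<d}. R)" using row by (intro prod_mono) auto
    also have "\<dots> = R ^ (d - 1)" by simp
    finally have "v \<le> norm_Rd d (A 0) * R ^ (d - 1)" by (simp add: mult_left_mono)
    then show ?thesis using R by (simp add: \<eta>_def field_simps)
  qed
  have PR: "P s" if "R \<le> s" for s unfolding P_def
  proof (intro allI impI)
    fix J K assume J: "J \<subseteq> ?S" "card J = 2 * d - 1" "\<forall>j\<in>J. K j \<in> \<C> j"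
    then have "card J \<noteq> 0" "card J \<le> 2 * d" using d by auto
    then obtain j where j: "j \<in> J" by fastforce
    obtain A b where A: "v \<le> \<bar>Det d A\<bar>" "\<forall>j\<in>J. ellipsoid_in d A b (K j)" using sel'[OF J(1) \<open>card J \<le> 2 * d\<close> J(3)] by blast
    have "ellipsoid_in d A b (H R)" unfolding ellipsoid_in_def H_def
    proof (intro allI impI CollectI)
      fix x assume "norm_Rd d x \<le> 1"
      then have "(\<lambda>i. app_mat d A x i + b i) \<in> K j" using A(2) j ellipsoid_inD by blast
      then have "\<bar>app_mat d A x 0 + b 0\<bar> \<le> R" using box[of j "K j" _ 0] J j d by force
      then show "app_mat d A x 0 + b 0 \<le> R" by simp
    qed
    then show "\<exists>A b. v \<le> \<bar>Det d A\<bar> \<and> (\<forall>j\<in>J. ellipsoid_in d A b (K j)) \<and> ellipsoid_in d A b (H s)"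
      using A ellH that by blast
  qed
  have nP: "\<not> P (- R - 1)"
  proof
    assume low: "P (- R - 1)"
    obtain J where J: "J \<subseteq> ?S" "card J = 2 * d - 1" using extend[of "{}" "2 * d - 1", OF _ _ le3] by auto
    have "\<forall>j\<in>J. F0 j \<in> \<C> j" using F0 J(1) by blast
    from PD[OF low J this] obtain A b where A: "\<forall>j\<in>J. ellipsoid_in d A b (F0 j)" "ellipsoid_in d A b (H (- R - 1))"
      by blast
    have "card J \<noteq> 0" using J d by auto
    then obtain j where j: "j \<in> J" by fastforce
    have z: "norm_Rd d (\<lambda>_. 0) \<le> 1" by simp
    have "(\<lambda>i. app_mat d A (\<lambda>_. 0) i + b i) \<in> F0 j" "(\<lambda>i. app_mat d A (\<lambda>_. 0) i + b i) \<in> H (- R - 1)"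
      using ellipsoid_inD[OF bspec[OF A(1) j] z] ellipsoid_inD[OF A(2) z] by auto
    then show False using box[of j "F0 j" "\<lambda>i. app_mat d A (\<lambda>_. 0) i + b i" 0] F0[of j] J j d
      by (auto simp: H_def)
  qed
  define Q where "Q = (\<lambda>m::nat. P (- R - 1 + real m * \<eta>))"
  define n where "n = Least Q"
  have n: "Q n" "\<And>m. m < n \<Longrightarrow> \<not> Q m"
  proof -
    obtain m :: nat where "2 * R + 1 < real m * \<eta>" using reals_Archimedean3[OF \<eta>] by blast
    then have "Q m" unfolding Q_def by (intro PR) simp
    then show "Q n" unfolding n_def by (rule LeastI)
    show "\<not> Q m" if "m < n" for m using that unfolding n_def by (rule not_less_Least)
  qed
  have "n \<noteq> 0" using n(1) nP by (intro notI) (simp add: Q_def)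
  define s where "s = - R - 1 + real n * \<eta>"
  have Ps: "P s" using n(1) by (simp add: s_def Q_def)
  have "- R - 1 + real (n - 1) * \<eta> = s - \<eta>" using \<open>n \<noteq> 0\<close> by (simp add: s_def of_nat_diff algebra_simps)
  then have "\<not> P (s - \<eta>)" using n(2)[of "n - 1"] \<open>n \<noteq> 0\<close> by (simp add: Q_def)
  then obtain J0 K0 where J0: "J0 \<subseteq> ?S" "card J0 = 2 * d - 1" "\<forall>j\<in>J0. K0 j \<in> \<C> j"
    and no: "\<And>A b. v \<le> \<bar>Det d A\<bar> \<Longrightarrow> \<forall>j\<in>J0. ellipsoid_in d A b (K0 j) \<Longrightarrow> \<not> ellipsoid_in d A b (H (s - \<eta>))"
    unfolding P_def by blast
  have "card J0 \<noteq> 0" using J0 d by auto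
  then obtain j0 where j0: "j0 \<in> J0" by fastforce
  have max: "\<bar>Det d A\<bar> < 2 ^ d * v" if A: "\<forall>j\<in>J0. ellipsoid_in d A b (K0 j)" "ellipsoid_in d A b (H s)" for A b
  proof (rule ccontr)
    assume *: "\<not> ?thesis"
    obtain b' where b': "\<And>K. ellipsoid_in d A b K \<Longrightarrow> ellipsoid_in d (\<lambda>i j. (1 / 2) * A i j) b' K"
      "ellipsoid_in d (\<lambda>i j. (1 / 2) * A i j) b' {z. z 0 \<le> s - norm_Rd d (A 0)}"
      using halved_ellipsoid[OF d A(2)[unfolded H_def]] by blast
    have "v * 1 \<le> v * 2 ^ d" using v by (intro mult_left_mono) auto
    then have "v \<le> \<bar>Det d A\<bar>" using * by (simp add: mult.commute)
    then have "\<eta> \<le> norm_Rd d (A 0)" using wide[of A b "K0 j0" j0] A(1) J0 j0 by blast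
    then have "ellipsoid_in d (\<lambda>i j. (1 / 2) * A i j) b' (H (s - \<eta>))"
      using ellH[of _ b' "s - norm_Rd d (A 0)" "s - \<eta>"] b'(2) unfolding H_def by simp
    moreover have "\<forall>j\<in>J0. ellipsoid_in d (\<lambda>i j. (1 / 2) * A i j) b' (K0 j)" using A(1) b'(1) by blast
    moreover have "v \<le> \<bar>Det d (\<lambda>i j. (1 / 2) * A i j)\<bar>"
      using * by (simp only: Det_scale abs_mult) (simp add: power_one_over field_simps)
    ultimately show False using no by blast
  qed
  obtain T t where T: "v \<le> \<bar>Det d T\<bar>" "\<forall>j\<in>J0. ellipsoid_in d T t (K0 j)" "ellipsoid_in d T t (H s)"
    using PD[OF Ps J0] by blast
  have cccH: "closed_convex d (H s)" unfolding H_def by (rule closed_convex_halfspace[OF d])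
  \<comment> \<open>the ellipsoid \<open>T\<close> depends on \<open>J0\<close> and \<open>K0\<close> only, so its translates can be compared for all \<open>F\<close>\<close>
  define M where "M = (\<Inter>G\<in>insert (H s) (K0 ` J0). G)"
  have cM: "closed_convex d M" unfolding M_def using cccH J0 closed_convex by (intro closed_convex_INT) auto
  have ellM: "ellipsoid_in d A b M \<longleftrightarrow> (\<forall>j\<in>J0. ellipsoid_in d A b (K0 j)) \<and> ellipsoid_in d A b (H s)" for A b
    by (auto simp: ellipsoid_in_def M_def)
  define I' where "I' = ?S - J0"
  have "card I' = d + 1" using J0 d by (simp add: I'_def card_Diff_subset finite_subset)
  have key: "\<exists>y. \<forall>i\<in>I'. ellipsoid_in d (\<lambda>i j. (\<delta> / 8 ^ d) * T i j) y (F i)"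
    if F: "\<And>i. i \<in> I' \<Longrightarrow> F i \<in> \<C> i" for F
  proof -
    define K where "K = (\<lambda>j. if j \<in> J0 then K0 j else F j)"
    have K: "K j \<in> \<C> j" if "j \<in> ?S" for j using that J0(3) F by (auto simp: K_def I'_def)
    define G where "G = (\<lambda>j. if j = 0 then H s else K j)"
    have G: "closed_convex d (G i)" if "i \<in> {0..3*d}" for i using that cccH closed_convex[of i "K i"] K[of i] by (auto simp: G_def)
    obtain A a where A: "v / (54 * (real d)\<^sup>2 * sqrt (real d)) ^ d \<le> \<bar>Det d A\<bar>" "\<And>j. j \<in> {0..3*d} \<Longrightarrow> ellipsoid_in d A a (G j)"
    proof (rule quantitative_Helly[where d = d and I = "{0..3*d}" and G = G and R = R and v = v, OF d _ G _ v])
      show "\<bar>z k\<bar> \<le> R" if z: "z \<in> (\<Inter>j\<in>{0..3*d}. G j)" and "k < d" for z k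
      proof -
        have "z \<in> G 1" using z d by auto
        then show ?thesis using box[of 1 "K 1" z k] K[of 1] that d by (simp add: G_def)
      qed
      show "\<exists>A b. v \<le> \<bar>Det d A\<bar> \<and> (\<forall>j\<in>J. ellipsoid_in d A b (G j))" if J: "J \<subseteq> {0..3*d}" "card J \<le> 2 * d" for J
      proof (cases "0 \<in> J")
        case True
        have "finite J" using J(1) finite_subset by blast
        then have "card (J - {0}) \<le> 2 * d - 1" using True J by simp
        moreover have JS: "J - {0} \<subseteq> ?S"
        proof
          fix j assume "j \<in> J - {0}"
          then show "j \<in> ?S" using subsetD[OF J(1), of j] by simp
        qed
        ultimately obtain J' where J': "J - {0} \<subseteq> J'" "J' \<subseteq> ?S" "card J' = 2 * d - 1"
          using extend[of "J - {0}" "2 * d - 1", OF _ _ le3] by auto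
        have "\<forall>j\<in>J'. K j \<in> \<C> j" using J'(2) K by blast
        then obtain A b where A: "v \<le> \<bar>Det d A\<bar>" "\<forall>j\<in>J'. ellipsoid_in d A b (K j)" "ellipsoid_in d A b (H s)"
          using PD[OF Ps J'(2,3)] by blast
        have "ellipsoid_in d A b (G j)" if "j \<in> J" for j
          using A(2,3) that J'(1) by (cases "j = 0") (auto simp: G_def)
        then show ?thesis using A(1) by blast
      next
        case False
        have JS: "J \<subseteq> ?S"
        proof
          fix j assume "j \<in> J"
          then show "j \<in> ?S" using subsetD[OF J(1), of j] False by (cases "j = 0") auto
        qed
        then have "\<forall>j\<in>J. K j \<in> \<C> j" using K by blast
        then obtain A b where A: "v \<le> \<bar>Det d A\<bar>" "\<forall>j\<in>J. ellipsoid_in d A b (K j)" using sel'[OF JS J(2)] by blast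
        have "ellipsoid_in d A b (G j)" if "j \<in> J" for j using A(2) that False by (auto simp: G_def)
        then show ?thesis using A(1) by blast
      qed
    qed (auto)
    have AK: "ellipsoid_in d A a (K j)" if "j \<in> ?S" for j using A(2)[of j] that by (simp add: G_def)
    have m1: "ellipsoid_in d A a M" unfolding ellM
    proof
      show "\<forall>j\<in>J0. ellipsoid_in d A a (K0 j)"
      proof
        fix j assume j: "j \<in> J0"
        show "ellipsoid_in d A a (K0 j)" using AK[OF subsetD[OF J0(1) j]] j by (simp add: K_def)
      qed
      show "ellipsoid_in d A a (H s)" using A(2)[of 0] by (simp add: G_def)
    qed
    have m2: "ellipsoid_in d T t M" using T ellM by blast
    have m3: "\<forall>A b. ellipsoid_in d A b M \<longrightarrow> \<bar>Det d A\<bar> < 2 ^ d * v" using max ellM by blast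
    have m4: "\<delta> * v \<le> \<bar>Det d A\<bar>" using A(1) by (simp add: \<delta>_def)
    obtain y where y: "\<And>F. cylindrical d F \<Longrightarrow> ellipsoid_in d A a F \<Longrightarrow> ellipsoid_in d (\<lambda>i j. (\<delta> / 8 ^ d) * T i j) y F"
      by (rule scaled_copy_in_sets[OF d cM m2 m1 m3 T(1) v m4 \<delta>]) blast
    have "ellipsoid_in d (\<lambda>i j. (\<delta> / 8 ^ d) * T i j) y (F i)" if "i \<in> I'" for i
    proof (rule y)
      show "cylindrical d (F i)" using closed_convex[of i "F i"] F[OF that] that by (auto simp: I'_def closed_convex_def)
      show "ellipsoid_in d A a (F i)" using AK[of i] that by (auto simp: K_def I'_def)
    qed
    then show ?thesis by blast
  qed
  obtain g where g: "bij_betw g {0..<d + 1} I'"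
    using ex_bij_betw_nat_finite[of I'] \<open>card I' = d + 1\<close> by (auto simp: I'_def)
  have gI: "g k \<in> I'" if "k \<le> d" for k using bij_betwE[OF g] that by auto
  define \<F> where "\<F> = (\<lambda>k. (\<lambda>C. {y. ellipsoid_in d (\<lambda>i j. (\<delta> / 8 ^ d) * T i j) y C}) ` \<C> (g k))"
  obtain k y where y: "k \<le> d" "\<And>S. S \<in> \<F> k \<Longrightarrow> y \<in> S"
  proof (rule colourful_Helly[of d \<F>])
    show "finite (\<F> k)" if "k \<le> d" for k using fin[of "g k"] gI[OF that] by (simp add: \<F>_def I'_def)
    show "closed_convex d S" if k: "k \<le> d" and S: "S \<in> \<F> k" for k S
    proof -
      obtain C where C: "C \<in> \<C> (g k)" "S = {y. ellipsoid_in d (\<lambda>i j. (\<delta> / 8 ^ d) * T i j) y C}" using S unfolding \<F>_def by blast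
      have "closed_convex d C" using closed_convex[OF _ C(1)] gI[OF k] by (auto simp: I'_def)
      then show ?thesis unfolding C(2) by (rule closed_convex_erosion)
    qed
    fix K assume K: "\<And>k. k \<le> d \<Longrightarrow> K k \<in> \<F> k"
    have "\<forall>k\<in>{0..<d + 1}. \<exists>C. C \<in> \<C> (g k) \<and> K k = {y. ellipsoid_in d (\<lambda>i j. (\<delta> / 8 ^ d) * T i j) y C}"
    proof
      fix k assume "k \<in> {0..<d + 1}"
      then have "K k \<in> \<F> k" by (intro K) auto
      then show "\<exists>C. C \<in> \<C> (g k) \<and> K k = {y. ellipsoid_in d (\<lambda>i j. (\<delta> / 8 ^ d) * T i j) y C}" unfolding \<F>_def by blast
    qed
    from bchoice[OF this] obtain f where f: "\<forall>k\<in>{0..<d + 1}. f k \<in> \<C> (g k) \<and> K k = {y. ellipsoid_in d (\<lambda>i j. (\<delta> / 8 ^ d) * T i j) y (f k)}" ..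
    define F where "F = (\<lambda>i. f (the_inv_into {0..<d + 1} g i))"
    have Fg: "F (g k) = f k" if "k \<in> {0..<d + 1}" for k
      using g that by (simp add: F_def bij_betw_def the_inv_into_f_f)
    have "F i \<in> \<C> i" if i: "i \<in> I'" for i
    proof -
      obtain k where "k \<in> {0..<d + 1}" "i = g k" using g i by (auto simp: bij_betw_def)
      then show ?thesis using f Fg by simp
    qed
    from key[of F, OF this] obtain y where y: "\<forall>i\<in>I'. ellipsoid_in d (\<lambda>i j. (\<delta> / 8 ^ d) * T i j) y (F i)" by blast
    have "y \<in> K k" if "k \<le> d" for k
    proof -
      have k: "k \<in> {0..<d + 1}" using that by auto
      then show ?thesis using bspec[OF f k] bspec[OF y gI[OF that]] Fg[OF k] by simp
    qed
    then show "\<exists>y. \<forall>k\<le>d. y \<in> K k" by blast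
  qed blast
  have "ellipsoid_in d (\<lambda>i j. (\<delta> / 8 ^ d) * T i j) y C" if "C \<in> \<C> (g k)" for C
    using y(2)[of "{y. ellipsoid_in d (\<lambda>i j. (\<delta> / 8 ^ d) * T i j) y C}"] that by (auto simp: \<F>_def)
  moreover have "(\<delta> / 8 ^ d) ^ d * v \<le> \<bar>Det d (\<lambda>i j. (\<delta> / 8 ^ d) * T i j)\<bar>"
    unfolding Det_scale abs_mult using T(1) \<delta> by (simp add: mult_left_mono)
  moreover have "g k \<in> ?S" using gI[OF y(1)] by (simp add: I'_def)
  ultimately show ?thesis by blast
qed

section \<open>Convex bodies in coordinates\<close>

definition cylinder :: "nat \<Rightarrow> (nat \<Rightarrow> real) set \<Rightarrow> (nat \<Rightarrow> real) set" where
  "cylinder d K = {x. restrict x {..<d} \<in> K}"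

lemma closed_convex_cylinder:
  assumes "convex_body d K"
  shows "closed_convex d (cylinder d K)"
  unfolding closed_convex_def
proof (intro conjI)
  have comp: "compactin (Rd_topology d) K" and conv: "convex_Rd d K" using assms by (auto simp: convex_body_def)
  have "Hausdorff_space (Rd_topology d)"
    unfolding Rd_topology_def by (simp add: Hausdorff_space_product_topology)
  then have "closedin (Rd_topology d) K" using comp by (rule compactin_imp_closedin)
  moreover have "continuous_map euclidean (Rd_topology d) (\<lambda>x. restrict x {..<d})"
    unfolding Rd_topology_def continuous_map_componentwise
  proof (intro conjI ballI)
    fix k assume k: "k \<in> {..<d}"
    have "continuous_on UNIV (\<lambda>x::nat \<Rightarrow> real. x k)" by (rule continuous_on_coord)
    then show "continuous_map euclidean euclideanreal (\<lambda>x::nat \<Rightarrow> real. restrict x {..<d} k)"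
      using k by simp
  qed auto
  ultimately have "closedin euclidean {x \<in> topspace euclidean. restrict x {..<d} \<in> K}"
    by (rule closedin_continuous_map_preimage[rotated])
  then show "closed (cylinder d K)" by (simp add: cylinder_def)
  show "convex_set (cylinder d K)" unfolding convex_set_def
  proof (intro ballI allI impI)
    fix x y and u v :: real
    assume *: "x \<in> cylinder d K" "y \<in> cylinder d K" "0 \<le> u" "0 \<le> v" "u + v = 1"
    then have "(\<lambda>i\<in>{..<d}. u * restrict x {..<d} i + v * restrict y {..<d} i) \<in> K"
      using conv unfolding convex_Rd_def cylinder_def mem_Collect_eq by blast
    also have "(\<lambda>i\<in>{..<d}. u * restrict x {..<d} i + v * restrict y {..<d} i)
        = (\<lambda>i\<in>{..<d}. u * x i + v * y i)"
      by (rule restrict_ext) simp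
    finally show "(\<lambda>i. u * x i + v * y i) \<in> cylinder d K" unfolding cylinder_def mem_Collect_eq .
  qed
  show "cylindrical d (cylinder d K)" unfolding cylindrical_def
  proof (intro allI impI)
    fix x y assume *: "x \<in> cylinder d K" "\<forall>i<d. x i = y i"
    have "restrict x {..<d} = restrict y {..<d}" using *(2) by (intro restrict_ext) simp
    then show "y \<in> cylinder d K" using *(1) by (simp add: cylinder_def)
  qed
qed

lemma convex_body_bounded:
  assumes "convex_body d K"
  obtains R where "\<And>z k. z \<in> cylinder d K \<Longrightarrow> k < d \<Longrightarrow> \<bar>z k\<bar> \<le> R"
proof -
  have comp: "compactin (Rd_topology d) K" using assms by (simp add: convex_body_def)
  have "\<exists>r. \<forall>x\<in>K. \<bar>x k\<bar> \<le> r" if k: "k < d" for k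
  proof -
    have "continuous_map (Rd_topology d) euclideanreal (\<lambda>x. x k)"
      unfolding Rd_topology_def using k by (intro continuous_map_product_projection) auto
    then have "compactin euclideanreal ((\<lambda>x. x k) ` K)" by (rule image_compactin[OF comp])
    then have "bounded ((\<lambda>x. x k) ` K)" by (simp add: compactin_euclidean_iff compact_imp_bounded)
    then obtain r where "\<forall>y\<in>(\<lambda>x. x k) ` K. norm y \<le> r" unfolding bounded_iff ..
    then show ?thesis by auto
  qed
  then obtain r where r: "\<And>k x. k < d \<Longrightarrow> x \<in> K \<Longrightarrow> \<bar>x k\<bar> \<le> r k" by metis
  show ?thesis
  proof (rule that[of "\<Sum>k<d. \<bar>r k\<bar>"])
    fix z k assume z: "z \<in> cylinder d K" "k < d"
    have "\<bar>restrict z {..<d} k\<bar> \<le> r k" using r[OF z(2)] z(1) by (simp only: cylinder_def mem_Collect_eq)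
    then have "\<bar>z k\<bar> \<le> \<bar>r k\<bar>" using z(2) by simp
    also have "\<dots> \<le> (\<Sum>k<d. \<bar>r k\<bar>)" using z(2) by (intro member_le_sum) auto
    finally show "\<bar>z k\<bar> \<le> (\<Sum>k<d. \<bar>r k\<bar>)" .
  qed
qed

lemma Det_entries: "A \<in> carrier_mat d d \<Longrightarrow> Det d (\<lambda>i j. A $$ (i, j)) = det A"
proof -
  assume "A \<in> carrier_mat d d"
  then have "mat d d (\<lambda>(i, j). A $$ (i, j)) = A" by (intro eq_matI) auto
  then show ?thesis by (simp add: Det_def)
qed

lemma invertible_mat_det:
  fixes A :: "real mat"
  assumes A: "A \<in> carrier_mat d d"
  shows "invertible_mat A \<longleftrightarrow> det A \<noteq> 0"
proof
  assume "invertible_mat A"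
  then obtain B where B: "A * B = 1\<^sub>m (dim_row A)" "B * A = 1\<^sub>m (dim_row B)"
    by (auto simp: invertible_mat_def inverts_mat_def)
  have "dim_col B = d" using arg_cong[OF B(1), of dim_col] A by simp
  moreover have "dim_row B = d" using arg_cong[OF B(2), of dim_col] A by simp
  ultimately have "B \<in> carrier_mat d d" by auto
  then have "det A * det B = 1" using det_mult[OF A, of B] B(1) A by simp
  then show "det A \<noteq> 0" by auto
next
  assume "det A \<noteq> 0"
  then have "A \<in> Units (ring_mat TYPE(real) d ())" by (rule det_non_zero_imp_unit[OF A])
  then obtain B where B: "B \<in> carrier_mat d d" "B * A = 1\<^sub>m d" "A * B = 1\<^sub>m d"
    by (auto simp: Units_def ring_mat_def)
  then show "invertible_mat A"
    using A by (auto simp: invertible_mat_def inverts_mat_def square_mat.simps intro!: exI[of _ B])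
qed

lemma affine_map_entries:
  "affine_map_Rd d A b = (\<lambda>x. \<lambda>i\<in>{..<d}. app_mat d (\<lambda>i j. A $$ (i, j)) x i + b i)"
  by (rule ext) (simp add: affine_map_Rd_def app_mat_def)

lemma contains_ellipsoidD:
  assumes "contains_ellipsoid_of_volume_at_least d v S"
  obtains A b where "v / ball_volume d \<le> \<bar>Det d A\<bar>" "ellipsoid_in d A b (cylinder d S)"
proof -
  obtain A b where A: "A \<in> carrier_mat d d" "invertible_mat A"
     and S: "affine_map_Rd d A b ` unit_ball_Rd d \<subseteq> S"
     and v: "v \<le> measure (Rd_lebesgue d) (affine_map_Rd d A b ` unit_ball_Rd d)"
    using assms by (auto simp: contains_ellipsoid_of_volume_at_least_def ellipsoid_def)
  define A' where "A' = (\<lambda>i j. A $$ (i, j))"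
  have "Det d A' \<noteq> 0" using Det_entries[OF A(1)] invertible_mat_det[OF A(1)] A(2) by (simp add: A'_def)
  from measure_ellipsoid[OF this, of b] v have "v \<le> \<bar>Det d A'\<bar> * ball_volume d"
    by (simp add: affine_map_entries A'_def)
  then have 1: "v / ball_volume d \<le> \<bar>Det d A'\<bar>" using ball_volume_pos[of d] by (simp add: divide_simps)
  have 2: "ellipsoid_in d A' b (cylinder d S)" unfolding ellipsoid_in_def
  proof (intro allI impI)
    fix x assume x: "norm_Rd d x \<le> 1"
    have "norm_Rd d (restrict x {..<d}) = norm_Rd d x" by (rule norm_Rd_cong) simp
    then have "restrict x {..<d} \<in> unit_ball_Rd d" using x by (simp add: unit_ball_Rd_def Rd_def)
    then have "affine_map_Rd d A b (restrict x {..<d}) \<in> S" using S by blast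
    moreover have "app_mat d A' (restrict x {..<d}) = app_mat d A' x" by (rule app_mat_cong) simp
    ultimately show "(\<lambda>i. app_mat d A' x i + b i) \<in> cylinder d S"
      by (simp add: cylinder_def affine_map_entries A'_def)
  qed
  show ?thesis using that[OF 1 2] .
qed

lemma contains_ellipsoidI:
  assumes "ellipsoid_in d A b (cylinder d S)" "v \<le> \<bar>Det d A\<bar> * ball_volume d" "v > 0"
  shows "contains_ellipsoid_of_volume_at_least d v S"
proof -
  have D: "Det d A \<noteq> 0" using assms(2,3) by auto
  define A' where "A' = mat d d (\<lambda>(i, j). A i j)"
  define b' where "b' = restrict b {..<d}"
  have A': "A' \<in> carrier_mat d d" by (simp add: A'_def)
  have b': "b' \<in> Rd d" by (simp add: Rd_def b'_def)
  have "invertible_mat A'" using D invertible_mat_det[OF A'] by (simp add: Det_def A'_def)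
  have map: "affine_map_Rd d A' b' = (\<lambda>x. \<lambda>i\<in>{..<d}. app_mat d A x i + b i)"
    by (rule ext) (auto simp: affine_map_Rd_def app_mat_def A'_def b'_def intro!: restrict_ext)
  show ?thesis unfolding contains_ellipsoid_of_volume_at_least_def
  proof (intro exI conjI)
    show "ellipsoid d (affine_map_Rd d A' b' ` unit_ball_Rd d)"
      unfolding ellipsoid_def using A' \<open>invertible_mat A'\<close> b' by blast
    show "affine_map_Rd d A' b' ` unit_ball_Rd d \<subseteq> S"
    proof
      fix y assume "y \<in> affine_map_Rd d A' b' ` unit_ball_Rd d"
      then obtain x where x: "norm_Rd d x \<le> 1" "y = (\<lambda>i\<in>{..<d}. app_mat d A x i + b i)"
        unfolding map by (auto simp: unit_ball_Rd_def)
      then show "y \<in> S" using ellipsoid_inD[OF assms(1) x(1)] by (simp add: cylinder_def)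
    qed
    show "v \<le> measure (Rd_lebesgue d) (affine_map_Rd d A' b' ` unit_ball_Rd d)"
      unfolding map measure_ellipsoid[OF D] by (rule assms(2))
  qed
qed

text \<open>
  Passes from selections given by a set of indices to selections given by an increasing
  enumeration.
\<close>

lemma enumerate_finite_nat_set:
  fixes J :: "nat set"
  assumes "finite J"
  obtains idx where "strict_mono_on {1..card J} idx" "idx ` {1..card J} = J"
proof
  define idx where "idx = (\<lambda>k. sorted_list_of_set J ! (k - 1))"
  let ?l = "sorted_list_of_set J"
  have len: "length ?l = card J" by simp
  have sorted: "sorted_wrt (<) ?l" by simp
  show "strict_mono_on {1..card J} (\<lambda>k. ?l ! (k - 1))"
  proof (rule strict_mono_onI)
    fix r s assume "r \<in> {1..card J}" "s \<in> {1..card J}" "r < s"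
    then show "?l ! (r - 1) < ?l ! (s - 1)"
      using sorted_wrt_nth_less[OF sorted, of "r - 1" "s - 1"] len by simp
  qed
  have "(\<lambda>k. ?l ! (k - 1)) ` {1..card J} = (\<lambda>k. ?l ! k) ` {0..<card J}"
  proof -
    have "{0..<card J} = (\<lambda>k. k - 1) ` {1..card J}" by (force simp: image_iff intro: bexI[of _ "Suc _"])
    then show ?thesis by (simp add: image_image)
  qed
  also have "\<dots> = set ?l" using nth_image[of "card J" ?l] len by (simp add: atLeast0LessThan take_all)
  also have "\<dots> = J" using assms by simp
  finally show "(\<lambda>k. ?l ! (k - 1)) ` {1..card J} = J" .
qed

lemma volume_bound_power:
  assumes "d \<ge> 1"
  shows "(1 / (54 * (real d)\<^sup>2 * sqrt (real d)) ^ d / 8 ^ d) ^ d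
    = (1 / 432) ^ d\<^sup>2 * real d powr (- 5 * (real d)\<^sup>2 / 2)"
proof -
  have d: "real d > 0" using assms by simp
  have "(real d)\<^sup>2 * sqrt (real d) = real d powr 2 * real d powr (1 / 2)"
    using d by (simp add: powr_half_sqrt)
  also have "\<dots> = real d powr (5 / 2)" by (simp only: powr_add[symmetric]) simp
  finally have 1: "(real d)\<^sup>2 * sqrt (real d) = real d powr (5 / 2)" .
  have "1 / (54 * (real d)\<^sup>2 * sqrt (real d)) ^ d / 8 ^ d = (1 / (432 * ((real d)\<^sup>2 * sqrt (real d)))) ^ d"
    by (simp add: power_divide power_mult_distrib[symmetric] mult_ac)
  also have "\<dots> = ((1 / 432) * real d powr (- 5 / 2)) ^ d"
    unfolding 1 by (simp add: powr_minus field_simps)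
  finally have "(1 / (54 * (real d)\<^sup>2 * sqrt (real d)) ^ d / 8 ^ d) ^ d = (((1 / 432) * real d powr (- 5 / 2)) ^ d) ^ d"
    by simp
  also have "\<dots> = ((1 / 432) * real d powr (- 5 / 2)) ^ d\<^sup>2" by (simp add: power_mult[symmetric] power2_eq_square)
  also have "\<dots> = (1 / 432) ^ d\<^sup>2 * (real d powr (- 5 / 2)) ^ d\<^sup>2" by (simp only: power_mult_distrib)
  also have "(real d powr (- 5 / 2)) ^ d\<^sup>2 = real d powr (- 5 * (real d)\<^sup>2 / 2)"
    using d by (subst powr_realpow[symmetric]) (simp_all add: powr_powr)
  finally show ?thesis .
qed

theorem theorem1p1:
  shows "\<exists>c::real. c > 0 \<and> (\<forall>d::nat. d \<ge> 1 \<longrightarrow>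
    (\<forall>\<C> :: nat \<Rightarrow> (nat \<Rightarrow> real) set set.
      (\<forall>i\<in>{1..3*d}. finite (\<C> i) \<and> (\<forall>C\<in>\<C> i. convex_body d C)) \<longrightarrow>
      (\<forall>(idx :: nat \<Rightarrow> nat) (K :: nat \<Rightarrow> (nat \<Rightarrow> real) set).
         strict_mono_on {1..2*d} idx \<longrightarrow>
         (\<forall>k\<in>{1..2*d}. idx k \<in> {1..3*d} \<and> K k \<in> \<C> (idx k)) \<longrightarrow>
         contains_ellipsoid_of_volume_at_least d 1 (\<Inter>k\<in>{1..2*d}. K k)) \<longrightarrow>
      (\<exists>i\<in>{1..3*d}. contains_ellipsoid_of_volume_at_least d
         (c ^ (d\<^sup>2) * real d powr (- 5 * (real d)\<^sup>2 / 2)) (\<Inter>C\<in>\<C> i. C))))"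
proof (intro exI[of _ "1 / 432"] conjI allI impI)
  fix d :: nat and \<C> :: "nat \<Rightarrow> (nat \<Rightarrow> real) set set"
  assume d: "1 \<le> d" and bodies: "\<forall>i\<in>{1..3*d}. finite (\<C> i) \<and> (\<forall>C\<in>\<C> i. convex_body d C)"
    and hyp: "\<forall>(idx :: nat \<Rightarrow> nat) (K :: nat \<Rightarrow> (nat \<Rightarrow> real) set).
         strict_mono_on {1..2*d} idx \<longrightarrow>
         (\<forall>k\<in>{1..2*d}. idx k \<in> {1..3*d} \<and> K k \<in> \<C> (idx k)) \<longrightarrow>
         contains_ellipsoid_of_volume_at_least d 1 (\<Inter>k\<in>{1..2*d}. K k)"
  define v where "v = (1 / 432) ^ d\<^sup>2 * real d powr (- 5 * (real d)\<^sup>2 / 2)"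
  have v: "v > 0" using d by (simp add: v_def)
  have om: "ball_volume d > 0" by (rule ball_volume_pos)
  have "\<exists>i\<in>{1..3*d}. \<exists>A b. v \<le> \<bar>Det d A\<bar> * ball_volume d \<and> (\<forall>C\<in>\<C> i. ellipsoid_in d A b (cylinder d C))"
  proof (cases "\<exists>i\<in>{1..3*d}. \<C> i = {}")
    case True
    then obtain i where i: "i \<in> {1..3*d}" "\<C> i = {}" by blast
    \<comment> \<open>an empty family has the whole space as its intersection, and a large ball suffices\<close>
    define s where "s = v / ball_volume d + 1"
    have s: "v / ball_volume d \<le> s" "1 \<le> s" using v om by (auto simp: s_def)
    have "v / ball_volume d \<le> s ^ d" using s self_le_power[of s d] d by linarith
    then have "v \<le> \<bar>Det d (\<lambda>i j. s * id_mat i j)\<bar> * ball_volume d" using s om by (simp add: Det_scale field_simps)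
    then show ?thesis using i by blast
  next
    case False
    have "\<exists>R. \<forall>z\<in>cylinder d C. \<forall>k<d. \<bar>z k\<bar> \<le> R" if "convex_body d C" for C
      using convex_body_bounded[OF that] by metis
    then obtain r where r: "\<And>C z k. convex_body d C \<Longrightarrow> z \<in> cylinder d C \<Longrightarrow> k < d \<Longrightarrow> \<bar>z k\<bar> \<le> r C"
      by metis
    define B where "B = (\<Union>i\<in>{1..3*d}. \<C> i)"
    have finB: "finite B" using bodies by (auto simp: B_def)
    define R where "R = 1 + (\<Sum>C\<in>B. \<bar>r C\<bar>)"
    have R: "1 \<le> R" by (simp add: R_def sum_nonneg)
    have "\<exists>i\<in>{1..3*d}. \<exists>A b.
      (1 / (54 * (real d)\<^sup>2 * sqrt (real d)) ^ d / 8 ^ d) ^ d * (1 / ball_volume d) \<le> \<bar>Det d A\<bar> \<and>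
      (\<forall>C\<in>cylinder d ` \<C> i. ellipsoid_in d A b C)"
    proof (rule colourful_core[OF d _ R])
      show "1 / ball_volume d > 0" using om by simp
      fix i assume i: "i \<in> {1..3*d}"
      show "finite (cylinder d ` \<C> i)" "cylinder d ` \<C> i \<noteq> {}" using i bodies False by auto
      fix C assume C: "C \<in> cylinder d ` \<C> i"
      then obtain C' where C': "C' \<in> \<C> i" "C = cylinder d C'" by blast
      then have cb: "convex_body d C'" using i bodies by blast
      then show "closed_convex d C" unfolding C'(2) by (rule closed_convex_cylinder)
      fix z k assume "z \<in> C" "k < d"
      then have "\<bar>z k\<bar> \<le> r C'" using r[OF cb] C'(2) by blast
      also have "\<dots> \<le> \<bar>r C'\<bar>" by simp
      also have "\<dots> \<le> (\<Sum>C\<in>B. \<bar>r C\<bar>)" using finB i C'(1) by (intro member_le_sum) (auto simp: B_def)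
      also have "\<dots> \<le> R" by (simp add: R_def)
      finally show "\<bar>z k\<bar> \<le> R" .
    next
      show "\<forall>J K. J \<subseteq> {1..3*d} \<longrightarrow> card J = 2*d \<longrightarrow> (\<forall>j\<in>J. K j \<in> cylinder d ` \<C> j) \<longrightarrow>
        (\<exists>A b. 1 / ball_volume d \<le> \<bar>Det d A\<bar> \<and> (\<forall>j\<in>J. ellipsoid_in d A b (K j)))"
      proof (intro allI impI)
        fix J K assume J: "J \<subseteq> {1..3*d}" "card J = 2*d" and K: "\<forall>j\<in>J. K j \<in> cylinder d ` \<C> j"
        have "\<forall>j\<in>J. \<exists>C. C \<in> \<C> j \<and> K j = cylinder d C" using K by blast
        from bchoice[OF this] obtain K' where K': "\<forall>j\<in>J. K' j \<in> \<C> j \<and> K j = cylinder d (K' j)" ..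
        have "finite J" using J(1) finite_subset by blast
        then obtain idx where idx: "strict_mono_on {1..2*d} idx" "idx ` {1..2*d} = J"
          using enumerate_finite_nat_set[of J] J(2) by metis
        have in_J: "idx k \<in> J" if "k \<in> {1..2*d}" for k using idx(2) that by blast
        have "\<forall>k\<in>{1..2*d}. idx k \<in> {1..3*d} \<and> K' (idx k) \<in> \<C> (idx k)"
          using in_J J(1) K' by blast
        from mp[OF mp[OF spec[OF spec[OF hyp, of idx], of "\<lambda>k. K' (idx k)"] idx(1)] this]
        obtain A b where A: "1 / ball_volume d \<le> \<bar>Det d A\<bar>" "ellipsoid_in d A b (cylinder d (\<Inter>k\<in>{1..2*d}. K' (idx k)))"
          by (rule contains_ellipsoidD)
        have "ellipsoid_in d A b (K j)" if j: "j \<in> J" for j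
        proof -
          obtain k where k: "k \<in> {1..2*d}" "j = idx k" using idx(2) j by blast
          have "K j = cylinder d (K' (idx k))" using K' j k(2) by blast
          then show ?thesis using A(2) k(1) by (auto simp: ellipsoid_in_def cylinder_def)
        qed
        then show "\<exists>A b. 1 / ball_volume d \<le> \<bar>Det d A\<bar> \<and> (\<forall>j\<in>J. ellipsoid_in d A b (K j))" using A(1) by blast
      qed
    qed
    then obtain i A b where i: "i \<in> {1..3*d}" "v * (1 / ball_volume d) \<le> \<bar>Det d A\<bar>" "\<forall>C\<in>cylinder d ` \<C> i. ellipsoid_in d A b C"
      unfolding volume_bound_power[OF d] v_def by blast
    have "v \<le> \<bar>Det d A\<bar> * ball_volume d" using i(2) om by (simp add: field_simps)
    then show ?thesis using i(1,3) by blast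
  qed
  then obtain i A b where i: "i \<in> {1..3*d}" and A: "v \<le> \<bar>Det d A\<bar> * ball_volume d" "\<forall>C\<in>\<C> i. ellipsoid_in d A b (cylinder d C)"
    by blast
  have "ellipsoid_in d A b (cylinder d (\<Inter>C\<in>\<C> i. C))" using A(2) by (auto simp: ellipsoid_in_def cylinder_def)
  from contains_ellipsoidI[OF this A(1) v] i
  show "\<exists>i\<in>{1..3*d}. contains_ellipsoid_of_volume_at_least d
     ((1 / 432) ^ (d\<^sup>2) * real d powr (- 5 * (real d)\<^sup>2 / 2)) (\<Inter>C\<in>\<C> i. C)"
    unfolding v_def by blast
qed simp

end
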